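(* Let $V$ be a finite-dimensional real vector space with a non-degenerate inner product of signature $(p,q)$, where $p\ge 2$ and $q\ge 2$, and let $\mathfrak{R}$ be a Szabó tensor on $V$ with Szabó operator $\mathfrak{S}$. Let $\operatorname{Spec}^{+}\{\mathfrak{S}\}$ (resp. $\operatorname{Spec}^{-}\{\mathfrak{S}\}$) be the common spectrum of $\mathfrak{S}(v)$ for $v\in S^{+}(V)$ (resp. $v\in S^{-}(V)$). Then: 1. $\operatorname{Spec}^{\pm}\{\mathfrak{S}\}=-\operatorname{Spec}^{\pm}\{\mathfrak{S}\}=\sqrt{-1}\,\operatorname{Spec}^{\mp}\{\mathfrak{S}\}$; 2. $\operatorname{Spec}^{\pm}\{\mathfrak{S}\}\subset\mathbb{R}\cup\sqrt{-1}\,\mathbb{R}$; 3. if $p<q$, then $\operatorname{Spec}^{+}\{\mathfrak{S}\}\subset\sqrt{-1}\,\mathbb{R}$ and $\operatorname{Spec}^{-}\{\mathfrak{S}\}\subset\mathbb{R}$; 4. if $q<p$, then $\operatorname{Spec}^{+}\{\mathfrak{S}\}\subset\mathbb{R}$ and $\operatorname{Spec}^{-}\{\mathfrak{S}\}\subset\sqrt{-1}\,\mathbb{R}$.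
   Context: Signature $(p,q)$ means that maximal timelike (negative definite) subspaces have dimension $p$ and maximal spacelike (positive definite) subspaces have dimension $q$; $\dim V=p+q$. The pseudo-spheres are $S^{\pm}(V)=\{v\in V:(v,v)=\pm1\}$. An algebraic covariant derivative curvature tensor on $V$ is a tensor $\mathfrak{R}\in\otimes^5V^*$ such that for all $x,y,z,w,v\in V$: $\mathfrak{R}(x,y,z,w;v)=\mathfrak{R}(z,w,x,y;v)=-\mathfrak{R}(y,x,z,w;v)$; $\mathfrak{R}(x,y,z,w;v)+\mathfrak{R}(y,z,x,w;v)+\mathfrak{R}(z,x,y,w;v)=0$; $\mathfrak{R}(x,y,z,w;v)+\mathfrak{R}(x,y,w,v;z)+\mathfrak{R}(x,y,v,z;w)=0$. Its Szabó operator is the linear map $\mathfrak{S}(v):V\to V$ (for $v\in V$) characterized by $(\mathfrak{S}(v)y,z)=\mathfrak{R}(y,v,v,z;v)$ for all $y,z\in V$; it is self-adjoint with respect to $(\cdot,\cdot)$. The spectrum $\operatorname{Spec}\{A\}\subset\mathbb{C}$ of a linear map $A$ is its set of complex eigenvalues. $\mathfrak{R}$ is spacelike Szabó (resp. timelike Szabó) if $\operatorname{Spec}\{\mathfrak{S}(v)\}$ is constant for $v\in S^{+}(V)$ (resp. $v\in S^{-}(V)$). These two notions are known to be equivalent, and such an $\mathfrak{R}$ is called a Szabó tensor. For a set $T\subset\mathbb{C}$ and $c\in\mathbb{C}$, $cT=\{ct:t\in T\}$. *)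

theory Defs
  imports "HOL-Analysis.Analysis"
begin

section \<open>Inner products of indefinite signature\<close>

definition nondegenerate_inner_product :: "('a::real_vector \<Rightarrow> 'a \<Rightarrow> real) \<Rightarrow> bool" where
  "nondegenerate_inner_product g \<longleftrightarrow>
     bilinear g \<and> (\<forall>x y. g x y = g y x) \<and> (\<forall>x. (\<forall>y. g x y = 0) \<longrightarrow> x = 0)"

definition timelike_subspace :: "('a::real_vector \<Rightarrow> 'a \<Rightarrow> real) \<Rightarrow> 'a set \<Rightarrow> bool" where
  "timelike_subspace g W \<longleftrightarrow> subspace W \<and> (\<forall>x\<in>W. x \<noteq> 0 \<longrightarrow> g x x < 0)"

definition spacelike_subspace :: "('a::real_vector \<Rightarrow> 'a \<Rightarrow> real) \<Rightarrow> 'a set \<Rightarrow> bool" where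
  "spacelike_subspace g W \<longleftrightarrow> subspace W \<and> (\<forall>x\<in>W. x \<noteq> 0 \<longrightarrow> g x x > 0)"

text \<open>Maximality is with respect to inclusion; the negative index \<open>p\<close> comes first.\<close>

definition has_signature :: "('a::real_vector \<Rightarrow> 'a \<Rightarrow> real) \<Rightarrow> nat \<Rightarrow> nat \<Rightarrow> bool" where
  "has_signature g p q \<longleftrightarrow>
     (\<forall>W. timelike_subspace g W \<and> (\<forall>U. timelike_subspace g U \<and> W \<subseteq> U \<longrightarrow> U = W) \<longrightarrow> dim W = p) \<and>
     (\<forall>W. spacelike_subspace g W \<and> (\<forall>U. spacelike_subspace g U \<and> W \<subseteq> U \<longrightarrow> U = W) \<longrightarrow> dim W = q) \<and>
     dim (UNIV :: 'a set) = p + q"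

definition spacelike_sphere :: "('a \<Rightarrow> 'a \<Rightarrow> real) \<Rightarrow> 'a set" where
  "spacelike_sphere g = {v. g v v = 1}"

definition timelike_sphere :: "('a \<Rightarrow> 'a \<Rightarrow> real) \<Rightarrow> 'a set" where
  "timelike_sphere g = {v. g v v = - 1}"

section \<open>Complex spectrum of a real linear map\<close>

text \<open>
  The complexification of a real vector space is modelled on pairs, \<open>(x, y)\<close> standing
  for \<open>x + \<i> y\<close>. The map \<open>A\<close> extends to it as \<open>map_prod A A\<close>.
\<close>

definition complex_scale :: "complex \<Rightarrow> 'a::real_vector \<times> 'a \<Rightarrow> 'a \<times> 'a" where
  "complex_scale c w =
     (Re c *\<^sub>R fst w - Im c *\<^sub>R snd w, Re c *\<^sub>R snd w + Im c *\<^sub>R fst w)"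

lemma vector_space_complex_scale:
  "vector_space (complex_scale :: complex \<Rightarrow> 'a::real_vector \<times> 'a \<Rightarrow> 'a \<times> 'a)"
  by unfold_locales (auto simp: complex_scale_def algebra_simps)

lemma map_prod_complex_scale:
  assumes "linear A"
  shows "map_prod A A (complex_scale c w) = complex_scale c (map_prod A A w)"
  using assms by (simp add: complex_scale_def linear_add linear_diff linear_scale)

definition complex_spectrum :: "('a::real_vector \<Rightarrow> 'a) \<Rightarrow> complex set" where
  "complex_spectrum A = {c. \<exists>w. w \<noteq> 0 \<and> map_prod A A w = complex_scale c w}"

section \<open>Covariant derivative curvature tensors and the Szabo operator\<close>

text \<open>\<open>R x y z w v\<close> is the value usually written \<open>R(x, y, z, w; v)\<close>.\<close>

definition multilinear5 ::
  "('a::real_vector \<Rightarrow> 'a \<Rightarrow> 'a \<Rightarrow> 'a \<Rightarrow> 'a \<Rightarrow> real) \<Rightarrow> bool" where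
  "multilinear5 R \<longleftrightarrow>
     (\<forall>y z w v. linear (\<lambda>x. R x y z w v)) \<and>
     (\<forall>x z w v. linear (\<lambda>y. R x y z w v)) \<and>
     (\<forall>x y w v. linear (\<lambda>z. R x y z w v)) \<and>
     (\<forall>x y z v. linear (\<lambda>w. R x y z w v)) \<and>
     (\<forall>x y z w. linear (\<lambda>v. R x y z w v))"

definition covariant_derivative_curvature_tensor ::
  "('a::real_vector \<Rightarrow> 'a \<Rightarrow> 'a \<Rightarrow> 'a \<Rightarrow> 'a \<Rightarrow> real) \<Rightarrow> bool" where
  "covariant_derivative_curvature_tensor R \<longleftrightarrow>
     multilinear5 R \<and>
     (\<forall>x y z w v. R x y z w v = R z w x y v) \<and>
     (\<forall>x y z w v. R x y z w v = - R y x z w v) \<and>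
     (\<forall>x y z w v. R x y z w v + R y z x w v + R z x y w v = 0) \<and>
     (\<forall>x y z w v. R x y z w v + R x y w v z + R x y v z w = 0)"

definition szabo_operator ::
  "('a::real_vector \<Rightarrow> 'a \<Rightarrow> real) \<Rightarrow> ('a \<Rightarrow> 'a \<Rightarrow> 'a \<Rightarrow> 'a \<Rightarrow> 'a \<Rightarrow> real) \<Rightarrow> 'a \<Rightarrow> 'a \<Rightarrow> 'a" where
  "szabo_operator g R v = (THE A. linear A \<and> (\<forall>y z. g (A y) z = R y v v z v))"

text \<open>In finite dimension the definite description is well defined.\<close>

lemma nondegenerate_riesz:
  fixes g :: "'a::real_vector \<Rightarrow> 'a \<Rightarrow> real"
  assumes fin: "\<exists>B. finite B \<and> span B = (UNIV :: 'a set)"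
    and g: "nondegenerate_inner_product g" and f: "linear f"
  shows "\<exists>x. \<forall>z. g x z = f z"
proof -
  obtain B0 :: "'a set" where B0: "finite B0" "span B0 = UNIV" using fin by blast
  obtain B where B: "B \<subseteq> B0" "independent B" "span B = (UNIV :: 'a set)"
    using maximal_independent_subset[of B0] B0(2)
    by (metis dual_order.antisym span_mono span_span subset_UNIV)
  have finB: "finite B" using B(1) B0(1) finite_subset by blast
  interpret fd: finite_dimensional_vector_space "scaleR :: real \<Rightarrow> 'a \<Rightarrow> 'a" B
    by unfold_locales
      (use finB B in \<open>auto simp: dependent_raw_def span_raw_def\<close>)
  have lin1: "linear (\<lambda>x. g x y)" and lin2: "linear (g x)" for x y
    using g by (auto simp: nondegenerate_inner_product_def bilinear_def)
  define T where "T x = (\<Sum>b\<in>B. g x b *\<^sub>R b)" for x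
  have linT: "linear T"
    by (rule linearI)
      (simp_all add: T_def linear_add[OF lin1] linear_scale[OF lin1] scaleR_add_left
        sum.distrib scaleR_sum_right)
  have ext: "g x z = h z" if "\<And>b. b \<in> B \<Longrightarrow> g x b = h b" "linear h" for x z h
    using linear_eq_on[OF lin2 that(2), of z B] that(1) B(3) by auto
  have "T x = 0 \<Longrightarrow> x = 0" for x
  proof -
    assume "T x = 0"
    then have "g x b = 0" if "b \<in> B" for b
      using independentD[OF B(2) finB order_refl, of "g x"] that by (simp add: T_def)
    then have "\<forall>z. g x z = 0" using ext[of x "\<lambda>_. 0"] by (simp add: linear_zero)
    then show "x = 0" using g by (simp add: nondegenerate_inner_product_def)
  qed
  then have "inj T" using linT by (simp add: linear_injective_0)
  then have "surj T" using fd.linear_inj_imp_surj linT by (simp add: linear_def)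
  then obtain x where x: "T x = (\<Sum>b\<in>B. f b *\<^sub>R b)" by (metis surjD)
  then have "(\<Sum>b\<in>B. (g x b - f b) *\<^sub>R b) = 0"
    by (simp add: T_def scaleR_diff_left sum_subtractf)
  then have "g x b = f b" if "b \<in> B" for b
    using independentD[OF B(2) finB order_refl, of "\<lambda>b. g x b - f b"] that by auto
  then show ?thesis using ext f by blast
qed

lemma szabo_operator_ex1:
  fixes g :: "'a::real_vector \<Rightarrow> 'a \<Rightarrow> real"
  assumes fin: "\<exists>B. finite B \<and> span B = (UNIV :: 'a set)"
    and g: "nondegenerate_inner_product g" and R: "multilinear5 R"
  shows "\<exists>!A. linear A \<and> (\<forall>y z. g (A y) z = R y v v z v)"
proof -
  have eq: "x = x'" if "\<And>z. g x z = g x' z" for x x'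
  proof -
    have lin: "linear (\<lambda>x. g x z)" for z
      using g by (auto simp: nondegenerate_inner_product_def bilinear_def)
    have "\<forall>z. g (x - x') z = 0" using that by (simp add: linear_diff[OF lin])
    then have "x - x' = 0" using g unfolding nondegenerate_inner_product_def by blast
    then show ?thesis by simp
  qed
  have lin1: "linear (\<lambda>x. g x y)" for y
    using g by (auto simp: nondegenerate_inner_product_def bilinear_def)
  have R1: "linear (\<lambda>y. R y v v z v)" and R4: "linear (\<lambda>z. R y v v z v)" for y z
    using R by (auto simp: multilinear5_def)
  have "\<exists>x. \<forall>z. g x z = R y v v z v" for y
    by (rule nondegenerate_riesz[OF fin g R4])
  then obtain A where A: "g (A y) z = R y v v z v" for y z by metis
  have "linear A"
    by (rule linearI; rule eq)
      (simp_all add: A linear_add[OF lin1] linear_scale[OF lin1] linear_add[OF R1] linear_scale[OF R1])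
  then show ?thesis using A eq by (intro ex1I[of _ A]) (auto intro!: ext eq)
qed

section \<open>Szabo tensors\<close>

definition spacelike_szabo ::
  "('a::real_vector \<Rightarrow> 'a \<Rightarrow> real) \<Rightarrow> ('a \<Rightarrow> 'a \<Rightarrow> 'a \<Rightarrow> 'a \<Rightarrow> 'a \<Rightarrow> real) \<Rightarrow> bool" where
  "spacelike_szabo g R \<longleftrightarrow>
     (\<lambda>v. complex_spectrum (szabo_operator g R v)) constant_on spacelike_sphere g"

definition timelike_szabo ::
  "('a::real_vector \<Rightarrow> 'a \<Rightarrow> real) \<Rightarrow> ('a \<Rightarrow> 'a \<Rightarrow> 'a \<Rightarrow> 'a \<Rightarrow> 'a \<Rightarrow> real) \<Rightarrow> bool" where
  "timelike_szabo g R \<longleftrightarrow>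
     (\<lambda>v. complex_spectrum (szabo_operator g R v)) constant_on timelike_sphere g"

text \<open>
  The spacelike and timelike conditions are equivalent, by a theorem that is not assumed
  here. The disjunction makes either of them suffice.
\<close>

definition szabo_tensor ::
  "('a::real_vector \<Rightarrow> 'a \<Rightarrow> real) \<Rightarrow> ('a \<Rightarrow> 'a \<Rightarrow> 'a \<Rightarrow> 'a \<Rightarrow> 'a \<Rightarrow> real) \<Rightarrow> bool" where
  "szabo_tensor g R \<longleftrightarrow>
     covariant_derivative_curvature_tensor R \<and> (spacelike_szabo g R \<or> timelike_szabo g R)"

text \<open>
  The common spectra. Each is determined when the pseudo-sphere is nonempty and the
  spectrum is constant on it.
\<close>

definition spec_plus ::
  "('a::real_vector \<Rightarrow> 'a \<Rightarrow> real) \<Rightarrow> ('a \<Rightarrow> 'a \<Rightarrow> 'a \<Rightarrow> 'a \<Rightarrow> 'a \<Rightarrow> real) \<Rightarrow> complex set" where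
  "spec_plus g R =
     (THE T. \<forall>v\<in>spacelike_sphere g. complex_spectrum (szabo_operator g R v) = T)"

definition spec_minus ::
  "('a::real_vector \<Rightarrow> 'a \<Rightarrow> real) \<Rightarrow> ('a \<Rightarrow> 'a \<Rightarrow> 'a \<Rightarrow> 'a \<Rightarrow> 'a \<Rightarrow> real) \<Rightarrow> complex set" where
  "spec_minus g R =
     (THE T. \<forall>v\<in>timelike_sphere g. complex_spectrum (szabo_operator g R v) = T)"

end

theory Submission
  imports Defs "HOL-Homology.Homology" "HOL-Computational_Algebra.Fundamental_Theorem_Algebra"
begin

text \<open>
  The proof shows more: the Szabo operators are nilpotent, so that both spectra are \<open>{0}\<close>.
  In a \<open>g\<close>-orthonormal basis, after multiplying the timelike vectors by \<open>\<i>\<close>, the Szabo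
  operator becomes a complex symmetric matrix \<open>M z\<close>, cubic in \<open>z\<close>, with \<open>M z z = 0\<close>. If the
  spectrum is constant on one pseudo-sphere, a suitably homogenised annihilating polynomial is
  a polynomial identity in \<open>z\<close>, hence it also holds on the real unit sphere \<open>S\<close> of the form
  \<open>\<Sum>i. z\<^sub>i\<^sup>2\<close>. For an eigenvalue \<open>c \<noteq> 0\<close> there is therefore a family of complex
  orthogonal projections \<open>P x\<close>, polynomial in \<open>x \<in> S\<close>, with \<open>P x x = 0\<close>, and with
  \<open>P x (P (- x)) = 0\<close> because \<open>M (- x) = - M x\<close>. Transporting a vector of square \<open>1\<close> from the
  pole with these projections gives a section \<open>s\<close> over the closed upper hemisphere. On the
  equator \<open>s x\<close> is orthogonal to \<open>s (- x)\<close>, so the real part of \<open>s x\<close> can be deformed without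
  zeros to that of \<open>s x + s (- x)\<close>, and then extends to an even map of the whole sphere that never
  points against the position vector. Such a map is homotopic to the identity, of degree \<open>1\<close>,
  while even maps have even degree.
\<close>

section \<open>Maps between spheres\<close>

text \<open>The real part of \<open>bil n s s\<close> is the squared length of the real part of
  \<open>s\<close> minus that of its imaginary part, so a section of positive square has a real part
  without zeros; two orthogonal values \<open>s x\<close> and \<open>s (- x)\<close> can be added
  because their squares add. Orthogonality to a point is also orthogonality to its antipode, which
  is why an even extension from the upper hemisphere still avoids the direction opposite to the
  position vector. A hemisphere is used because every point of it is joined to the pole by a segment
  that stays away from the origin, while paths to the opposite pole would need a choice. The
  obstacle is the degree of an even map. Reading it off in homology relative to a punctured sphere
  requires a point missed by the image of the equator, and a merely continuous image of a sphere of
  lower dimension may fill the whole target. Hence Lipschitz bounds accompany the construction: the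
  projections are polynomial, transport consists of finitely many projections along a path, and a
  packing count then finds the missed point.\<close>

definition sph :: "nat \<Rightarrow> (nat \<Rightarrow> real) set" where
  "sph n = {x. (\<Sum>i\<le>n. (x i)\<^sup>2) = 1 \<and> (\<forall>i>n. x i = 0)}"

lemma nsphere_eq_top_of_set: "nsphere n = top_of_set (sph n)"
  by (simp add: nsphere sph_def euclidean_product_topology)

lemma continuous_on_coordinate:
  fixes f :: "'b::topological_space \<Rightarrow> 'c \<Rightarrow> 'd::topological_space"
  assumes "continuous_on S f"
  shows "continuous_on S (\<lambda>x. f x i)"
  using continuous_on_product_then_coordinatewise[OF assms] .

lemma normalize_in_sph:
  assumes "\<forall>i>n. x i = 0" "x \<noteq> (\<lambda>i. 0)"
  shows "(\<lambda>i. x i / sqrt (\<Sum>j\<le>n. (x j)\<^sup>2)) \<in> sph n" "(\<Sum>j\<le>n. (x j)\<^sup>2) > 0"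
proof -
  obtain i where "x i \<noteq> 0" using assms(2) by auto
  then have "i \<le> n" using assms(1) by (meson not_le)
  then show pos: "(\<Sum>j\<le>n. (x j)\<^sup>2) > 0"
    using \<open>x i \<noteq> 0\<close> by (intro sum_pos2[of _ i]) auto
  then show "(\<lambda>i. x i / sqrt (\<Sum>j\<le>n. (x j)\<^sup>2)) \<in> sph n"
    using assms(1) by (simp add: sph_def power_divide sum_nonneg flip: sum_divide_distrib)
qed

lemma continuous_on_normalize:
  fixes f :: "'b::topological_space \<Rightarrow> nat \<Rightarrow> real"
  assumes "continuous_on S f" "\<And>x. x \<in> S \<Longrightarrow> (\<Sum>j\<le>n. (f x j)\<^sup>2) > 0"
  shows "continuous_on S (\<lambda>x i. f x i / sqrt (\<Sum>j\<le>n. (f x j)\<^sup>2))"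
  by (intro continuous_on_coordinatewise_then_product continuous_intros 
       continuous_on_coordinate[OF assms(1)])
     (use assms(2) in force)

text \<open>The straight-line homotopy, projected radially. The target \<open>T\<close> is separate
  from \<open>sph n\<close> because contracting a punctured sphere requires the homotopy to avoid
  the puncture as well as the origin.\<close>

lemma homotopic_normalize_sph:
  assumes f: "continuous_on S f" "f ` S \<subseteq> sph n" and g: "continuous_on S g" "g ` S \<subseteq> sph n"
    and T: "T \<subseteq> sph n"
    and seg: "\<And>x t. x \<in> S \<Longrightarrow> t \<in> {0..1} \<Longrightarrow> 
       (\<lambda>i. (1 - t) * f x i + t * g x i) \<noteq> (\<lambda>i. 0) \<and>
       (\<lambda>i. ((1 - t) * f x i + t * g x i) / sqrt (\<Sum>j\<le>n. ((1 - t) * f x j + t * g x j)\<^sup>2)) \<in> T"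
  shows "homotopic_with_canon (\<lambda>x. True) S T f g"
proof -
  let ?h = "\<lambda>(t, x) i. (1 - t) * f x i + t * g x i"
  have nz: "(\<Sum>j\<le>n. (?h y j)\<^sup>2) > 0" if "y \<in> {0..1} \<times> S" for y
    using that seg[of "snd y" "fst y"] f g 
    by (intro normalize_in_sph(2)) (auto simp: sph_def case_prod_unfold image_subset_iff)
  have c: "continuous_on ({0..1} \<times> S) ?h"
    unfolding case_prod_unfold
    by (intro continuous_on_coordinatewise_then_product continuous_intros 
         continuous_on_compose2[OF continuous_on_coordinate[OF f(1)]] 
         continuous_on_compose2[OF continuous_on_coordinate[OF g(1)]])
       auto
  have "continuous_on ({0..1} \<times> S) (\<lambda>y i. ?h y i / sqrt (\<Sum>j\<le>n. (?h y j)\<^sup>2))"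
    by (rule continuous_on_normalize[OF c nz])
  moreover have "(\<lambda>y i. ?h y i / sqrt (\<Sum>j\<le>n. (?h y j)\<^sup>2)) ` ({0..1} \<times> S) \<subseteq> T"
    using seg by auto
  moreover have "(\<lambda>i. f x i / sqrt (\<Sum>j\<le>n. (f x j)\<^sup>2)) = f x"
      "(\<lambda>i. g x i / sqrt (\<Sum>j\<le>n. (g x j)\<^sup>2)) = g x" if "x \<in> S" for x
    using f(2) g(2) that by (auto simp: sph_def image_subset_iff)
  ultimately show ?thesis
    by (subst homotopic_with, simp, intro exI[of _ "\<lambda>y i. ?h y i / sqrt (\<Sum>j\<le>n. (?h y j)\<^sup>2)"])
       (simp add: image_subset_iff Pi_iff)
qed

lemma contractible_punctured_sphere:
  assumes w: "w \<in> sph n"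
  shows "contractible (sph n - {w})"
proof -
  let ?a = "\<lambda>i. - w i"
  have a: "?a \<in> sph n" using w by (simp add: sph_def)
  have "homotopic_with_canon (\<lambda>x. True) (sph n - {w}) (sph n - {w}) (\<lambda>x. x) (\<lambda>x. ?a)"
  proof (rule homotopic_normalize_sph[where n=n])
    fix x :: "nat \<Rightarrow> real" and t :: real assume x: "x \<in> sph n - {w}" and t: "t \<in> {0..1}"
    let ?y = "\<lambda>i. (1 - t) * x i + t * - w i"
    \<comment> \<open>The contraction runs along segments to the antipode of \<open>w\<close>. The
      case \<open>c = 0\<close> says that such a segment misses the origin, and a positive
      \<open>c\<close> that its normalisation misses \<open>w\<close>: comparing lengths gives
      \<open>1 - t = t + c\<close>, which forces \<open>x = w\<close>.\<close>
    have key: False if c: "\<And>i. (1 - t) * x i = (t + c) * w i" "c \<ge> 0" for c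
    proof -
      have "(1 - t)\<^sup>2 = (\<Sum>i\<le>n. ((1 - t) * x i)\<^sup>2)"
        using x by (simp add: sph_def power_mult_distrib flip: sum_distrib_left)
      also have "\<dots> = (\<Sum>i\<le>n. ((t + c) * w i)\<^sup>2)" using c(1) by simp
      also have "\<dots> = (t + c)\<^sup>2"
        using w by (simp add: sph_def power_mult_distrib flip: sum_distrib_left)
      finally have e: "1 - t = t + c" using t c(2) by (simp add: power2_eq_iff)
      then have "x i = w i" for i
      proof -
        have "1 - t \<noteq> 0" using e t c(2) by auto
        then show ?thesis using c(1)[of i] e by simp
      qed
      then show False using x by auto
    qed
    have "?y \<noteq> (\<lambda>i. 0)" using key[of 0] by (auto simp: fun_eq_iff)
    moreover have "\<forall>i>n. ?y i = 0" using x w by (auto simp: sph_def)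
    ultimately have N: "(\<lambda>i. ?y i / sqrt (\<Sum>j\<le>n. (?y j)\<^sup>2)) \<in> sph n" "(\<Sum>j\<le>n. (?y j)\<^sup>2) > 0"
      using normalize_in_sph[of n ?y] by simp_all
    define r where "r = sqrt (\<Sum>j\<le>n. (?y j)\<^sup>2)"
    have r: "r > 0" using N(2) by (simp add: r_def)
    have "(\<lambda>i. ?y i / r) \<noteq> w"
    proof
      assume e: "(\<lambda>i. ?y i / r) = w"
      have "?y i = r * w i" for i
        using fun_cong[OF e, of i] r by (simp add: nonzero_divide_eq_eq mult.commute)
      then have "(1 - t) * x i = (t + r) * w i" for i by (smt (verit) distrib_right mult_minus_right)
      then show False using key[of r] r by simp
    qed
    then show "?y \<noteq> (\<lambda>i. 0) \<and> (\<lambda>i. ?y i / sqrt (\<Sum>j\<le>n. (?y j)\<^sup>2)) \<in> sph n - {w}"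
      using N(1) \<open>?y \<noteq> (\<lambda>i. 0)\<close> unfolding r_def by simp
  next
    have "w \<noteq> (\<lambda>i. - w i)"
    proof
      assume "w = (\<lambda>i. - w i)"
      then have "w i = 0" for i using fun_cong[of w "\<lambda>i. - w i" i] by simp
      then show False using w by (simp add: sph_def)
    qed
    then show "(\<lambda>x. ?a) ` (sph n - {w}) \<subseteq> sph n" using a by auto
  qed (simp_all add: continuous_on_id)
  then show ?thesis unfolding contractible_def id_def by blast
qed

text \<open>
  The fundamental class is the sum of the classes of the two hemispheres, which the antipodal
  map exchanges up to the sign \<open>d\<close>. So an even map sends it to \<open>1 + d \<in> {0, 2}\<close> times a class
  relative to a punctured sphere containing the image of the equator.
\<close>

lemma even_map_degree:
  assumes n: "n \<noteq> 0"
    and f: "continuous_on (sph n) f" "f ` sph n \<subseteq> sph n"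
    and ev: "\<And>x. x \<in> sph n \<Longrightarrow> f (\<lambda>i. - x i) = f x"
    and w: "w \<in> sph n" "\<And>x. x \<in> sph n \<Longrightarrow> x n = 0 \<Longrightarrow> f x \<noteq> w"
  shows "even (Brouwer_degree2 n f)"
proof -
  define neg where "neg \<equiv> \<lambda>x::nat\<Rightarrow>real. \<lambda>i. -x i"
  define U where "U \<equiv> {x::nat\<Rightarrow>real. x n \<ge> 0}"
  define L where "L \<equiv> {x::nat\<Rightarrow>real. x n \<le> 0}"
  define E where "E \<equiv> {x::nat\<Rightarrow>real. x n = 0}"
  define Y where "Y \<equiv> - {w}"
  define S where "S \<equiv> nsphere n"
  define US where "US \<equiv> subtopology S U"
  define LS where "LS \<equiv> subtopology S L"
  have S: "S = top_of_set (sph n)" by (simp add: S_def nsphere_eq_top_of_set)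
  have topS [simp]: "topspace S = sph n" by (simp add: S)
  let ?H = "homology_group n S"
  let ?RE = "relative_homology_group n S E"
  let ?RL = "relative_homology_group n LS E"
  let ?RU = "relative_homology_group n US E"
  let ?RY = "relative_homology_group n S Y"
  have red: "reduced_homology_group n S = ?H" using n by (simp add: un_reduced_homology_group)
  have cf: "continuous_map S S f" using f by (simp add: S image_subset_iff)
  have cneg: "continuous_map S S neg"
  proof -
    have "continuous_on (sph n) neg"
      unfolding neg_def by (rule continuous_on_coordinatewise_then_product)
        (rule continuous_on_minus[OF continuous_on_coordinate[OF continuous_on_id]])
    moreover have "neg \<in> sph n \<rightarrow> sph n" by (simp add: neg_def sph_def)
    ultimately show ?thesis by (simp add: S)
  qed
  have cnegLU: "continuous_map LS US neg"
    using cneg by (auto simp: LS_def US_def L_def U_def neg_def continuous_map_in_subtopology 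
      intro: continuous_map_from_subtopology)
  have cnegUL: "continuous_map US LS neg"
    using cneg by (auto simp: LS_def US_def L_def U_def neg_def continuous_map_in_subtopology 
      intro: continuous_map_from_subtopology)
  have cLS: "continuous_map LS S id" and cUS: "continuous_map US S id"
    by (simp_all add: LS_def US_def)
  have negE: "neg \<in> E \<rightarrow> E" by (auto simp: neg_def E_def)
  \<comment> \<open>Both solutions 1 and -1 of \<open>d * d = 1\<close> make \<open>d + 1\<close>
    even, which is the property used at the end.\<close>
  define d where "d = Brouwer_degree2 n neg"
  have "d * d = 1"
  proof -
    have "Brouwer_degree2 n (neg \<circ> neg) = d * d"
      unfolding d_def using cneg by (intro Brouwer_degree2_compose) (auto simp: S_def)
    moreover have "neg \<circ> neg = id" by (auto simp: neg_def)
    ultimately show ?thesis by simp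
  qed
  then have d: "d = 1 \<or> d = -1" using zmult_eq_1_iff by blast
  obtain v where v: "v \<in> carrier ?H" and vgen: "subgroup_generated ?H {v} = ?H"
    using cyclic_reduced_homology_group_nsphere[of n n] red S_def by (auto simp: cyclic_group_def)
  interpret H: comm_group ?H by (simp add: abelian_homology_group)
  interpret RE: comm_group ?RE by simp
  interpret RL: comm_group ?RL by simp
  interpret RU: comm_group ?RU by simp
  interpret RY: comm_group ?RY by simp
  define hl where "hl = hom_induced n LS E S E id"
  define hu where "hu = hom_induced n US E S E id"
  define hn where "hn = hom_induced n S E S E neg"
  define nl where "nl = hom_induced n LS E US E neg"
  define nu where "nu = hom_induced n US E LS E neg"
  define io where "io = hom_induced n S {} S E id"
  define ph where "ph = hom_induced n S E S Y f"
  define ka where "ka = hom_induced n S {} S Y id"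
  interpret hl: group_hom ?RL ?RE hl unfolding hl_def by (simp add: group_hom_axioms_def group_hom_def hom_induced_hom)
  interpret hu: group_hom ?RU ?RE hu unfolding hu_def by (simp add: group_hom_axioms_def group_hom_def hom_induced_hom)
  interpret hn: group_hom ?RE ?RE hn unfolding hn_def by (simp add: group_hom_axioms_def group_hom_def hom_induced_hom)
  interpret io: group_hom ?H ?RE io unfolding io_def by (simp add: group_hom_axioms_def group_hom_def hom_induced_hom)
  interpret ph: group_hom ?RE ?RY ph unfolding ph_def by (simp add: group_hom_axioms_def group_hom_def hom_induced_hom)
  interpret ka: group_hom ?H ?RY ka unfolding ka_def by (simp add: group_hom_axioms_def group_hom_def hom_induced_hom)
  \<comment> \<open>Modulo the equator, homology is the direct sum of the contributions of the two
    closed hemispheres. Injectivity of this map allows an equation of classes to be split into its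
    two components.\<close>
  have iso: "(\<lambda>(x, y). hl x \<otimes>\<^bsub>?RE\<^esub> hu y) \<in> Group.iso (?RL \<times>\<times> ?RU) ?RE"
    unfolding hl_def hu_def
  proof (rule conjunct1 [OF exact_sequence_sum_lemma [OF abelian_relative_homology_group]])
    show "hom_induced n LS E S U id \<in> Group.iso ?RL (relative_homology_group n S U)"
      unfolding LS_def E_def L_def U_def S_def
      using iso_relative_homology_group_lower_hemisphere by blast
    show "hom_induced n US E S L id \<in> Group.iso ?RU (relative_homology_group n S L)"
      unfolding US_def E_def L_def U_def S_def
      using iso_relative_homology_group_upper_hemisphere by blast
    show "exact_seq ([relative_homology_group n S L, ?RE, ?RL],
          [hom_induced n S E S L id, hom_induced n LS E S E id])"
      unfolding LS_def E_def L_def by (rule homology_exactness_triple_3) force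
    show "exact_seq ([relative_homology_group n S U, ?RE, ?RU],
          [hom_induced n S E S U id, hom_induced n US E S E id])"
      unfolding US_def E_def U_def by (rule homology_exactness_triple_3) force
    show "hom_induced n S E S U id (hom_induced n LS E S E id x) = hom_induced n LS E S U id x" for x
      by (simp add: hom_induced_compose' subset_iff LS_def E_def L_def U_def)
    show "hom_induced n S E S L id (hom_induced n US E S E id x) = hom_induced n US E S L id x" for x
      by (simp add: hom_induced_compose' subset_iff US_def E_def L_def U_def)
  qed
  have sur: "carrier ?RE \<subseteq> (\<lambda>(x, y). hl x \<otimes>\<^bsub>?RE\<^esub> hu y) ` (carrier ?RL \<times> carrier ?RU)"
    and inj: "inj_on (\<lambda>(x, y). hl x \<otimes>\<^bsub>?RE\<^esub> hu y) (carrier ?RL \<times> carrier ?RU)"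
    using iso by (simp_all add: iso_iff)
  have "io v \<in> carrier ?RE" using v by simp
  then obtain x y where x: "x \<in> carrier ?RL" and y: "y \<in> carrier ?RU" 
    and ioxy: "io v = hl x \<otimes>\<^bsub>?RE\<^esub> hu y"
    using subsetD[OF sur] by force
  have nlx: "nl x \<in> carrier ?RU" and nuy: "nu y \<in> carrier ?RL"
    by (simp_all add: nl_def nu_def hom_induced_carrier)
  have hnl: "hn (hl x) = hu (nl x)"
    unfolding hn_def hl_def hu_def nl_def
    using cneg cLS cUS cnegLU negE by (simp add: hom_induced_compose')
  have hnu: "hn (hu y) = hl (nu y)"
    unfolding hn_def hl_def hu_def nu_def
    using cneg cLS cUS cnegUL negE by (simp add: hom_induced_compose')
  have "hn (io v) = io (hom_induced n S {} S {} neg v)"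
    unfolding hn_def io_def using cneg negE by (simp add: hom_induced_compose')
  also have "hom_induced n S {} S {} neg v = v [^]\<^bsub>?H\<^esub> d"
    unfolding d_def using Brouwer_degree2[of v n neg] v red by (simp add: S_def)
  also have "io \<dots> = hl (x [^]\<^bsub>?RL\<^esub> d) \<otimes>\<^bsub>?RE\<^esub> hu (y [^]\<^bsub>?RU\<^esub> d)"
    using v x y by (simp add: io.hom_int_pow ioxy RE.int_pow_distrib hl.hom_int_pow hu.hom_int_pow)
  finally have "hl (nu y) \<otimes>\<^bsub>?RE\<^esub> hu (nl x) = hl (x [^]\<^bsub>?RL\<^esub> d) \<otimes>\<^bsub>?RE\<^esub> hu (y [^]\<^bsub>?RU\<^esub> d)"
    using x y nlx nuy by (simp add: ioxy hnl hnu RE.m_comm)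
  \<comment> \<open>The antipodal map exchanges the hemispheres, so the image of the lower component
    is compared with the upper component of the \<open>d\<close>-th power.\<close>
  then have nlx_eq: "nl x = y [^]\<^bsub>?RU\<^esub> d"
    using inj_onD[OF inj, of "(nu y, nl x)" "(x [^]\<^bsub>?RL\<^esub> d, y [^]\<^bsub>?RU\<^esub> d)"] x y nlx nuy by simp
  \<comment> \<open>Here evenness enters: \<open>f \<circ> neg\<close> agrees with \<open>f\<close>
    on the sphere. The subspace is cut down to \<open>topspace S \<inter> E\<close> because
    \<open>f\<close> is only known to map equatorial points of the sphere into
    \<open>Y\<close>.\<close>
  have phn: "ph (hn z) = ph z" for z
  proof -
    have fY: "f \<in> topspace S \<inter> E \<rightarrow> Y" using w(2) by (auto simp: E_def Y_def)
    have nE: "neg \<in> topspace S \<inter> E \<rightarrow> topspace S \<inter> E" 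
      using negE cneg by (auto simp: continuous_map_def)
    have "ph z = hom_induced n S (topspace S \<inter> E) S Y f z" for z
      unfolding ph_def by (metis hom_induced inf.left_idem)
    moreover have "hn z = hom_induced n S (topspace S \<inter> E) S (topspace S \<inter> E) neg z"
      unfolding hn_def by (metis hom_induced inf.left_idem)
    moreover have "hom_induced n S (topspace S \<inter> E) S Y f (hom_induced n S (topspace S \<inter> E) S (topspace S \<inter> E) neg z)
      = hom_induced n S (topspace S \<inter> E) S Y (f \<circ> neg) z"
      using cneg cf fY nE by (simp add: hom_induced_compose')
    moreover have "hom_induced n S (topspace S \<inter> E) S Y (f \<circ> neg) = hom_induced n S (topspace S \<inter> E) S Y f"
      by (rule hom_induced_eq) (simp add: neg_def ev)
    ultimately show ?thesis by simp
  qed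
  define F where "F = ph (hu y)"
  have Fc: "F \<in> carrier ?RY" using y by (simp add: F_def)
  have "ph (hl x) = F [^]\<^bsub>?RY\<^esub> d"
    using phn[of "hl x"] y by (simp add: hnl nlx_eq hu.hom_int_pow ph.hom_int_pow F_def)
  then have "ph (io v) = F [^]\<^bsub>?RY\<^esub> d \<otimes>\<^bsub>?RY\<^esub> F"
    using x y by (simp add: ioxy F_def)
  also have "\<dots> = F [^]\<^bsub>?RY\<^esub> (d + 1)"
    using Fc by (simp add: RY.int_pow_mult)
  finally have 1: "ph (io v) = F [^]\<^bsub>?RY\<^esub> (d + 1)" .
  have "ph (io v) = ka (hom_induced n S {} S {} f v)"
  proof -
    have fY: "f \<in> topspace S \<inter> E \<rightarrow> Y" using w(2) by (auto simp: E_def Y_def)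
    have "ph z = hom_induced n S (topspace S \<inter> E) S Y f z" for z
      unfolding ph_def by (metis hom_induced inf.left_idem)
    moreover have "io v = hom_induced n S {} S (topspace S \<inter> E) id v"
      unfolding io_def by (metis hom_induced inf.left_idem inf_bot_right)
    ultimately show ?thesis 
      unfolding ka_def using cf fY by (simp add: hom_induced_compose')
  qed
  also have "hom_induced n S {} S {} f v = v [^]\<^bsub>?H\<^esub> Brouwer_degree2 n f"
    using Brouwer_degree2[of v n f] v red by (simp add: S_def)
  finally have 2: "ka (v [^]\<^bsub>?H\<^esub> Brouwer_degree2 n f) = F [^]\<^bsub>?RY\<^esub> (d + 1)" using 1 by simp
  \<comment> \<open>The punctured sphere is contractible, so nothing is lost by reading the degree
    in homology relative to \<open>Y\<close>.\<close>
  have kaiso: "ka \<in> Group.iso ?H ?RY"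
    unfolding ka_def red[symmetric]
  proof (rule iso_reduced_homology_by_contractible)
    have "subtopology S Y = top_of_set (sph n - {w})"
      by (simp add: S Y_def subtopology_subtopology Diff_eq)
    then show "contractible_space (subtopology S Y)" 
      using contractible_punctured_sphere[OF w(1)] by simp
    have "(\<lambda>i. - w i) \<in> sph n" using w(1) by (simp add: sph_def)
    moreover have "(\<lambda>i. - w i) \<noteq> w"
    proof
      assume "(\<lambda>i. - w i) = w"
      then have "w i = 0" for i using fun_cong[of "\<lambda>i. - w i" w i] by simp
      then show False using w(1) by (simp add: sph_def)
    qed
    ultimately show "topspace S \<inter> Y \<noteq> {}" by (auto simp: Y_def)
  qed
  then obtain z where z: "z \<in> carrier ?H" "ka z = F"
    using Fc unfolding iso_iff by (metis imageE)
  then obtain j :: int where j: "z = v [^]\<^bsub>?H\<^esub> j"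
    using vgen H.carrier_subgroup_generated_by_singleton[OF v] by auto
  have "ka (v [^]\<^bsub>?H\<^esub> Brouwer_degree2 n f) = ka (v [^]\<^bsub>?H\<^esub> (j * (d + 1)))"
    using 2 z j v by (simp add: ka.hom_int_pow flip: H.int_pow_pow)
  then have "v [^]\<^bsub>?H\<^esub> Brouwer_degree2 n f = v [^]\<^bsub>?H\<^esub> (j * (d + 1))"
    using kaiso v by (auto simp: iso_iff inj_on_def)
  moreover have "H.ord v = 0"
    
proof -
    have "infinite (carrier ?H)"
      using iso_finite[OF reduced_homology_group_nsphere(1), of n] red by (simp add: S_def)
    then show ?thesis using H.infinite_cyclic_subgroup_order[OF v] vgen by simp
  qed
  ultimately have "Brouwer_degree2 n f = j * (d + 1)"
    using v by (simp add: H.int_pow_eq)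
  then show ?thesis using d by auto
qed

text \<open>The case \<open>c = 0\<close> of \<open>away\<close> says that \<open>F\<close> has no
  zeros and can be normalised; the general case keeps the segments from \<open>x\<close> to the
  normalised value off the origin. The direction \<open>w\<close> is the missed point that
  \<open>even_map_degree\<close> asks for.\<close>

lemma no_even_map_close_to_identity:
  assumes n: "n \<noteq> 0"
    and F: "continuous_on (sph n) F" "\<And>x i. x \<in> sph n \<Longrightarrow> n < i \<Longrightarrow> F x i = 0"
    and ev: "\<And>x. x \<in> sph n \<Longrightarrow> F (\<lambda>i. - x i) = F x"
    and away: "\<And>x c. x \<in> sph n \<Longrightarrow> c \<ge> 0 \<Longrightarrow> F x \<noteq> (\<lambda>i. - c * x i)"
    and w: "w \<in> sph n" "\<And>x c. x \<in> sph n \<Longrightarrow> x n = 0 \<Longrightarrow> c > 0 \<Longrightarrow> F x \<noteq> (\<lambda>i. c * w i)"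
  shows False
proof -
  define N where "N x = sqrt (\<Sum>j\<le>n. (F x j)\<^sup>2)" for x
  define f where "f x = (\<lambda>i. F x i / N x)" for x
  have F0: "F x \<noteq> (\<lambda>i. 0)" if "x \<in> sph n" for x
    using away[OF that, of 0] by simp
  have Npos: "N x > 0" if "x \<in> sph n" for x
    using normalize_in_sph(2)[of n "F x"] F(2) F0 that by (simp add: N_def)
  have Ff: "F x = (\<lambda>i. N x * f x i)" if "x \<in> sph n" for x
    using Npos[OF that] by (simp add: f_def fun_eq_iff)
  have fS: "f x \<in> sph n" if "x \<in> sph n" for x
    using normalize_in_sph(1)[of n "F x"] F(2) F0 that by (simp add: N_def f_def)
  have cf: "continuous_on (sph n) f"
  proof -
    have "continuous_on (sph n) (\<lambda>x i. F x i / sqrt (\<Sum>j\<le>n. (F x j)\<^sup>2))"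
    proof (rule continuous_on_normalize[OF F(1)])
      show "0 < (\<Sum>j\<le>n. (F x j)\<^sup>2)" if "x \<in> sph n" for x
        using Npos[OF that] by (simp add: N_def)
    qed
    then show ?thesis by (simp add: f_def[abs_def] N_def)
  qed
  have "even (Brouwer_degree2 n f)"
  proof (rule even_map_degree[OF n cf _ _ w(1)])
    show "f ` sph n \<subseteq> sph n" using fS by auto
    show "f (\<lambda>i. - x i) = f x" if "x \<in> sph n" for x
      using ev[OF that] by (simp add: f_def N_def)
    show "f x \<noteq> w" if "x \<in> sph n" "x n = 0" for x
      using w(2)[OF that Npos] Ff that by metis
  qed
  moreover have "homotopic_with_canon (\<lambda>x. True) (sph n) (sph n) id f"
  proof (rule homotopic_normalize_sph[where n=n])
    fix x :: "nat \<Rightarrow> real" and t :: real assume x: "x \<in> sph n" and t: "t \<in> {0..1}"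
    let ?y = "\<lambda>i. (1 - t) * id x i + t * f x i"
    have "?y \<noteq> (\<lambda>i. 0)"
    proof
      assume y: "?y = (\<lambda>i. 0)"
      show False
      proof (cases "t = 0")
        case True
        then have "x = (\<lambda>i. 0)" using y by simp
        then show False using x by (simp add: sph_def)
      next
        case False
        have "F x i = - (N x * ((1 - t) / t)) * x i" for i
        proof -
          have "f x i = - ((1 - t) / t) * x i"
            using fun_cong[OF y, of i] False by (simp add: field_simps)
          then show ?thesis using fun_cong[OF Ff[OF x], of i] by simp
        qed
        moreover have "N x * ((1 - t) / t) \<ge> 0" using Npos[OF x] t False by simp
        ultimately show False using away[OF x] by blast
      qed
    qed
    moreover have "\<forall>i>n. ?y i = 0" using x fS[OF x] by (simp add: sph_def)
    ultimately show "?y \<noteq> (\<lambda>i. 0) \<and> (\<lambda>i. ?y i / sqrt (\<Sum>j\<le>n. (?y j)\<^sup>2)) \<in> sph n"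
      using normalize_in_sph[of n ?y] by simp
  qed (use cf fS in \<open>auto simp: id_def continuous_on_id\<close>)
  then have "Brouwer_degree2 n f = 1"
    using Brouwer_degree2_homotopic[of n id f] by (simp add: nsphere_eq_top_of_set)
  ultimately show False by simp
qed

text \<open>
  Packing argument: otherwise the \<open>K ^ m\<close> directions \<open>D a\<close> would give \<open>K ^ m\<close> points of the
  \<open>n\<close>-sphere, and hence \<open>K ^ (m + 1)\<close> multiples of them in an \<open>m\<close>-dimensional cube, at mutual
  distances of order \<open>1 / K\<close>.
\<close>

lemma lipschitz_image_misses_direction:
  assumes lip: "\<And>y y' B i. y \<in> sph n \<Longrightarrow> y' \<in> sph n \<Longrightarrow> i \<le> Suc n \<Longrightarrow> (\<And>j. j \<le> n \<Longrightarrow> \<bar>y j - y' j\<bar> \<le> B) \<Longrightarrow>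
     \<bar>G y i - G y' i\<bar> \<le> Lc * (B::real)"
    and low: "\<And>y. y \<in> sph n \<Longrightarrow> \<exists>i\<le>Suc n. \<bar>G y i\<bar> \<ge> \<delta>" and \<delta>: "\<delta> > 0"
  shows "\<exists>w\<in>sph (Suc n). \<forall>y\<in>sph n. \<forall>c>0. G y \<noteq> (\<lambda>i. c * w i)"
proof (rule ccontr)
  assume "\<not> ?thesis"
  then have hit: "\<exists>y\<in>sph n. \<exists>c>0. G y = (\<lambda>i. c * w i)" if "w \<in> sph (Suc n)" for w using that by blast
  define m where "m = Suc n"
  obtain M0 :: nat where M0: "2 * Lc / \<delta> < real M0" using reals_Archimedean2 by blast
  \<comment> \<open>Cells will have side \<open>1 / (K * M)\<close>. The part \<open>M0\<close>
    makes directions belonging to one cell closer than \<open>1 / K\<close>, the part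
    \<open>m\<close> does so for radii, and the 2 absorbs the rounding in the cell count.\<close>
  define M where "M = M0 + m + 2"
  have M: "2 * Lc / \<delta> < real M" "real m < real M" "M \<ge> 2" using M0 by (auto simp: M_def)
  \<comment> \<open>Counting will give \<open>K * K ^ m \<le> (5 * M) ^ m * K ^ m\<close>, so any
    \<open>K\<close> above \<open>(5 * M) ^ m\<close> is contradictory.\<close>
  define K where "K = (5 * M) ^ m + 1"
  have K: "K > 0" by (simp add: K_def)
  define A where "A = PiE {..<m} (\<lambda>_. {..<K})"
  \<comment> \<open>The last coordinate is set to 1 so that the factor \<open>c a\<close> is
    coordinate \<open>m\<close> of \<open>G (y a)\<close> and obeys the same Lipschitz
    bound.\<close>
  define D where "D a = (\<lambda>i. if i < m then real (a i) / real K else if i = m then 1 else 0)" for a :: "nat \<Rightarrow> nat"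
  have "\<exists>y\<in>sph n. \<exists>c>0. G y = (\<lambda>i. c * D a i)" for a
  proof -
    have D0: "\<forall>i>m. D a i = 0" "D a \<noteq> (\<lambda>i. 0)" by (auto simp: D_def fun_eq_iff)
    obtain y c where y: "y \<in> sph n" "c > 0" "G y = (\<lambda>i. c * (D a i / sqrt (\<Sum>j\<le>m. (D a j)\<^sup>2)))"
      using hit[OF normalize_in_sph(1)[OF D0, unfolded m_def], folded m_def] by blast
    have "sqrt (\<Sum>j\<le>m. (D a j)\<^sup>2) > 0" using normalize_in_sph(2)[OF D0] by simp
    then have "G y = (\<lambda>i. (c / sqrt (\<Sum>j\<le>m. (D a j)\<^sup>2)) * D a i)" "c / sqrt (\<Sum>j\<le>m. (D a j)\<^sup>2) > 0"
      using y by (simp_all add: fun_eq_iff)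
    then show ?thesis using y(1) by blast
  qed
  then obtain y c where y: "\<And>a. y a \<in> sph n" and c: "\<And>a. c a > 0" and G: "\<And>a. G (y a) = (\<lambda>i. c a * D a i)"
    by metis
  have cd: "c a \<ge> \<delta>" if a: "a \<in> A" for a
  proof -
    obtain i where i: "i \<le> Suc n" "\<bar>G (y a) i\<bar> \<ge> \<delta>" using low[OF y] by blast
    have "\<bar>D a i\<bar> \<le> 1" using a i(1) K by (auto simp: D_def A_def PiE_def Pi_def m_def less_imp_le)
    then have "\<bar>G (y a) i\<bar> \<le> c a" using c[of a] by (simp add: G abs_mult mult_left_le)
    then show ?thesis using i by simp
  qed
  \<comment> \<open>For \<open>j\<close> from \<open>K\<close> to \<open>2 * K - 1\<close> the radii
    are spaced by \<open>1 / K\<close> in the interval from 1 to 2. A radius of at least 1 lets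
    closeness of the multiples pass to the points \<open>y a\<close> themselves.\<close>
  define P where "P j a i = real j / real K * y a i" for j a i
  define cell where "cell = (\<lambda>(j, a). restrict (\<lambda>i. \<lfloor>real (K * M) * P j a i\<rfloor>) {..<m})"
  define C where "C = PiE {..<m} (\<lambda>_. {- int (2*K*M) - 1 .. int (2*K*M)})"
  have nrm: "L2_set (y a) {..<m} = 1" for a
    using y[of a] by (simp add: L2_set_def sph_def m_def lessThan_Suc_atMost)
  have yb: "\<bar>y a i\<bar> \<le> 1" if "i < m" for a i
  proof -
    have "\<bar>y a i\<bar> = L2_set (y a) {i}" by simp
    also have "\<dots> \<le> L2_set (y a) {..<m}" unfolding L2_set_def 
      using that by (intro real_sqrt_le_mono sum_mono2) auto
    finally show ?thesis using nrm by simp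
  qed
  \<comment> \<open>For two points in one cell, comparing norms identifies the radius
    \<open>j\<close>, then the Lipschitz bound on \<open>G\<close> together with
    \<open>c a \<ge> \<delta>\<close> identifies the grid direction \<open>a\<close>.\<close>
  have inj: "inj_on cell ({K..<2*K} \<times> A)"
  proof (rule inj_onI, clarify)
    fix j a j' a' assume j: "j \<in> {K..<2*K}" "j' \<in> {K..<2*K}" and a: "a \<in> A" "a' \<in> A"
      and eq: "cell (j, a) = cell (j', a')"
    have KM: "real (K * M) > 0" using K M(3) by simp
    have close: "\<bar>P j a i - P j' a' i\<bar> \<le> 1 / real (K * M)" if "i < m" for i
    proof -
      have "\<lfloor>real (K * M) * P j a i\<rfloor> = \<lfloor>real (K * M) * P j' a' i\<rfloor>"
        using fun_cong[OF eq, of i] that by (simp add: cell_def)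
      then have "\<bar>real (K * M) * P j a i - real (K * M) * P j' a' i\<bar> \<le> 1" by linarith
      then have "real (K * M) * \<bar>P j a i - P j' a' i\<bar> \<le> 1"
        using KM by (simp add: abs_mult flip: right_diff_distrib)
      then show ?thesis using KM by (simp add: field_simps)
    qed
    have nP: "L2_set (P j a) {..<m} = real j / real K" for j a
    proof -
      have "L2_set (P j a) {..<m} = real j / real K * L2_set (y a) {..<m}"
        unfolding P_def by (rule L2_set_right_distrib[symmetric]) simp
      then show ?thesis by (simp add: nrm)
    qed
    have tri: "L2_set f {..<m} \<le> L2_set g {..<m} + m * (1 / real (K * M))" 
      if "\<And>i. i < m \<Longrightarrow> \<bar>f i - g i\<bar> \<le> 1 / real (K * M)" for f g :: "nat \<Rightarrow> real"
    proof -
      have "L2_set f {..<m} = L2_set (\<lambda>i. g i + (f i - g i)) {..<m}" by simp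
      also have "\<dots> \<le> L2_set g {..<m} + L2_set (\<lambda>i. f i - g i) {..<m}" by (rule L2_set_triangle_ineq)
      also have "L2_set (\<lambda>i. f i - g i) {..<m} \<le> (\<Sum>i<m. \<bar>f i - g i\<bar>)" by (rule L2_set_le_sum_abs)
      also have "\<dots> \<le> m * (1 / real (K * M))" using sum_mono[of "{..<m}" "\<lambda>i. \<bar>f i - g i\<bar>" "\<lambda>_. 1 / real (K * M)"] that by simp
      finally show ?thesis by simp
    qed
    have "\<bar>real j / real K - real j' / real K\<bar> \<le> m * (1 / real (K * M))"
      using tri[of "P j a" "P j' a'"] tri[of "P j' a'" "P j a"] close nP by (simp add: abs_minus_commute abs_le_iff)
    also have "\<dots> < 1 / real K" using K M(2,3) by (simp add: field_simps)
    finally have "\<bar>real j - real j'\<bar> < 1" using K by (simp add: divide_less_cancel flip: diff_divide_distrib)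
    then have jj: "j' = j" by linarith
    have cy: "\<bar>y a i - y a' i\<bar> \<le> 1 / real (K * M)" if "i \<le> n" for i
    proof -
      have r: "real j / real K \<ge> 1" using j K by simp
      have "\<bar>y a i - y a' i\<bar> \<le> real j / real K * \<bar>y a i - y a' i\<bar>" 
        using mult_right_mono[OF r, of "\<bar>y a i - y a' i\<bar>"] by simp
      also have "\<dots> = \<bar>P j a i - P j' a' i\<bar>" proof -
        have "P j a i - P j' a' i = real j / real K * (y a i - y a' i)" 
          by (simp add: P_def jj right_diff_distrib)
        then show ?thesis by (simp add: abs_mult)
      qed
      finally show ?thesis using close[of i] that by (simp add: m_def)
    qed
    have "a i = a' i" for i
    proof (cases "i < m")
      case False
      then show ?thesis using a by (auto simp: A_def PiE_def extensional_def)
    next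
      case True
      have l1: "\<bar>c a * D a i - c a' * D a' i\<bar> \<le> Lc * (1 / real (K * M))"
        using lip[OF y y, of i a a' "1 / real (K * M)"] cy True by (simp add: G m_def)
      have l2: "\<bar>c a - c a'\<bar> \<le> Lc * (1 / real (K * M))"
        using lip[OF y y, of m a a' "1 / real (K * M)"] cy by (simp add: G m_def D_def)
      have d: "D a i = a i / K" "D a' i = a' i / K" using True by (simp_all add: D_def)
      have d1: "0 \<le> D a' i" "D a' i \<le> 1" using a(2) True K by (auto simp: d A_def PiE_def Pi_def less_imp_le)
      have "c a * (D a i - D a' i) = (c a * D a i - c a' * D a' i) - (c a - c a') * D a' i"
        by (simp add: algebra_simps)
      then have "c a * \<bar>D a i - D a' i\<bar> \<le> \<bar>c a * D a i - c a' * D a' i\<bar> + \<bar>c a - c a'\<bar> * D a' i"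
        using c[of a] d1 by (metis abs_mult abs_of_nonneg abs_of_pos abs_triangle_ineq4)
      also have "\<bar>c a - c a'\<bar> * D a' i \<le> \<bar>c a - c a'\<bar>" using d1 by (simp add: mult_left_le)
      finally have "c a * \<bar>D a i - D a' i\<bar> \<le> 2 * Lc * (1 / real (K * M))" using l1 l2 by simp
      then have "\<delta> * \<bar>D a i - D a' i\<bar> \<le> 2 * Lc * (1 / real (K * M))"
        using mult_right_mono[OF cd[OF a(1)], of "\<bar>D a i - D a' i\<bar>"] by simp
      then have "\<bar>D a i - D a' i\<bar> \<le> 2 * Lc * (1 / real (K * M)) / \<delta>"
        unfolding pos_le_divide_eq[OF \<delta>] by (simp only: mult.commute)
      then have "\<bar>D a i - D a' i\<bar> \<le> (2 * Lc / \<delta>) * (1 / real (K * M))" by (simp add: mult_ac)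
      also have "\<dots> < real M * (1 / real (K * M))" using M(1) KM by (intro mult_strict_right_mono) auto
      also have "\<dots> = 1 / real K" using M(3) by simp
      finally have "\<bar>real (a i) - real (a' i)\<bar> < 1" using K by (simp add: d divide_less_cancel flip: diff_divide_distrib)
      then show ?thesis by linarith
    qed
    then show "j = j' \<and> a = a'" using jj by auto
  qed
  have img: "cell ` ({K..<2*K} \<times> A) \<subseteq> C"
  proof (clarify)
    fix j a assume j: "j \<in> {K..<2*K}" and a: "a \<in> A"
    have "\<lfloor>real (K * M) * P j a i\<rfloor> \<in> {- int (2*K*M) - 1 .. int (2*K*M)}" if "i < m" for i
    proof -
      have r: "real j / real K \<le> 2" using j K by (simp add: field_simps)
      have "\<bar>P j a i\<bar> \<le> 2 * 1" unfolding P_def abs_mult using yb[OF that] r by (intro mult_mono) auto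
      then have "\<bar>real (K * M) * P j a i\<bar> \<le> real (K * M) * 2" 
        unfolding abs_mult by (intro mult_mono) auto
      then have "\<bar>real (K * M) * P j a i\<bar> \<le> of_int (int (2*K*M))" by simp
      then show ?thesis unfolding atLeastAtMost_iff by linarith
    qed
    then show "cell (j, a) \<in> C" by (auto simp: cell_def C_def)
  qed
  have "K * K ^ m = card ({K..<2*K} \<times> A)" by (simp add: A_def card_PiE card_cartesian_product)
  also have "\<dots> \<le> card C" by (rule card_inj_on_le[OF inj img]) (simp add: C_def finite_PiE)
  also have "\<dots> = (4*K*M + 2) ^ m"
  proof -
    have "card {- int (2*K*M) - 1 .. int (2*K*M)} = 4*K*M + 2" by (simp add: nat_eq_iff)
    then show ?thesis by (simp only: C_def card_PiE finite_lessThan prod_constant card_lessThan)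
  qed
  also have "\<dots> \<le> (5*M*K) ^ m"
  proof (rule power_mono)
    have "2 \<le> M * K" using M(3) K by (metis One_nat_def Suc_leI mult_le_mono nat_mult_1_right)
    then show "4*K*M + 2 \<le> 5*M*K" by (simp add: algebra_simps)
  qed simp
  also have "\<dots> = (5*M)^m * K^m" by (simp add: power_mult_distrib)
  finally have "K \<le> (5*M)^m" using K by simp
  then show False by (simp add: K_def)
qed

section \<open>Sections over a hemisphere\<close>

definition bil :: "nat \<Rightarrow> (nat \<Rightarrow> complex) \<Rightarrow> (nat \<Rightarrow> complex) \<Rightarrow> complex" where
  "bil n v w = (\<Sum>i\<le>n. v i * w i)"

lemma bil_square:
  "bil n (\<lambda>i. a i + c * b i) (\<lambda>i. a i + c * b i) = bil n a a + 2 * c * bil n a b + c * c * bil n b b"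
proof -
  have "(a i + c * b i) * (a i + c * b i) = a i * a i + 2 * c * (a i * b i) + c * c * (b i * b i)" for i
    by (simp add: algebra_simps)
  then show ?thesis by (simp add: bil_def sum.distrib sum_distrib_left)
qed

text \<open>Squares of imaginary parts enter with a negative sign. This turns a lower bound on the
  complex square of a section into one on the length of its real part.\<close>

lemma Re_bil_self_le: "Re (bil n v v) \<le> (\<Sum>i\<le>n. (Re (v i))\<^sup>2)"
  by (simp add: bil_def power2_eq_square sum_mono)

lemma sph_equator: "x \<in> sph (Suc n) \<and> x (Suc n) = 0 \<longleftrightarrow> x \<in> sph n"
  unfolding sph_def by (auto simp: Suc_lessI)
     (metis Suc_lessI)

lemma neg_in_sph [simp]: "(\<lambda>i. - x i) \<in> sph n \<longleftrightarrow> x \<in> sph n"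
  by (simp add: sph_def)


context
  notes sum.atMost_Suc [simp del]
begin

text \<open>
  The map \<open>p\<close> retracts a collar of the equator to the equator, which leaves room to fade in the
  antipodal summand of \<open>t\<close>. The resulting \<open>f x\<close> is orthogonal to \<open>p x\<close> instead of \<open>x\<close>, but as
  \<open>x\<close> and \<open>p x\<close> have positive inner product it is still no multiple of \<open>x\<close>.
\<close>

lemma no_equivariant_section:
  fixes s :: "(nat \<Rightarrow> real) \<Rightarrow> nat \<Rightarrow> complex" and n :: nat
  defines "D \<equiv> {x \<in> sph (Suc n). x (Suc n) \<ge> 0}"
  assumes cont: "\<And>i. continuous_on D (\<lambda>x. s x i)"
    and supp: "\<And>x i. i > Suc n \<Longrightarrow> s x i = 0"
    and tang: "\<And>x. x \<in> D \<Longrightarrow> bil (Suc n) (s x) (\<lambda>i. of_real (x i)) = 0"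
    and pos: "\<And>x. x \<in> D \<Longrightarrow> Re (bil (Suc n) (s x) (s x)) \<ge> 1/2"
    and orth: "\<And>x. x \<in> sph n \<Longrightarrow> bil (Suc n) (s x) (s (\<lambda>i. - x i)) = 0"
    and lip: "\<And>y y' B i. y \<in> sph n \<Longrightarrow> y' \<in> sph n \<Longrightarrow> (\<And>j. j \<le> n \<Longrightarrow> \<bar>y j - y' j\<bar> \<le> B) \<Longrightarrow>
     cmod (s y i - s y' i) \<le> Lc * B"
  shows False
proof -
  let ?m = "Suc n"
  define q where "q x i = (if i = ?m then max 0 (x ?m - 1/2) else x i)" for x :: "nat \<Rightarrow> real" and i
  define N where "N x = sqrt (\<Sum>j\<le>?m. (q x j)\<^sup>2)" for x
  define p where "p x = (\<lambda>i. q x i / N x)" for x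
  \<comment> \<open>The threshold 1/2 matches the one in \<open>q\<close>: \<open>ph\<close> is
    positive only where \<open>p x\<close> lies on the equator. Elsewhere \<open>- p x\<close> may
    leave \<open>D\<close>, where nothing is known about \<open>s\<close>.\<close>
  define ph where "ph x = max 0 (1 - 2 * x ?m)" for x :: "nat \<Rightarrow> real"
  define t where "t x = (\<lambda>i. s (p x) i + of_real (ph x) * s (\<lambda>j. - p x j) i)" for x
  define f where "f x = (\<lambda>i. Re (t x i))" for x
  define F where "F x = (if x ?m \<ge> 0 then f x else f (\<lambda>i. - x i))" for x
  have Dsub: "D \<subseteq> sph ?m" by (auto simp: D_def)
  have eqD: "x \<in> D" "x \<in> sph ?m" "x ?m = 0" "(\<lambda>i. - x i) \<in> sph n" "(\<lambda>i. - x i) \<in> D" if "x \<in> sph n" for x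
    using that sph_equator[of x n] sph_equator[of "\<lambda>i. - x i" n] by (auto simp: D_def)
  have q0: "q x \<noteq> (\<lambda>i. 0)" if x: "x \<in> D" for x
  proof
    assume q: "q x = (\<lambda>i. 0)"
    have 1: "x i = 0" if "i \<noteq> ?m" for i using fun_cong[OF q, of i] that by (simp add: q_def)
    have "x ?m \<le> 1/2" using fun_cong[OF q, of ?m] by (simp add: q_def max_def split: if_splits)
    moreover have "(x ?m)\<^sup>2 = 1" using x 1 by (simp add: D_def sph_def sum.atMost_Suc)
    ultimately show False using x by (auto simp: power2_eq_1_iff D_def)
  qed
  have qs: "\<forall>i>?m. q x i = 0" if "x \<in> D" for x using that by (simp add: q_def D_def sph_def)
  have Npos: "N x > 0" if "x \<in> D" for x
    using normalize_in_sph(2)[OF qs q0] that by (simp add: N_def)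
  have pD: "p x \<in> D" if "x \<in> D" for x
    using normalize_in_sph(1)[OF qs q0] that Npos[OF that] unfolding D_def
    by (simp add: p_def N_def) (simp add: q_def)
  have peq: "p x \<in> sph n" if "x \<in> D" "x ?m \<le> 1/2" for x
  proof -
    have "p x ?m = 0" using that by (simp add: p_def q_def)
    then show ?thesis using pD[OF that(1)] sph_equator by (auto simp: D_def)
  qed
  have fixp: "p x = x" "ph x = 1" if "x \<in> sph n" for x
  proof -
    have x: "x \<in> D" "x ?m = 0" using eqD[OF that] by auto
    then have q: "q x = x" by (auto simp: q_def fun_eq_iff)
    have "N x = 1" using Dsub x by (auto simp: N_def q sph_def)
    then show "p x = x" by (simp add: p_def q)
    show "ph x = 1" using x by (simp add: ph_def)
  qed
  have qp: "(\<Sum>i\<le>?m. x i * p x i) > 0" if x: "x \<in> D" for x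
  proof -
    have "(\<Sum>i\<le>?m. (q x i)\<^sup>2) \<le> (\<Sum>i\<le>?m. x i * q x i)"
      using x by (intro sum_mono) (auto simp: q_def power2_eq_square D_def max_def intro!: mult_right_mono)
    moreover have "(\<Sum>i\<le>?m. (q x i)\<^sup>2) > 0" using Npos[OF x] by (simp add: N_def)
    ultimately have "(\<Sum>i\<le>?m. x i * q x i) > 0" by linarith
    moreover have "(\<Sum>i\<le>?m. x i * p x i) = (\<Sum>i\<le>?m. x i * q x i) / N x" 
      by (simp add: p_def sum_divide_distrib del: sum.atMost_Suc)
    ultimately show ?thesis using Npos[OF x] by simp
  qed
  have bilD: "bil ?m (\<lambda>i. a i + c * b i) w = bil ?m a w + c * bil ?m b w" for a b c w
    by (simp add: bil_def sum_distrib_left sum.distrib algebra_simps)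
  have bilC: "bil ?m a b = bil ?m b a" for a b by (simp add: bil_def mult.commute)
  have bilN: "bil ?m a (\<lambda>i. of_real (- x i)) = - bil ?m a (\<lambda>i. of_real (x i))" for a x 
    by (simp add: bil_def sum_negf)
  have ph0: "ph x \<ge> 0" for x by (simp add: ph_def)
  have phz: "ph x = 0 \<or> x ?m \<le> 1/2" for x by (auto simp: ph_def)
  \<comment> \<open>The cross term vanishes by \<open>orth\<close>, so the antipodal summand can
    only increase the real part of the square and never cancels \<open>s (p x)\<close>.\<close>
  have tt: "Re (bil ?m (t x) (t x)) \<ge> 1/2 + 1/2 * (ph x)\<^sup>2" if x: "x \<in> D" for x
  proof (cases "ph x = 0")
    case True
    then show ?thesis using pos[OF pD[OF x]] by (simp add: t_def)
  next
    case False
    then have e: "p x \<in> sph n" using peq x phz by blast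
    have o: "bil ?m (s (p x)) (s (\<lambda>j. - p x j)) = 0" using orth[OF e] .
    have "bil ?m (t x) (t x) = bil ?m (s (p x)) (s (p x)) + of_real (ph x) * of_real (ph x) * bil ?m (s (\<lambda>j. - p x j)) (s (\<lambda>j. - p x j))"
      unfolding t_def bil_square o by simp
    then have "Re (bil ?m (t x) (t x)) = Re (bil ?m (s (p x)) (s (p x))) + (ph x)\<^sup>2 * Re (bil ?m (s (\<lambda>j. - p x j)) (s (\<lambda>j. - p x j)))"
      by (simp add: power2_eq_square)
    moreover have "(ph x)\<^sup>2 * Re (bil ?m (s (\<lambda>j. - p x j)) (s (\<lambda>j. - p x j))) \<ge> (ph x)\<^sup>2 * (1/2)"
      using pos[OF eqD(5)[OF e]] by (intro mult_left_mono) auto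
    ultimately show ?thesis using pos[OF pD[OF x]] by simp
  qed
  have f2: "(\<Sum>i\<le>?m. (f x i)\<^sup>2) \<ge> 1/2 + 1/2 * (ph x)\<^sup>2" if x: "x \<in> D" for x
    using tt[OF x] Re_bil_self_le[of ?m "t x"] by (simp add: f_def)
  have fp: "(\<Sum>i\<le>?m. f x i * p x i) = 0" if x: "x \<in> D" for x
  proof -
    have 1: "bil ?m (s (p x)) (\<lambda>i. of_real (p x i)) = 0" using tang[OF pD[OF x]] .
    have 2: "of_real (ph x) * bil ?m (s (\<lambda>j. - p x j)) (\<lambda>i. of_real (p x i)) = 0"
    proof (cases "ph x = 0")
      case False
      then have e: "p x \<in> sph n" using peq x phz by blast
      show ?thesis using tang[OF eqD(5)[OF e]] bilN[of "s (\<lambda>j. - p x j)" "p x"] by simp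
    qed simp
    have "bil ?m (t x) (\<lambda>i. of_real (p x i)) = 0" unfolding t_def bilD using 1 2 by simp
    moreover have "Re (bil ?m (t x) (\<lambda>i. of_real (p x i))) = (\<Sum>i\<le>?m. f x i * p x i)"
      by (simp add: bil_def f_def)
    ultimately show ?thesis by simp
  qed
  have away: "f x \<noteq> (\<lambda>i. c * x i)" if x: "x \<in> D" for x c
  proof
    assume e: "f x = (\<lambda>i. c * x i)"
    have "(\<Sum>i\<le>?m. f x i * p x i) = c * (\<Sum>i\<le>?m. x i * p x i)"
      unfolding e sum_distrib_left by (simp only: mult.assoc)
    then have "c = 0" using qp[OF x] fp[OF x] by simp
    then have "(\<Sum>i\<le>?m. (f x i)\<^sup>2) = 0" unfolding e by simp
    then show False using f2[OF x] zero_le_power2[of "ph x"] by linarith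
  qed
  have feq: "f x = (\<lambda>i. Re (s x i) + Re (s (\<lambda>j. - x j) i))" if "x \<in> sph n" for x
    using fixp[OF that] by (simp add: f_def t_def)
  have even_eq: "f (\<lambda>i. - x i) = f x" if "x \<in> sph n" for x
    using feq[OF that] feq[OF eqD(4)[OF that]] by (simp add: add.commute)
  have cq: "continuous_on D q"
    unfolding q_def[abs_def]
  proof (rule continuous_on_coordinatewise_then_product)
    fix i show "continuous_on D (\<lambda>x. if i = ?m then max 0 (x ?m - 1/2) else x i)"
      by (cases "i = ?m") (auto intro!: continuous_on_max continuous_on_diff continuous_on_const
         continuous_on_coordinate[OF continuous_on_id])
  qed
  have cp: "continuous_on D p"
    unfolding p_def[abs_def] N_def 
    by (rule continuous_on_normalize[OF cq]) (use Npos in \<open>simp add: N_def\<close>)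
  have cpi: "continuous_on D (\<lambda>x. s (p x) i)" for i
    using continuous_on_compose2[OF cont cp] pD by blast
  have cneg: "continuous_on T (\<lambda>x i. - x i)" for T :: "(nat \<Rightarrow> real) set"
    by (rule continuous_on_coordinatewise_then_product)
        (rule continuous_on_minus[OF continuous_on_coordinate[OF continuous_on_id]])
  have cm: "continuous_on T (\<lambda>x. x ?m)" for T :: "(nat \<Rightarrow> real) set"
    by (rule continuous_on_coordinate[OF continuous_on_id])
  have clo: "closed {x::nat \<Rightarrow> real. x ?m \<le> 1/2}" "closed {x::nat \<Rightarrow> real. x ?m \<ge> 1/2}" 
     "closed {x::nat \<Rightarrow> real. x ?m \<le> 0}" "closed {x::nat \<Rightarrow> real. x ?m \<ge> 0}"
    by (intro closed_Collect_le cm continuous_on_const)+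
  \<comment> \<open>Continuity is proved on two closed pieces meeting at height 1/2: below,
    \<open>- p x\<close> stays on the equator; above, its coefficient is 0.\<close>
  have cf1: "continuous_on (D \<inter> {x. x ?m \<le> 1/2}) (\<lambda>x. f x i)" for i
  proof -
    have 1: "continuous_on (D \<inter> {x. x ?m \<le> 1/2}) (\<lambda>x. \<lambda>j. - p x j)"
      by (rule continuous_on_compose2[OF cneg[of UNIV] continuous_on_subset[OF cp]]) auto
    have "continuous_on (D \<inter> {x. x ?m \<le> 1/2}) (\<lambda>x. s (\<lambda>j. - p x j) i)"
      by (rule continuous_on_compose2[OF cont 1]) (use peq eqD(5) in auto)
    moreover have "continuous_on (D \<inter> {x. x ?m \<le> 1/2}) (\<lambda>x. s (p x) i)"
      by (rule continuous_on_subset[OF cpi]) auto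
    ultimately show ?thesis unfolding f_def t_def ph_def
      by (intro continuous_on_Re continuous_on_add continuous_on_mult continuous_on_of_real 
         continuous_on_max continuous_on_diff continuous_on_const cm)
  qed
  have cf2: "continuous_on (D \<inter> {x. x ?m \<ge> 1/2}) (\<lambda>x. f x i)" for i
  proof (rule continuous_on_eq)
    show "continuous_on (D \<inter> {x. x ?m \<ge> 1/2}) (\<lambda>x. Re (s (p x) i))"
      by (intro continuous_on_Re continuous_on_subset[OF cpi]) auto
  qed (auto simp: f_def t_def ph_def)
  have closedD: "closed D"
  proof -
    have "D = {x. (\<Sum>i\<le>?m. (x i)\<^sup>2) = 1} \<inter> (\<Inter>i\<in>{?m<..}. {x. x i = 0}) \<inter> {x. x ?m \<ge> 0}"
      (is "_ = ?A \<inter> ?B \<inter> _")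
      unfolding D_def sph_def by blast
    moreover have "closed ?A"
      by (rule closed_Collect_eq[OF continuous_on_sum[OF continuous_on_power[OF continuous_on_coordinate[OF continuous_on_id]]]
         continuous_on_const])
    moreover have "closed ?B"
      by (rule closed_INT, rule ballI, rule closed_Collect_eq[OF continuous_on_coordinate[OF continuous_on_id] continuous_on_const])
    ultimately show ?thesis using closed_Int[OF closed_Int clo(4)] by (simp only:)
  qed
  have cfi: "continuous_on D (\<lambda>x. f x i)" for i
  proof -
    have "D = (D \<inter> {x. x ?m \<le> 1/2}) \<union> (D \<inter> {x. x ?m \<ge> 1/2})" by auto
    then show ?thesis 
      using continuous_on_closed_Un[OF closed_Int[OF closedD clo(1)] closed_Int[OF closedD clo(2)] cf1 cf2] by simp
  qed
  have cf: "continuous_on D f" by (rule continuous_on_coordinatewise_then_product[OF cfi])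
  define D' where "D' = {x \<in> sph ?m. x ?m \<le> 0}"
  have D'D: "(\<lambda>i. - x i) \<in> D \<longleftrightarrow> x \<in> D'" for x by (auto simp: D_def D'_def)
  have closedD': "closed D'"
  proof -
    have "D' = (\<lambda>x i. - x i) -` D" using D'D by auto
    then show ?thesis using closed_vimage[OF closedD cneg[of UNIV]] by simp
  qed
  have cF: "continuous_on (sph ?m) F"
  proof -
    have "continuous_on D F" 
      by (rule continuous_on_eq[OF cf]) (simp add: F_def D_def)
    moreover have "continuous_on D' F"
    proof (rule continuous_on_eq)
      show "continuous_on D' (\<lambda>x. f (\<lambda>i. - x i))"
        by (rule continuous_on_compose2[OF cf cneg]) (use D'D in auto)
      fix x assume x: "x \<in> D'"
      show "f (\<lambda>i. - x i) = F x"
      proof (cases "x ?m = 0")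
        case True
        then have "x \<in> sph n" using x sph_equator by (auto simp: D'_def)
        then show ?thesis using even_eq True by (simp add: F_def)
      qed (use x in \<open>simp add: F_def D'_def\<close>)
    qed
    moreover have "sph ?m = D \<union> D'" by (auto simp: D_def D'_def)
    ultimately show ?thesis using continuous_on_closed_Un[OF closedD closedD'] by simp
  qed
  \<comment> \<open>On the equator \<open>ph\<close> is 1, so the real part has squared length at
    least 1. If all \<open>?m + 1\<close> coordinates were smaller than this reciprocal, the squared
    length would be below 1. The Lipschitz constant doubles because \<open>f\<close> adds two values
    of \<open>s\<close>.\<close>
  define \<delta> where "\<delta> = 1 / real (?m + 1)"
  have "\<exists>w\<in>sph ?m. \<forall>y\<in>sph n. \<forall>c>0. f y \<noteq> (\<lambda>i. c * w i)"
  proof (rule lipschitz_image_misses_direction[where \<delta> = \<delta> and Lc = "2 * Lc"])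
    fix y y' B i assume y: "y \<in> sph n" "y' \<in> sph n" and B: "\<And>j. j \<le> n \<Longrightarrow> \<bar>y j - y' j\<bar> \<le> B"
    have 1: "cmod (s y i - s y' i) \<le> Lc * B" by (rule lip[OF y B])
    have 2: "cmod (s (\<lambda>j. - y j) i - s (\<lambda>j. - y' j) i) \<le> Lc * B" 
      by (rule lip[OF eqD(4)[OF y(1)] eqD(4)[OF y(2)]]) (use B in \<open>simp add: abs_minus_commute\<close>)
    have "f y i - f y' i = Re (s y i - s y' i) + Re (s (\<lambda>j. - y j) i - s (\<lambda>j. - y' j) i)"
      using feq y by simp
    then show "\<bar>f y i - f y' i\<bar> \<le> 2 * Lc * B"
      using 1 2 abs_Re_le_cmod[of "s y i - s y' i"] abs_Re_le_cmod[of "s (\<lambda>j. - y j) i - s (\<lambda>j. - y' j) i"] by linarith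
  next
    fix y assume y: "y \<in> sph n"
    show "\<exists>i\<le>Suc n. \<bar>f y i\<bar> \<ge> \<delta>"
    proof (rule ccontr)
      assume "\<not> ?thesis"
      then have lt: "\<bar>f y i\<bar> < \<delta>" if "i \<le> ?m" for i using that by (metis not_le)
      have "(\<Sum>i\<le>?m. (f y i)\<^sup>2) < (\<Sum>i\<le>?m. \<delta>)"
      proof (rule sum_strict_mono)
        fix i assume "i \<in> {..?m}"
        then have a: "\<bar>f y i\<bar> < \<delta>" using lt by simp
        have "(f y i)\<^sup>2 = \<bar>f y i\<bar> * \<bar>f y i\<bar>" by (simp add: power2_eq_square)
        also have "\<dots> \<le> \<bar>f y i\<bar> * 1"
        proof (rule mult_left_mono)
          have "\<delta> \<le> 1" by (simp add: \<delta>_def)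
          then show "\<bar>f y i\<bar> \<le> 1" using a by linarith
        qed simp
        finally show "(f y i)\<^sup>2 < \<delta>" using a by simp
      qed auto
      also have "\<dots> = 1" by (simp add: \<delta>_def)
      finally show False using f2[OF eqD(1)[OF y]] fixp(2)[OF y] by simp
    qed
  qed (simp add: \<delta>_def)
  then obtain w where w: "w \<in> sph ?m" "\<And>y c. y \<in> sph n \<Longrightarrow> c > 0 \<Longrightarrow> f y \<noteq> (\<lambda>i. c * w i)" by blast
  show False
  proof (rule no_even_map_close_to_identity[OF _ cF _ _ _ w(1)])
    show "?m \<noteq> 0" by simp
    show "F x i = 0" if "x \<in> sph ?m" "i > ?m" for x i
      using supp that by (simp add: F_def f_def t_def)
    show "F (\<lambda>i. - x i) = F x" if x: "x \<in> sph ?m" for x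
    proof (cases "x ?m = 0")
      case True
      then have "x \<in> sph n" using x sph_equator by auto
      then show ?thesis using even_eq True by (simp add: F_def)
    qed (simp add: F_def)
    show "F x \<noteq> (\<lambda>i. - c * x i)" if x: "x \<in> sph ?m" and "c \<ge> 0" for x c
    proof (cases "x ?m \<ge> 0")
      case True
      then show ?thesis using away[of x "-c"] x by (simp add: F_def D_def)
    next
      case False
      then show ?thesis using away[of "\<lambda>i. - x i" c] x by (simp add: F_def D_def)
    qed
    show "F x \<noteq> (\<lambda>i. c * w i)" if "x \<in> sph ?m" "x ?m = 0" "c > 0" for x c
      using w(2)[of x c] that sph_equator[of x n] by (simp add: F_def)
  qed
qed

end

section \<open>Families of projections\<close>

text \<open>Boundedness is included to make the class closed under products. The function
  \<open>d\<close> is a parameter because both pairs of a time and a point and points alone are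
  compared, in each case by sums of absolute differences.\<close>

definition bounded_lipschitz :: "'a set \<Rightarrow> ('a \<Rightarrow> 'a \<Rightarrow> real) \<Rightarrow> ('a \<Rightarrow> 'b::real_normed_vector) \<Rightarrow> bool" where
  "bounded_lipschitz X d f \<longleftrightarrow>
     (\<exists>C\<ge>0. (\<forall>x\<in>X. norm (f x) \<le> C) \<and> (\<forall>x\<in>X. \<forall>y\<in>X. norm (f x - f y) \<le> C * d x y))"

lemma bounded_lipschitzI:
  assumes d: "\<And>x y. d x y \<ge> 0"
    and "\<And>x. x \<in> X \<Longrightarrow> norm (f x) \<le> A" "\<And>x y. x \<in> X \<Longrightarrow> y \<in> X \<Longrightarrow> norm (f x - f y) \<le> B * d x y"
  shows "bounded_lipschitz X d f"
proof -
  let ?C = "max 0 (max A B)"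
  have "norm (f x) \<le> ?C" if "x \<in> X" for x using assms(2)[OF that] by simp
  moreover have "norm (f x - f y) \<le> ?C * d x y" if "x \<in> X" "y \<in> X" for x y
    using order_trans[OF assms(3)[OF that] mult_right_mono[OF _ d[of x y], of B ?C]] by simp
  ultimately show ?thesis unfolding bounded_lipschitz_def by (intro exI[of _ ?C]) auto
qed

lemma bounded_lipschitz_const:
  assumes d: "\<And>x y. d x y \<ge> 0"
  shows "bounded_lipschitz X d (\<lambda>x. c)"
  by (rule bounded_lipschitzI[OF d, of X _ "norm c" 0]) simp_all

lemma bounded_lipschitz_add:
  assumes d: "\<And>x y. d x y \<ge> 0" and "bounded_lipschitz X d f" "bounded_lipschitz X d g"
  shows "bounded_lipschitz X d (\<lambda>x. f x + g x)"
proof -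
  obtain A B where A: "\<And>x. x \<in> X \<Longrightarrow> norm (f x) \<le> A" "\<And>x y. x \<in> X \<Longrightarrow> y \<in> X \<Longrightarrow> norm (f x - f y) \<le> A * d x y"
    and B: "\<And>x. x \<in> X \<Longrightarrow> norm (g x) \<le> B" "\<And>x y. x \<in> X \<Longrightarrow> y \<in> X \<Longrightarrow> norm (g x - g y) \<le> B * d x y"
    using assms(2,3) unfolding bounded_lipschitz_def by metis
  show ?thesis
  proof (rule bounded_lipschitzI[OF d, of X _ "A + B" "A + B"])
    fix x assume "x \<in> X" then show "norm (f x + g x) \<le> A + B"
      using A(1)[of x] B(1)[of x] norm_triangle_ineq[of "f x" "g x"] by linarith
  next
    fix x y assume "x \<in> X" "y \<in> X"
    then show "norm (f x + g x - (f y + g y)) \<le> (A + B) * d x y"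
      using A(2)[of x y] B(2)[of x y] norm_diff_triangle_ineq[of "f x" "g x" "f y" "g y"]
      by (simp add: distrib_right)
  qed
qed

lemma bounded_lipschitz_mult:
  fixes f g :: "'a \<Rightarrow> 'b::real_normed_algebra"
  assumes d: "\<And>x y. d x y \<ge> 0" and "bounded_lipschitz X d f" "bounded_lipschitz X d g"
  shows "bounded_lipschitz X d (\<lambda>x. f x * g x)"
proof -
  obtain A B where A: "A \<ge> 0" "\<And>x. x \<in> X \<Longrightarrow> norm (f x) \<le> A" "\<And>x y. x \<in> X \<Longrightarrow> y \<in> X \<Longrightarrow> norm (f x - f y) \<le> A * d x y"
    and B: "B \<ge> 0" "\<And>x. x \<in> X \<Longrightarrow> norm (g x) \<le> B" "\<And>x y. x \<in> X \<Longrightarrow> y \<in> X \<Longrightarrow> norm (g x - g y) \<le> B * d x y"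
    using assms(2,3) unfolding bounded_lipschitz_def by metis
  show ?thesis
  proof (rule bounded_lipschitzI[OF d, of X _ "A * B" "2 * (A * B)"])
    fix x assume "x \<in> X" 
    then show "norm (f x * g x) \<le> A * B"
      using A(1) A(2)[of x] B(2)[of x] norm_mult_ineq[of "f x" "g x"] 
        mult_mono[of "norm (f x)" A "norm (g x)" B] by simp
  next
    fix x y assume xy: "x \<in> X" "y \<in> X"
    have "f x * g x - f y * g y = (f x - f y) * g x + f y * (g x - g y)" by (simp add: algebra_simps)
    then have "norm (f x * g x - f y * g y) \<le> norm (f x - f y) * norm (g x) + norm (f y) * norm (g x - g y)"
      by (metis add_mono norm_mult_ineq norm_triangle_le)
    also have "norm (f x - f y) * norm (g x) \<le> (A * d x y) * B"
      using A(3)[OF xy] B(2)[OF xy(1)] A(1) d by (intro mult_mono) auto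
    also have "norm (f y) * norm (g x - g y) \<le> A * (B * d x y)"
      using B(3)[OF xy] A(2)[OF xy(2)] A(1) d by (intro mult_mono) auto
    finally show "norm (f x * g x - f y * g y) \<le> 2 * (A * B) * d x y" by (simp add: mult_ac)
  qed
qed

lemma bounded_lipschitz_sum:
  assumes d: "\<And>x y. d x y \<ge> 0" and "\<And>i. i \<in> I \<Longrightarrow> bounded_lipschitz X d (f i)"
  shows "bounded_lipschitz X d (\<lambda>x. \<Sum>i\<in>I. f i x)"
  using assms(2)
proof (induction I rule: infinite_finite_induct)
  case (insert i I)
  then show ?case by (simp add: bounded_lipschitz_add[OF d])
qed (simp_all add: bounded_lipschitz_const d)

lemma bounded_lipschitz_of_real:
  assumes "bounded_lipschitz X d f"
  shows "bounded_lipschitz X d (\<lambda>x. of_real (f x) :: 'b::real_normed_algebra_1)"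
  using assms by (simp add: bounded_lipschitz_def flip: of_real_diff)

text \<open>For the two roots \<open>a\<close> and \<open>b\<close>, the difference of reciprocals
  is a difference of squares divided by \<open>a * b * (a + b)\<close>. Both roots are at least 1/2,
  so this divisor is at least 1/4, whence the constant \<open>4 * A\<close>.\<close>

lemma bounded_lipschitz_inverse_sqrt:
  assumes d: "\<And>x y. d x y \<ge> 0" and f: "bounded_lipschitz X d f" and low: "\<And>x. x \<in> X \<Longrightarrow> f x \<ge> (1/2 :: real)"
  shows "bounded_lipschitz X d (\<lambda>x. 1 / sqrt (f x))"
proof -
  obtain A where A: "\<And>x y. x \<in> X \<Longrightarrow> y \<in> X \<Longrightarrow> norm (f x - f y) \<le> A * d x y"
    using f unfolding bounded_lipschitz_def by metis
  have s: "sqrt (f x) \<ge> 1/2" if "x \<in> X" for x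
    by (rule real_le_rsqrt) (use low[OF that] in \<open>simp add: power2_eq_square\<close>)
  show ?thesis
  proof (rule bounded_lipschitzI[OF d, of X _ 2 "4 * A"])
    fix x assume "x \<in> X" 
    then have "sqrt (f x) \<ge> 1/2" by (rule s)
    then have "1 / sqrt (f x) \<le> 1 / (1/2)" using \<open>sqrt (f x) \<ge> 1/2\<close> by (intro divide_left_mono mult_pos_pos) linarith+
    moreover have "norm (1 / sqrt (f x)) = 1 / sqrt (f x)" using \<open>sqrt (f x) \<ge> 1/2\<close> by (simp add: abs_of_nonneg)
    ultimately show "norm (1 / sqrt (f x)) \<le> 2" by simp
  next
    fix x y assume xy: "x \<in> X" "y \<in> X"
    define a where "a = sqrt (f x)" define b where "b = sqrt (f y)"
    have ab: "a \<ge> 1/2" "b \<ge> 1/2" using s xy by (auto simp: a_def b_def)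
    have f: "f x = a * a" "f y = b * b" using low xy by (force simp: a_def b_def)+
    have "a * b \<ge> 1/2 * (1/2)" using ab by (intro mult_mono) auto
    then have "1/4 * 1 \<le> (a * b) * (a + b)" using ab by (intro mult_mono) auto
    moreover have "(1 / a - 1 / b) * ((a * b) * (a + b)) = b * b - a * a"
      using ab by (simp add: field_simps)
    then have "\<bar>1 / a - 1 / b\<bar> * ((a * b) * (a + b)) = \<bar>f x - f y\<bar>"
      using ab unfolding f by (metis abs_minus_commute abs_mult abs_of_pos add_pos_pos half_gt_zero_iff less_le_trans mult_pos_pos zero_less_one)
    ultimately have "\<bar>1 / a - 1 / b\<bar> * (1/4) \<le> \<bar>f x - f y\<bar>"
      by (metis abs_ge_zero mult.right_neutral mult_left_mono)
    then show "norm (1 / sqrt (f x) - 1 / sqrt (f y)) \<le> 4 * A * d x y"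
      using A[OF xy] by (simp add: a_def b_def)
  qed
qed

lemma bounded_lipschitz_reindex:
  assumes "bounded_lipschitz X d f" "\<And>y. y \<in> Y \<Longrightarrow> h y \<in> X" "\<And>y y'. d (h y) (h y') = d' y y'"
  shows "bounded_lipschitz Y d' (\<lambda>y. f (h y))"
  using assms unfolding bounded_lipschitz_def by metis

lemma bounded_lipschitz_uniform:
  assumes "finite I" and d: "\<And>x y. d x y \<ge> 0" and "\<And>i. i \<in> I \<Longrightarrow> bounded_lipschitz X d (f i)"
  shows "\<exists>C\<ge>0. \<forall>i\<in>I. \<forall>x\<in>X. \<forall>y\<in>X. norm (f i x - f i y) \<le> C * d x y"
proof -
  obtain C where C: "\<And>i. i \<in> I \<Longrightarrow> C i \<ge> 0" 
     "\<And>i x y. i \<in> I \<Longrightarrow> x \<in> X \<Longrightarrow> y \<in> X \<Longrightarrow> norm (f i x - f i y) \<le> C i * d x y"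
    using assms(3) unfolding bounded_lipschitz_def by metis
  have "norm (f i x - f i y) \<le> sum C I * d x y" if "i \<in> I" "x \<in> X" "y \<in> X" for i x y
    using C(2)[OF that] mult_right_mono[OF member_le_sum[of i I C] d[of x y]] C(1) that assms(1) by fastforce
  then show ?thesis using sum_nonneg[of I C] C(1) by blast
qed

section \<open>Polynomial functions, symmetric matrices and their estimates\<close>

inductive polyf :: "((nat \<Rightarrow> complex) \<Rightarrow> complex) \<Rightarrow> bool" where
  polyf_const: "polyf (\<lambda>z. c)"
| polyf_coord: "polyf (\<lambda>z. z i)"
| polyf_add: "polyf f \<Longrightarrow> polyf g \<Longrightarrow> polyf (\<lambda>z. f z + g z)"
| polyf_mult: "polyf f \<Longrightarrow> polyf g \<Longrightarrow> polyf (\<lambda>z. f z * g z)"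

lemma polyf_bounded_lipschitz:
  assumes "polyf f" "\<And>x y. d x y \<ge> 0" "\<And>i. bounded_lipschitz X d (\<lambda>x. v x i)"
  shows "bounded_lipschitz X d (\<lambda>x. f (v x))"
  using assms(1)
  by induction (simp_all add: bounded_lipschitz_const bounded_lipschitz_add bounded_lipschitz_mult assms(2,3))

text \<open>Vectors are functions on all natural numbers; the value 0 above \<open>n\<close> lets
  equations between vectors be equations between functions.\<close>

definition apply_matrix :: "nat \<Rightarrow> (nat \<Rightarrow> nat \<Rightarrow> complex) \<Rightarrow> (nat \<Rightarrow> complex) \<Rightarrow> nat \<Rightarrow> complex" where
  "apply_matrix n A s = (\<lambda>i. if i \<le> n then \<Sum>j\<le>n. A i j * s j else 0)"

lemma bil_apply_matrix:
  assumes "\<And>i j. i \<le> n \<Longrightarrow> j \<le> n \<Longrightarrow> A i j = A j i"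
  shows "bil n (apply_matrix n A s) t = bil n s (apply_matrix n A t)"
proof -
  have "bil n (apply_matrix n A s) t = (\<Sum>i\<le>n. \<Sum>j\<le>n. A i j * s j * t i)"
    by (simp add: bil_def apply_matrix_def sum_distrib_right)
  also have "\<dots> = (\<Sum>j\<le>n. \<Sum>i\<le>n. A i j * s j * t i)" by (rule sum.swap)
  also have "\<dots> = bil n s (apply_matrix n A t)"
    unfolding bil_def apply_matrix_def sum_distrib_left 
    by (intro sum.cong refl) (simp add: assms sum_distrib_left mult_ac)
  finally show ?thesis .
qed

lemma bil_diff_square:
  "bil n (\<lambda>i. a i - b i) (\<lambda>i. a i - b i) = bil n a a - 2 * bil n a b + bil n b b"
proof -
  have "(a i - b i) * (a i - b i) = a i * a i - 2 * (a i * b i) + b i * b i" for i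
    by (simp add: algebra_simps)
  then show ?thesis by (simp add: bil_def sum.distrib sum_subtractf sum_distrib_left)
qed

text \<open>Over the complex numbers \<open>bil\<close> has isotropic vectors and bounds no entry,
  so the transported vector is controlled by a genuine norm.\<close>

definition norm1 :: "nat \<Rightarrow> (nat \<Rightarrow> complex) \<Rightarrow> real" where
  "norm1 n s = (\<Sum>i\<le>n. cmod (s i))"

lemma norm1_nonneg: "norm1 n s \<ge> 0" by (simp add: norm1_def sum_nonneg)

lemma norm1_triangle: "norm1 n (\<lambda>i. a i + b i) \<le> norm1 n a + norm1 n b"
  by (simp add: norm1_def norm_triangle_ineq sum_mono flip: sum.distrib)

lemma bil_le_norm1: "cmod (bil n s t) \<le> norm1 n s * norm1 n t"
proof -
  have "cmod (bil n s t) \<le> (\<Sum>i\<le>n. cmod (s i) * cmod (t i))"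
    unfolding bil_def by (rule sum_norm_le) (simp add: norm_mult)
  also have "\<dots> \<le> (\<Sum>i\<le>n. cmod (s i) * norm1 n t)"
    unfolding norm1_def by (intro sum_mono mult_left_mono member_le_sum) auto
  finally show ?thesis by (simp add: norm1_def sum_distrib_right)
qed

lemma norm1_apply_diff:
  assumes c: "\<And>i j. i \<le> n \<Longrightarrow> j \<le> n \<Longrightarrow> cmod (A i j - B i j) \<le> c"
  shows "norm1 n (\<lambda>i. apply_matrix n A s i - apply_matrix n B s i) \<le> real (n + 1) * c * norm1 n s"
proof -
  have "cmod (apply_matrix n A s i - apply_matrix n B s i) \<le> c * norm1 n s" if i: "i \<le> n" for i
  proof -
    have "apply_matrix n A s i - apply_matrix n B s i = (\<Sum>j\<le>n. (A i j - B i j) * s j)"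
      using i by (simp add: apply_matrix_def sum_subtractf left_diff_distrib)
    also have "cmod \<dots> \<le> (\<Sum>j\<le>n. c * cmod (s j))"
      using c[OF i] by (intro sum_norm_le) (simp add: norm_mult mult_right_mono)
    finally show ?thesis by (simp add: norm1_def sum_distrib_left)
  qed
  then have "norm1 n (\<lambda>i. apply_matrix n A s i - apply_matrix n B s i) \<le> (\<Sum>i\<le>n. c * norm1 n s)"
    unfolding norm1_def by (intro sum_mono) auto
  then show ?thesis by (simp add: mult_ac)
qed


text \<open>The path is the normalised segment from the pole \<open>e\<close> to \<open>u\<close>.
  Since \<open>u n \<ge> 0\<close>, the squared length before normalising is at least
  \<open>(1 - t)^2 + t^2\<close>, hence at least 1/2, which makes the normalisation Lipschitz in
  time and endpoint together.\<close>

lemma sph_path: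
  fixes n :: nat
  defines "D \<equiv> {x \<in> sph n. x n \<ge> 0}"
  defines "e \<equiv> \<lambda>i. if i = n then 1 else (0::real)"
  defines "d \<equiv> \<lambda>p p'. \<bar>fst p - fst p'\<bar> + (\<Sum>j\<le>n. \<bar>snd p j - snd p' j\<bar>)"
  obtains v where "\<And>t u. t \<in> {0..1} \<Longrightarrow> u \<in> D \<Longrightarrow> v (t, u) \<in> sph n"
    and "\<And>u. u \<in> D \<Longrightarrow> v (0, u) = e" "\<And>u. u \<in> D \<Longrightarrow> v (1, u) = u"
    and "\<And>i. bounded_lipschitz ({0..1} \<times> D) d (\<lambda>p. v p i)"
proof -
  let ?X = "{0..1} \<times> D"
  define q where "q p i = (1 - fst p) * e i + fst p * snd p i" for p :: "real \<times> (nat \<Rightarrow> real)" and i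
  define S where "S p = (\<Sum>j\<le>n. q p j * q p j)" for p
  define v where "v p i = q p i * (1 / sqrt (S p))" for p i
  have d: "d p p' \<ge> 0" for p p' by (simp add: d_def sum_nonneg)
  have u1: "(\<Sum>j\<le>n. u j * u j) = 1" "\<And>i. i > n \<Longrightarrow> u i = 0" "u n \<ge> 0" if "u \<in> D" for u
    using that by (auto simp: D_def sph_def power2_eq_square)
  have S: "S (t, u) = (1 - t)\<^sup>2 + 2 * t * (1 - t) * u n + t\<^sup>2" if u: "u \<in> D" for t u
  proof -
    have "q (t, u) j * q (t, u) j = (if j = n then (1 - t)\<^sup>2 + 2 * t * (1 - t) * u n else 0) + t\<^sup>2 * (u j * u j)" for j
      by (simp add: q_def e_def power2_eq_square algebra_simps)
    then show ?thesis using u1(1)[OF u] by (simp add: S_def sum.distrib flip: sum_distrib_left)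
  qed
  have Slow: "S p \<ge> 1/2" if p: "p \<in> ?X" for p
  proof -
    obtain t u where p': "p = (t, u)" "t \<in> {0..1}" "u \<in> D" using p by auto
    have "2 * t * (1 - t) * u n \<ge> 0" using p'(2) u1(3)[OF p'(3)] by simp
    moreover have "(1 - t)\<^sup>2 + t\<^sup>2 \<ge> 1/2" 
      using zero_le_power2[of "2 * t - 1"] by (simp add: power2_eq_square algebra_simps)
    ultimately show ?thesis unfolding p'(1) S[OF p'(3)] by linarith
  qed
  show ?thesis
  proof (rule that)
    show "v (t, u) \<in> sph n" if t: "t \<in> {0..1}" and u: "u \<in> D" for t u
    proof -
      have "(\<Sum>i\<le>n. (v (t, u) i)\<^sup>2) = (\<Sum>i\<le>n. q (t, u) i * q (t, u) i) * (1 / sqrt (S (t, u)))\<^sup>2"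
        unfolding v_def sum_distrib_right by (simp add: power2_eq_square mult_ac)
      also have "\<dots> = 1" using Slow[of "(t, u)"] t u by (simp add: power_divide flip: S_def)
      finally show ?thesis using u1(2)[OF u] by (auto simp: sph_def v_def q_def e_def)
    qed
    show "v (0, u) = e" if u: "u \<in> D" for u using S[OF u, of 0] by (simp add: v_def q_def fun_eq_iff)
    show "v (1, u) = u" if u: "u \<in> D" for u using S[OF u, of 1] by (simp add: v_def q_def fun_eq_iff)
    have q: "bounded_lipschitz ?X d (\<lambda>p. q p i)" for i
    proof -
      have fst: "bounded_lipschitz ?X d fst"
      proof (rule bounded_lipschitzI[OF d, of _ _ 1 1])
        show "norm (fst p - fst p') \<le> 1 * d p p'" for p p'
          by (simp add: d_def sum_nonneg)
      qed auto
      have snd: "bounded_lipschitz ?X d (\<lambda>p. snd p i)"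
      proof (cases "i \<le> n")
        case True
        show ?thesis
        proof (rule bounded_lipschitzI[OF d, of _ _ 1 1])
          show "norm (snd p i - snd p' i) \<le> 1 * d p p'" for p p'
            using member_le_sum[of i "{..n}" "\<lambda>j. \<bar>snd p j - snd p' j\<bar>"] True by (simp add: d_def)
          show "norm (snd p i) \<le> 1" if p: "p \<in> ?X" for p
          proof -
            have "(snd p i)\<^sup>2 \<le> (\<Sum>j\<le>n. (snd p j)\<^sup>2)" using True by (intro member_le_sum) auto
            also have "\<dots> = 1" using p by (auto simp: D_def sph_def)
            finally show ?thesis by (simp add: abs_square_le_1)
          qed
        qed
      next
        case False
        then have z: "snd p i = 0" if "p \<in> ?X" for p using that by (auto simp: D_def sph_def)
        show ?thesis
          by (rule bounded_lipschitzI[OF d, of _ _ 0 0])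
             (simp_all only: z norm_zero diff_self mult_zero_left order_refl)
      qed
      have "bounded_lipschitz ?X d (\<lambda>p. (1 + (-1) * fst p) * e i + fst p * snd p i)"
        by (intro bounded_lipschitz_add[OF d] bounded_lipschitz_mult[OF d] bounded_lipschitz_const[OF d] fst snd)
      then show ?thesis by (simp add: q_def[abs_def])
    qed
    have "bounded_lipschitz ?X d S"
      unfolding S_def[abs_def] by (intro bounded_lipschitz_sum[OF d] bounded_lipschitz_mult[OF d] q)
    then show "bounded_lipschitz ?X d (\<lambda>p. v p i)" for i
      unfolding v_def by (intro bounded_lipschitz_mult[OF d] q bounded_lipschitz_inverse_sqrt[OF d]) (use Slow in auto)
  qed
qed

text \<open>
  Each projection step changes \<open>bil m s s\<close> only by the square of the displacement, which is
  of order \<open>1 / N\<close>; so it stays near \<open>1\<close> after \<open>N\<close> steps.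
\<close>

lemma no_projection_family:
  fixes n :: nat and P :: "(nat \<Rightarrow> complex) \<Rightarrow> nat \<Rightarrow> nat \<Rightarrow> complex"
  defines "m \<equiv> Suc n"
  defines "Q \<equiv> \<lambda>x. P (\<lambda>i. complex_of_real (x i))"
  assumes poly: "\<And>i j. polyf (\<lambda>z. P z i j)"
    and idem: "\<And>x s. x \<in> sph m \<Longrightarrow> apply_matrix m (Q x) (apply_matrix m (Q x) s) = apply_matrix m (Q x) s"
    and sym: "\<And>x i j. x \<in> sph m \<Longrightarrow> Q x i j = Q x j i"
    and anti: "\<And>x s. x \<in> sph m \<Longrightarrow> apply_matrix m (Q x) (apply_matrix m (Q (\<lambda>i. - x i)) s) = (\<lambda>i. 0)"
    and tang: "\<And>x. x \<in> sph m \<Longrightarrow> apply_matrix m (Q x) (\<lambda>i. of_real (x i)) = (\<lambda>i. 0)"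
    and w0: "apply_matrix m (Q (\<lambda>i. if i = m then 1 else 0)) w0 = w0" "bil m w0 w0 = 1"
  shows False
proof -
  define D where "D = {x \<in> sph m. x m \<ge> 0}"
  define e where "e = (\<lambda>i. if i = m then 1 else (0::real))"
  define d where "d = (\<lambda>p p' :: real \<times> (nat \<Rightarrow> real). \<bar>fst p - fst p'\<bar> + (\<Sum>j\<le>m. \<bar>snd p j - snd p' j\<bar>))"
  define d' where "d' = (\<lambda>u u' :: nat \<Rightarrow> real. \<Sum>j\<le>m. \<bar>u j - u' j\<bar>)"
  have d: "d p p' \<ge> 0" for p p' by (simp add: d_def sum_nonneg)
  have d': "d' p p' \<ge> 0" for p p' by (simp add: d'_def sum_nonneg)
  obtain v where v: "\<And>t u. t \<in> {0..1} \<Longrightarrow> u \<in> D \<Longrightarrow> v (t, u) \<in> sph m"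
    and v0: "\<And>u. u \<in> D \<Longrightarrow> v (0, u) = e" and v1: "\<And>u. u \<in> D \<Longrightarrow> v (1, u) = u"
    and vlip: "\<And>i. bounded_lipschitz ({0..1} \<times> D) d (\<lambda>p. v p i)"
    using sph_path[of m thesis] unfolding D_def e_def d_def by blast
  have Qlip: "bounded_lipschitz ({0..1} \<times> D) d (\<lambda>p. Q (v p) i j)" for i j
    unfolding Q_def by (rule polyf_bounded_lipschitz[OF poly d bounded_lipschitz_of_real[OF vlip]])
  have "\<exists>C\<ge>0. \<forall>ij\<in>{..m}\<times>{..m}. \<forall>p\<in>{0..1} \<times> D. \<forall>p'\<in>{0..1} \<times> D. 
      norm ((\<lambda>p. Q (v p) (fst ij) (snd ij)) p - (\<lambda>p. Q (v p) (fst ij) (snd ij)) p') \<le> C * d p p'"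
    by (rule bounded_lipschitz_uniform[OF _ d Qlip]) simp
  then obtain C where C: "C \<ge> 0" and QC: "\<And>i j p p'. i \<le> m \<Longrightarrow> j \<le> m \<Longrightarrow> p \<in> {0..1} \<times> D \<Longrightarrow> p' \<in> {0..1} \<times> D \<Longrightarrow>
      cmod (Q (v p) i j - Q (v p') i j) \<le> C * d p p'" by fastforce
  define C1 where "C1 = real (m + 1) * C"
  have C1: "C1 \<ge> 0" using C by (simp add: C1_def)
  \<comment> \<open>One step multiplies \<open>norm1\<close> by at most \<open>1 + C1 / N\<close>,
    and the \<open>N\<close>-th power of this is below \<open>exp C1\<close> for every
    \<open>N\<close>. So \<open>B\<close> bounds all intermediate vectors and can be fixed before
    the number of steps.\<close>
  define B where "B = exp C1 * norm1 m w0"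
  have B: "B \<ge> 0" by (simp add: B_def norm1_nonneg)
  \<comment> \<open>Each of the \<open>N\<close> steps changes the square by at most
    \<open>(C1 * B / N)^2\<close>. The choice makes the accumulated error
    \<open>(C1 * B)^2 / N\<close> at most 1/2.\<close>
  obtain N0 :: nat where N0: "2 * (C1 * B)\<^sup>2 < real N0" using reals_Archimedean2 by blast
  define N where "N = N0 + 1"
  have N: "N > 0" "2 * (C1 * B)\<^sup>2 \<le> real N" using N0 by (auto simp: N_def)
  define Qk where "Qk k u = Q (v (real k / real N, u))" for k u
  define sec where "sec k u = rec_nat w0 (\<lambda>k s. apply_matrix m (Qk (Suc k) u) s) k" for k u
  have sec0: "sec 0 u = w0" and secS: "sec (Suc k) u = apply_matrix m (Qk (Suc k) u) (sec k u)" for k u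
    by (simp_all add: sec_def)
  have kX: "(real k / real N, u) \<in> {0..1} \<times> D" if "k \<le> N" "u \<in> D" for k u using that N by simp
  have vk: "v (real k / real N, u) \<in> sph m" if "k \<le> N" "u \<in> D" for k u using v kX[OF that] by blast
  have fixk: "apply_matrix m (Qk k u) (sec k u) = sec k u" if "k \<le> N" "u \<in> D" for k u
  proof (cases k)
    case 0
    then show ?thesis using w0(1) v0[OF that(2)] by (simp add: Qk_def sec0 e_def)
  next
    case (Suc l)
    then show ?thesis using idem[OF vk[OF that]] by (simp add: secS Qk_def)
  qed
  define r where "r k u = (\<lambda>i. sec k u i - sec (Suc k) u i)" for k u
  have rn: "norm1 m (r k u) \<le> C1 / N * norm1 m (sec k u)" if k: "k < N" and u: "u \<in> D" for k u
  proof -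
    have "r k u = (\<lambda>i. apply_matrix m (Qk k u) (sec k u) i - apply_matrix m (Qk (Suc k) u) (sec k u) i)"
      using fixk[of k u] k u by (simp add: r_def secS)
    moreover have "cmod (Qk k u i j - Qk (Suc k) u i j) \<le> C / N" if "i \<le> m" "j \<le> m" for i j
    proof -
      have "d (real k / real N, u) (real (Suc k) / real N, u) = \<bar>real k / real N - real (Suc k) / real N\<bar>" by (simp add: d_def)
      also have "\<dots> = 1 / N" by (simp flip: diff_divide_distrib)
      finally show ?thesis using QC[OF that kX[of k u] kX[of "Suc k" u]] k u by (simp add: Qk_def)
    qed
    ultimately have "norm1 m (r k u) \<le> real (m + 1) * (C / N) * norm1 m (sec k u)"
      using norm1_apply_diff[of m "Qk k u" "Qk (Suc k) u" "C / N"] by simp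
    then show ?thesis by (simp add: C1_def)
  qed
  have grow: "norm1 m (sec k u) \<le> (1 + C1 / N) ^ k * norm1 m w0" if "k \<le> N" "u \<in> D" for k u
    using that
  proof (induction k)
    case (Suc k)
    have "sec (Suc k) u = (\<lambda>i. sec k u i + - r k u i)" by (simp add: r_def)
    then have "norm1 m (sec (Suc k) u) \<le> norm1 m (sec k u) + norm1 m (\<lambda>i. - r k u i)"
      using norm1_triangle by metis
    also have "norm1 m (\<lambda>i. - r k u i) = norm1 m (r k u)" by (simp add: norm1_def)
    also have "norm1 m (sec k u) + norm1 m (r k u) \<le> (1 + C1 / N) * norm1 m (sec k u)"
      using rn[of k u] Suc.prems by (simp add: algebra_simps)
    also have "\<dots> \<le> (1 + C1 / N) * ((1 + C1 / N) ^ k * norm1 m w0)"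
      using Suc C1 by (intro mult_left_mono) auto
    finally show ?case by simp
  qed (simp add: sec0)
  have secB: "norm1 m (sec k u) \<le> B" if "k \<le> N" "u \<in> D" for k u
  proof -
    have "(1 + C1 / N) ^ k \<le> (1 + C1 / N) ^ N" using that C1 by (intro power_increasing) auto
    also have "\<dots> \<le> exp C1" using C1 N(1) by (intro exp_ge_one_plus_x_over_n_power_n) auto
    finally have "(1 + C1 / N) ^ k * norm1 m w0 \<le> B"
      unfolding B_def by (intro mult_right_mono norm1_nonneg)
    then show ?thesis using grow[OF that] by linarith
  qed
  have near: "cmod (bil m (sec k u) (sec k u) - 1) \<le> k * (C1 * B / N)\<^sup>2" if "k \<le> N" and u: "u \<in> D" for k u
    using that(1)
  proof (induction k)
    case 0
    show ?case using w0(2) by (simp add: sec0)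
  next
    case (Suc k)
    have x: "v (real (Suc k) / real N, u) \<in> sph m" using vk Suc.prems u by blast
    \<comment> \<open>For a symmetric idempotent the projected vector pairs with the old one as with
      itself. The mixed term then makes the change of the square exactly
      \<open>- bil m (r k u) (r k u)\<close>, with no term linear in the displacement.\<close>
    have s: "bil m (sec k u) (sec (Suc k) u) = bil m (sec (Suc k) u) (sec (Suc k) u)"
    proof -
      have "bil m (sec (Suc k) u) (sec (Suc k) u) = bil m (sec k u) (apply_matrix m (Qk (Suc k) u) (sec (Suc k) u))"
        unfolding secS[of k u] unfolding Qk_def by (rule bil_apply_matrix, rule sym[OF x])
      then show ?thesis using fixk[OF Suc.prems u] by simp
    qed
    have "bil m (r k u) (r k u) = bil m (sec k u) (sec k u) - bil m (sec (Suc k) u) (sec (Suc k) u)"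
      unfolding r_def bil_diff_square s by simp
    then have "bil m (sec (Suc k) u) (sec (Suc k) u) - 1 = (bil m (sec k u) (sec k u) - 1) - bil m (r k u) (r k u)" by simp
    then have "cmod (bil m (sec (Suc k) u) (sec (Suc k) u) - 1) \<le> cmod (bil m (sec k u) (sec k u) - 1) + cmod (bil m (r k u) (r k u))"
      by (metis norm_triangle_ineq4)
    also have "cmod (bil m (r k u) (r k u)) \<le> (C1 * B / N)\<^sup>2"
    proof -
      have "norm1 m (r k u) \<le> C1 / N * B"
        using order_trans[OF rn[of k u] mult_left_mono[OF secB[of k u], of "C1 / N"]] Suc.prems u C1 by simp
      then have "norm1 m (r k u) * norm1 m (r k u) \<le> (C1 / N * B) * (C1 / N * B)"
        using norm1_nonneg B C1 by (intro mult_mono) auto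
      then show ?thesis using bil_le_norm1[of m "r k u" "r k u"] by (simp add: power2_eq_square)
    qed
    finally show ?case using Suc by (simp add: algebra_simps)
  qed
  have eN: "cmod (bil m (sec N u) (sec N u) - 1) \<le> 1/2" if "u \<in> D" for u
  proof -
    have "real N * (C1 * B / N)\<^sup>2 = (C1 * B)\<^sup>2 / N" using N(1) by (simp add: power2_eq_square)
    also have "\<dots> \<le> 1/2" using N by (simp add: field_simps)
    finally show ?thesis using near[of N u] that by simp
  qed
  \<comment> \<open>The constants may grow with \<open>k\<close>, but only \<open>k = N\<close>
    matters and \<open>N\<close> is fixed. This is the Lipschitz bound from which the missed
    direction is obtained.\<close>
  have slip: "bounded_lipschitz D d' (\<lambda>u. sec k u i)" if "k \<le> N" for k i
    using that
  proof (induction k arbitrary: i)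
    case 0
    then show ?case by (simp add: sec0 bounded_lipschitz_const d')
  next
    case (Suc k)
    have Qkl: "bounded_lipschitz D d' (\<lambda>u. Qk (Suc k) u i j)" for i j
      unfolding Qk_def
      by (rule bounded_lipschitz_reindex[OF Qlip]) (use kX[OF Suc.prems] in \<open>auto simp: d_def d'_def\<close>)
    show ?case
    proof (cases "i \<le> m")
      case True
      then show ?thesis using Suc unfolding secS apply_matrix_def
        by (simp, intro bounded_lipschitz_sum[OF d'] bounded_lipschitz_mult[OF d'] Qkl) auto
    qed (simp add: secS apply_matrix_def bounded_lipschitz_const d')
  qed
  have QN: "Qk N u = Q u" if "u \<in> D" for u using N(1) v1[OF that] by (simp add: Qk_def)
  have "\<exists>C\<ge>0. \<forall>i\<in>{..m}. \<forall>u\<in>D. \<forall>u'\<in>D. norm ((\<lambda>u. sec N u i) u - (\<lambda>u. sec N u i) u') \<le> C * d' u u'"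
    by (rule bounded_lipschitz_uniform[OF _ d' slip]) simp_all
  then obtain K where K: "K \<ge> 0" and sK: "\<And>i u u'. i \<le> m \<Longrightarrow> u \<in> D \<Longrightarrow> u' \<in> D \<Longrightarrow> cmod (sec N u i - sec N u' i) \<le> K * d' u u'"
    by auto
  have supp: "sec N u i = 0" if "i > m" for u i
    using that N(1) secS[of "N - 1" u] by (simp add: apply_matrix_def)
  have eqD: "x \<in> D" "(\<lambda>i. - x i) \<in> D" "x \<in> sph m" if "x \<in> sph n" for x
    using that sph_equator[of x n] sph_equator[of "\<lambda>i. - x i" n] by (auto simp: D_def m_def)
  show False
  proof (rule no_equivariant_section[of n "sec N" "K * real (m + 1)", folded m_def, folded D_def])
    show "continuous_on D (\<lambda>x. sec N x i)" for i
    proof (cases "i \<le> m")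
      case True
      show ?thesis
        unfolding continuous_on_def
      proof
        fix x assume x: "x \<in> D"
        have "continuous_on D (\<lambda>u. K * d' u x)"
          unfolding d'_def by (intro continuous_on_mult continuous_on_sum continuous_on_rabs continuous_on_diff 
             continuous_on_const continuous_on_coordinate[OF continuous_on_id])
        then have "((\<lambda>u. K * d' u x) \<longlongrightarrow> K * d' x x) (at x within D)"
          using x by (simp add: continuous_on_def)
        then have "((\<lambda>u. K * d' u x) \<longlongrightarrow> 0) (at x within D)" by (simp add: d'_def)
        then show "((\<lambda>u. sec N u i) \<longlongrightarrow> sec N x i) (at x within D)"
          by (rule Lim_null_comparison[THEN LIM_zero_cancel, rotated])
             (auto simp: eventually_at_filter sK[OF True _ x])
      qed
    qed (simp add: supp)
    show "bil m (sec N x) (\<lambda>i. of_real (x i)) = 0" if x: "x \<in> D" for x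
    proof -
      have x': "x \<in> sph m" using x by (simp add: D_def)
      have "bil m (sec N x) (\<lambda>i. of_real (x i)) = bil m (apply_matrix m (Q x) (sec N x)) (\<lambda>i. of_real (x i))"
        using fixk[of N x] x QN by simp
      also have "\<dots> = bil m (sec N x) (apply_matrix m (Q x) (\<lambda>i. of_real (x i)))"
        by (rule bil_apply_matrix) (rule sym[OF x'])
      finally show ?thesis using tang[OF x'] by (simp add: bil_def)
    qed
    show "1/2 \<le> Re (bil m (sec N x) (sec N x))" if "x \<in> D" for x
      using eN[OF that] abs_Re_le_cmod[of "bil m (sec N x) (sec N x) - 1"] by simp
    show "bil m (sec N x) (sec N (\<lambda>i. - x i)) = 0" if x: "x \<in> sph n" for x
    proof -
      have "bil m (sec N x) (sec N (\<lambda>i. - x i)) = bil m (apply_matrix m (Q x) (sec N x)) (apply_matrix m (Q (\<lambda>i. - x i)) (sec N (\<lambda>i. - x i)))"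
        using fixk[of N x] fixk[of N "\<lambda>i. - x i"] eqD[OF x] QN by simp
      also have "\<dots> = bil m (sec N x) (apply_matrix m (Q x) (apply_matrix m (Q (\<lambda>i. - x i)) (sec N (\<lambda>i. - x i))))"
        by (rule bil_apply_matrix) (rule sym[OF eqD(3)[OF x]])
      finally show ?thesis using anti[OF eqD(3)[OF x]] by (simp add: bil_def)
    qed
    show "cmod (sec N y i - sec N y' i) \<le> K * real (m + 1) * B" 
      if y: "y \<in> sph n" "y' \<in> sph n" and B: "\<And>j. j \<le> n \<Longrightarrow> \<bar>y j - y' j\<bar> \<le> B" for y y' B i
    proof -
      have B0: "B \<ge> 0" using B[of 0] abs_ge_zero[of "y 0 - y' 0"] by linarith
      have yB: "\<bar>y j - y' j\<bar> \<le> B" if "j \<le> m" for j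
        using B[of j] y that B0 by (cases "j \<le> n") (auto simp: sph_def m_def)
      have "d' y y' \<le> (\<Sum>j\<le>m. B)" unfolding d'_def by (intro sum_mono) (use yB in auto)
      then have dB: "K * d' y y' \<le> K * (real (m + 1) * B)" using K by (intro mult_left_mono) auto
      show ?thesis
      proof (cases "i \<le> m")
        case True
        show ?thesis using sK[OF True eqD(1)[OF y(1)] eqD(1)[OF y(2)]] dB by (simp add: mult.assoc)
      qed (use supp K B0 in simp)
    qed
  qed (simp_all add: supp)
qed

section \<open>Polynomials in an operator\<close>

definition op_linear :: "((nat \<Rightarrow> complex) \<Rightarrow> nat \<Rightarrow> complex) \<Rightarrow> bool" where
  "op_linear A \<longleftrightarrow> (\<forall>c d s t. A (\<lambda>i. c * s i + d * t i) = (\<lambda>i. c * A s i + d * A t i))"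

lemma op_linear_zero: "op_linear A \<Longrightarrow> A (\<lambda>i. 0) = (\<lambda>i. 0)"
  unfolding op_linear_def by (drule spec[of _ 0], drule spec[of _ 0]) simp

lemma op_linear_add: "op_linear A \<Longrightarrow> A (\<lambda>i. s i + t i) = (\<lambda>i. A s i + A t i)"
  unfolding op_linear_def by (drule spec[of _ 1], drule spec[of _ 1]) simp

lemma op_linear_scale: "op_linear A \<Longrightarrow> A (\<lambda>i. c * s i) = (\<lambda>i. c * A s i)"
  unfolding op_linear_def by (drule spec[of _ c], drule spec[of _ 0]) simp

lemma op_linear_sum:
  assumes "op_linear A"
  shows "A (\<lambda>i. \<Sum>j\<in>J. c j * s j i) = (\<lambda>i. \<Sum>j\<in>J. c j * A (s j) i)"
proof (induction J rule: infinite_finite_induct)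
  case (insert j J)
  then show ?case using op_linear_add[OF assms, of "\<lambda>i. c j * s j i" "\<lambda>i. \<Sum>j\<in>J. c j * s j i"]
    by (simp add: op_linear_scale[OF assms])
qed (simp_all add: op_linear_zero assms)

lemma op_linear_apply_matrix: "op_linear (apply_matrix n A)"
  by (simp add: op_linear_def apply_matrix_def fun_eq_iff sum.distrib sum_distrib_left algebra_simps)

definition poly_op :: "complex poly \<Rightarrow> ((nat \<Rightarrow> complex) \<Rightarrow> nat \<Rightarrow> complex) \<Rightarrow> (nat \<Rightarrow> complex) \<Rightarrow> nat \<Rightarrow> complex" where
  "poly_op p A = fold_coeffs (\<lambda>a f s i. a * s i + A (f s) i) p (\<lambda>s i. 0)"

lemma poly_op_0 [simp]: "poly_op 0 A s = (\<lambda>i. 0)"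
  by (simp add: poly_op_def)

text \<open>Linearity covers the case in which \<open>pCons a p\<close> is the zero polynomial and
  has no coefficient to fold over: the formula then requires \<open>A\<close> to send 0 to
  0.\<close>

lemma poly_op_pCons:
  assumes "op_linear A"
  shows "poly_op (pCons a p) A s = (\<lambda>i. a * s i + A (poly_op p A s) i)"
proof -
  have "(\<lambda>a f s i. a * s i + A (f s) i) 0 (\<lambda>s i. 0) = (\<lambda>s i. 0)"
    using op_linear_zero[OF assms] by simp
  then show ?thesis unfolding poly_op_def
    by (cases "p = 0 \<and> a = 0") (auto simp: op_linear_zero[OF assms])
qed

context
  fixes A :: "(nat \<Rightarrow> complex) \<Rightarrow> nat \<Rightarrow> complex"
  assumes A: "op_linear A"
begin

lemma poly_op_add: "poly_op (p + q) A s = (\<lambda>i. poly_op p A s i + poly_op q A s i)"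
proof (induction p arbitrary: q)
  case (pCons a p)
  obtain b q' where q: "q = pCons b q'" by (cases q) auto
  show ?case using pCons(2)[of q'] op_linear_add[OF A]
    by (simp add: q poly_op_pCons[OF A] algebra_simps)
qed simp

lemma poly_op_smult: "poly_op (Polynomial.smult c p) A s = (\<lambda>i. c * poly_op p A s i)"
proof (induction p)
  case (pCons a p)
  then show ?case using op_linear_scale[OF A] by (simp add: poly_op_pCons[OF A] algebra_simps)
qed simp

lemma poly_op_mult: "poly_op (p * q) A s = poly_op p A (poly_op q A s)"
proof (induction p)
  case (pCons a p)
  then show ?case
    by (simp add: poly_op_add poly_op_smult poly_op_pCons[OF A])
qed simp

lemma poly_op_commute: "poly_op p A (poly_op q A s) = poly_op q A (poly_op p A s)"
  by (metis poly_op_mult mult.commute)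

lemma poly_op_X: "poly_op [:0, 1:] A s = A s"
  by (simp add: poly_op_pCons[OF A] op_linear_zero[OF A])

lemma poly_op_1: "poly_op 1 A s = s"
  by (simp add: poly_op_pCons[OF A] op_linear_zero[OF A] one_pCons)

lemma op_linear_poly_op: "op_linear (poly_op p A)"
proof (induction p)
  case (pCons a p)
  then show ?case using A unfolding op_linear_def
    by (simp add: poly_op_pCons[OF A] algebra_simps)
qed (simp add: op_linear_def)

lemma poly_op_eigenvector:
  assumes "A w = (\<lambda>i. c * w i)"
  shows "poly_op p A w = (\<lambda>i. poly p c * w i)"
proof (induction p)
  case (pCons a p)
  have "A (\<lambda>i. poly p c * w i) = (\<lambda>i. poly p c * (c * w i))"
    unfolding op_linear_scale[OF A] assms ..
  then show ?case using pCons(2) by (simp add: poly_op_pCons[OF A]) (simp add: algebra_simps)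
qed simp

text \<open>The operator at the antipode is the negative of the operator at the point, so both
  projections become polynomials in one operator and can be multiplied.\<close>

lemma poly_op_neg:
  "poly_op (pcompose p [:0, -1:]) A s = poly_op p (\<lambda>s i. - A s i) s"
proof (induction p)
  case (pCons a p)
  have "op_linear (\<lambda>s i. - A s i)" using A by (simp add: op_linear_def)
  moreover have "poly_op (- r) A s = (\<lambda>i. - poly_op r A s i)" for r
    using poly_op_smult[of "-1" r s] by simp
  ultimately show ?case using pCons op_linear_scale[OF A, of "-1"]
    by (simp add: poly_op_add poly_op_pCons pcompose_pCons A op_linear_zero)
qed simp

lemma bil_poly_op:
  assumes "\<And>s t. bil n (A s) t = bil n s (A t)"
  shows "bil n (poly_op p A s) t = bil n s (poly_op p A t)"
proof (induction p arbitrary: s t)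
  case 0
  then show ?case by (simp add: bil_def)
next
  case (pCons a p)
  have add: "bil n (\<lambda>i. a * u i + v i) t = a * bil n u t + bil n v t" 
    "bil n t (\<lambda>i. a * u i + v i) = a * bil n t u + bil n t v" for u v t
    by (simp_all add: bil_def sum.distrib sum_distrib_left algebra_simps)
  have "bil n (A (poly_op p A s)) t = bil n s (A (poly_op p A t))"
    using assms pCons(2) poly_op_commute[of p "[:0,1:]"] by (simp add: poly_op_X)
  then show ?case by (simp add: poly_op_pCons[OF A] add)
qed

lemma poly_op_support:
  assumes "\<And>s i. i > n \<Longrightarrow> A s i = 0" "\<And>i. i > n \<Longrightarrow> s i = 0" "i > n"
  shows "poly_op p A s i = 0"
  using assms by (induction p) (simp_all add: poly_op_pCons[OF A])

end

lemma polyf_sum: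
  assumes "\<And>j. j \<in> J \<Longrightarrow> polyf (f j)"
  shows "polyf (\<lambda>z. \<Sum>j\<in>J. f j z)"
  using assms by (induction J rule: infinite_finite_induct) (simp_all add: polyf_const polyf_add)

lemma polyf_apply_matrix:
  assumes "\<And>i j. polyf (\<lambda>z. M z i j)" "\<And>i. polyf (\<lambda>z. s z i)"
  shows "polyf (\<lambda>z. apply_matrix n (M z) (s z) i)"
  by (cases "i \<le> n") (auto simp: apply_matrix_def intro!: polyf_sum polyf_mult polyf_const assms)

lemma polyf_poly_op:
  assumes "\<And>i j. polyf (\<lambda>z. M z i j)" "\<And>i. polyf (\<lambda>z. s z i)"
  shows "polyf (\<lambda>z. poly_op p (apply_matrix n (M z)) (s z) i)"
proof (induction p arbitrary: i)
  case (pCons a p)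
  then show ?case
    by (simp add: poly_op_pCons[OF op_linear_apply_matrix])
       (intro polyf_add polyf_mult polyf_const polyf_apply_matrix assms)
qed (simp add: polyf_const)

text \<open>For exponent 1, divide \<open>b\<close> with remainder by the linear factor; the
  remainder is the non-zero value at \<open>c\<close>. The induction multiplies the identity for
  \<open>k\<close> by this one.\<close>

lemma bezout_linear_power:
  fixes b :: "'a::field poly"
  assumes "poly b c \<noteq> 0"
  shows "\<exists>u w. u * [:-c, 1:] ^ k + w * b = 1"
proof (induction k)
  case 0
  show ?case by (intro exI[of _ 1] exI[of _ 0]) simp
next
  case (Suc k)
  then obtain u w where 1: "u * [:-c, 1:] ^ k + w * b = 1" by blast
  have "poly (b - [:poly b c:]) c = 0" by simp
  then obtain r where "b - [:poly b c:] = [:-c, 1:] * r" unfolding poly_eq_0_iff_dvd by (rule dvdE)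
  then have r: "[:poly b c:] = b - [:-c, 1:] * r" by (metis add_diff_cancel_left' diff_add_cancel)
  define v where "v = [:inverse (poly b c):]"
  have "v * [:poly b c:] = 1" using assms by (simp add: v_def one_pCons)
  then have 2: "v * b - v * r * [:-c, 1:] = 1" unfolding r by (simp add: algebra_simps)
  have "1 = (u * [:-c, 1:] ^ k + w * b) * (v * b - v * r * [:-c, 1:])" using 1 2 by simp
  also have "\<dots> = (- (u * v * r)) * [:-c, 1:] ^ Suc k + (u * [:-c, 1:] ^ k * v + w * (v * b - v * r * [:-c, 1:])) * b"
    by (simp add: algebra_simps)
  finally show ?case by metis
qed

text \<open>By Bezout, \<open>h = v * q2\<close> is 0 modulo \<open>q2\<close> and 1 modulo
  \<open>a ^ k\<close>. Wherever \<open>q\<close> annihilates the operator, \<open>h\<close> of it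
  is the projection to the generalised eigenspace of \<open>c\<close>. As one fixed polynomial,
  \<open>h\<close> yields projections that are polynomial in \<open>z\<close> and symmetric like
  \<open>M\<close>; they kill \<open>z\<close>, an eigenvector for 0, because
  \<open>poly h 0 = 0\<close>.\<close>

lemma no_isospectral_symmetric_family:
  fixes n :: nat and M :: "(nat \<Rightarrow> complex) \<Rightarrow> nat \<Rightarrow> nat \<Rightarrow> complex" and q :: "complex poly"
  defines "m \<equiv> Suc n"
  defines "A \<equiv> \<lambda>z. apply_matrix m (M z)"
  assumes poly: "\<And>i j. polyf (\<lambda>z. M z i j)"
    and sym: "\<And>z i j. M z i j = M z j i"
    and odd: "\<And>z i j. M (\<lambda>i. - z i) i j = - M z i j"
    and tang: "\<And>z. A z z = (\<lambda>i. 0)"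
    and q: "q \<noteq> 0" "pcompose q [:0, -1:] = q" "poly q 0 = 0"
    and kill: "\<And>x s. x \<in> sph m \<Longrightarrow> (\<And>i. i > m \<Longrightarrow> s i = 0) \<Longrightarrow> 
        poly_op q (A (\<lambda>i. complex_of_real (x i))) s = (\<lambda>i. 0)"
    and eig: "A (\<lambda>i. if i = m then 1 else 0) w = (\<lambda>i. c * w i)" "w \<noteq> (\<lambda>i. 0)" "\<And>i. i > m \<Longrightarrow> w i = 0"
  shows "c = 0"
proof (rule ccontr)
  assume c: "c \<noteq> 0"
  define e where "e = (\<lambda>i. if i = m then 1 else (0::real))"
  define B where "B x = A (\<lambda>i. complex_of_real (x i))" for x
  have Be: "B e = A (\<lambda>i. if i = m then 1 else 0)"
    unfolding B_def e_def by (rule arg_cong[of _ _ A]) auto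
  have e: "e \<in> sph m" by (simp add: sph_def e_def if_distrib[of "\<lambda>x. x ^ 2"] cong: if_cong)
  have lin: "op_linear (A z)" "op_linear (B x)" for z x by (simp_all add: A_def B_def op_linear_apply_matrix)
  have sA: "bil m (A z s) t = bil m s (A z t)" for z s t
    unfolding A_def by (rule bil_apply_matrix) (rule sym)
  have suppA: "A z s i = 0" if "i > m" for z s i using that by (simp add: A_def apply_matrix_def)
  have suppB: "B x s i = 0" if "i > m" for x s i using that by (simp add: B_def suppA)
  have kill': "poly_op q (B x) s = (\<lambda>i. 0)" if "x \<in> sph m" "\<And>i. i > m \<Longrightarrow> s i = 0" for x s
    unfolding B_def by (rule kill) (use that in auto)
  define a where "a = [:-c, 1:]"
  define k where "k = Polynomial.order c q"
  obtain q2 where q2: "q = a ^ k * q2" "\<not> a dvd q2" 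
    using order_decomp[OF q(1), of c] by (auto simp: a_def k_def)
  have q2c: "poly q2 c \<noteq> 0" using q2(2) by (simp add: a_def poly_eq_0_iff_dvd)
  have "poly q c = 0"
  proof -
    have "(\<lambda>i. poly q c * w i) = (\<lambda>i. 0)"
      using kill'[OF e, of w] eig(3) poly_op_eigenvector[OF lin(2)[of e], of w c q] eig(1) Be by simp
    then show ?thesis using eig(2) by (metis mult_eq_0_iff)
  qed
  then have k: "k > 0" using q(1) by (simp add: k_def order_root)
  obtain u v where bez: "u * a ^ k + v * q2 = 1" using bezout_linear_power[OF q2c, of k] unfolding a_def by blast
  define h where "h = v * q2"
  have h1: "h = 1 - u * a ^ k" using bez by (simp add: h_def eq_diff_eq algebra_simps)
  have hc: "poly h c = 1" using k by (simp add: h1 a_def)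
  have h0: "poly h 0 = 0"
  proof -
    have "(- c) ^ k * poly q2 0 = 0" using q(3) unfolding q2(1) by (simp add: a_def)
    then show ?thesis using c by (simp add: h_def)
  qed
  have hh: "h * h = h - u * v * q"
    unfolding q2(1) by (subst (2) h1) (simp add: h_def algebra_simps)
  define h' where "h' = pcompose h [:0, -1:]"
  define q2' where "q2' = pcompose q2 [:0, -1:]"
  \<comment> \<open>Since \<open>q\<close> is even, its factor \<open>a ^ k\<close> must divide the
    reflected product \<open>a' ^ k * q2'\<close>. The reflected \<open>a'\<close> has no root at
    \<open>c\<close>, because \<open>c\<close> and \<open>- c\<close> differ, so
    \<open>a ^ k\<close> divides \<open>q2'\<close>. This makes the projections at antipodal points
    annihilate each other.\<close>
  have "q dvd h * h'"
  proof -
    define a' where "a' = pcompose a [:0, -1:]"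
    have a': "a' = [:-c, -1:]" by (simp add: a'_def a_def pcompose_pCons)
    have pw: "pcompose (a ^ j) r = pcompose a r ^ j" for j r
      by (induction j) (simp_all add: pcompose_mult pcompose_1)
    have eq: "a' ^ k * q2' = q"
      using q(2) unfolding a'_def q2'_def by (simp add: q2(1) pcompose_mult pw)
    have nz: "a' ^ k * q2' \<noteq> 0" using eq q(1) by simp
    have "Polynomial.order c (a' ^ k) = 0" using c by (intro order_0I) (simp add: a')
    moreover have "Polynomial.order c q = Polynomial.order c (a' ^ k) + Polynomial.order c q2'"
      using order_mult[OF nz, of c] unfolding eq .
    ultimately have "Polynomial.order c q2' = k" by (simp add: k_def[symmetric])
    then have "a ^ k dvd q2'" using order_1[of c q2'] by (simp add: a_def)
    then have "q dvd q2' * q2" unfolding q2(1) by (rule mult_dvd_mono) simp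
    also have "q2' * q2 dvd h * h'" 
      unfolding h_def h'_def q2'_def pcompose_mult by (simp add: mult_ac dvd_triv_left)
    finally show ?thesis .
  qed
  then obtain g where g: "h * h' = g * q" by (metis dvdE mult.commute)
  \<comment> \<open>The columns are the images of the unit vectors. The matrix ignores entries above
    \<open>m\<close>, hence the truncation \<open>tr\<close> when it is compared with the
    operator.\<close>
  define P where "P z i j = (if j \<le> m then poly_op h (A z) (\<lambda>l. if l = j then 1 else 0) i else 0)" for z i j
  define tr where "tr s i = (if i \<le> m then s i else 0)" for s :: "nat \<Rightarrow> complex" and i
  have tr: "tr s i = 0" if "i > m" for s i using that by (simp add: tr_def)
  have trid: "tr s = s" if "\<And>i. i > m \<Longrightarrow> s i = 0" for s using that by (auto simp: tr_def fun_eq_iff)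
  have hsupp: "poly_op h (A z) s i = 0" if "i > m" "\<And>i. i > m \<Longrightarrow> s i = 0" for z s i
    by (rule poly_op_support[OF lin(1) suppA]) (use that in auto)
  have apP: "apply_matrix m (P z) s = poly_op h (A z) (tr s)" for z s
  proof
    fix i
    show "apply_matrix m (P z) s i = poly_op h (A z) (tr s) i"
    proof (cases "i \<le> m")
      case True
      have "tr s = (\<lambda>l. \<Sum>j\<le>m. s j * (if l = j then 1 else 0))"
        by (auto simp: tr_def fun_eq_iff if_distrib[of "\<lambda>x. _ * x"] cong: if_cong)
      then have "poly_op h (A z) (tr s) i = (\<Sum>j\<le>m. s j * poly_op h (A z) (\<lambda>l. if l = j then 1 else 0) i)"
        using op_linear_sum[OF op_linear_poly_op[OF lin(1)], where s = "\<lambda>j l. if l = j then 1 else 0"] by simp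
      then show ?thesis using True by (simp add: apply_matrix_def P_def mult.commute)
    qed (simp add: apply_matrix_def hsupp tr)
  qed
  have Bneg: "B (\<lambda>i. - x i) = (\<lambda>s i. - B x s i)" for x
    using odd[of "\<lambda>i. complex_of_real (x i)"] by (simp add: B_def A_def apply_matrix_def fun_eq_iff sum_negf)
  have Bx: "poly_op h (A (\<lambda>i. complex_of_real (x i))) = poly_op h (B x)" for x by (simp add: B_def)
  have trP: "tr (poly_op h (B x) (tr s)) = poly_op h (B x) (tr s)" for x s
    by (rule trid) (auto simp: B_def intro!: hsupp tr)
  have "\<exists>w0. apply_matrix m (P (\<lambda>i. complex_of_real (e i))) w0 = w0 \<and> bil m w0 w0 = 1"
  proof -
    let ?H = "poly_op h (B e)"
    \<comment> \<open>The eigenvector \<open>w\<close> may be isotropic. Its conjugate pairs with it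
      to a positive number, and symmetry of \<open>?H\<close> preserves this pairing for
      \<open>?H y\<close>; so one of \<open>w\<close>, \<open>?H y\<close> and their sum has a
      non-zero square and can be rescaled to square 1.\<close>
    define y where "y = (\<lambda>i. cnj (w i))"
    have w1: "?H w = w" using poly_op_eigenvector[OF lin(2)[of e], of w c h] eig(1) hc by (simp add: Be)
    have ysupp: "y i = 0" if "i > m" for i using eig(3)[OF that] by (simp add: y_def)
    have HH: "?H (?H s) = ?H s" if s: "\<And>i. i > m \<Longrightarrow> s i = 0" for s
    proof -
      have "poly_op (u * v * q) (B e) s = (\<lambda>i. 0)"
        using kill'[OF e s] by (simp add: poly_op_mult[OF lin(2)] op_linear_zero[OF op_linear_poly_op[OF lin(2)]])
      moreover have "h = h * h + u * v * q" using hh by simp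
      ultimately show ?thesis using poly_op_add[OF lin(2), of "h * h" "u * v * q" e s] 
        by (simp add: poly_op_mult[OF lin(2)])
    qed
    have Hy: "?H (?H y) = ?H y" by (rule HH) (rule ysupp)
    have Hys: "?H y i = 0" if "i > m" for i
      unfolding B_def by (rule hsupp[OF that ysupp])
    have sB: "bil m (?H s) t = bil m s (?H t)" for s t
      by (rule bil_poly_op[OF lin(2)]) (simp add: B_def sA)
    have "bil m w y \<noteq> 0"
    proof -
      have "bil m w y = of_real (\<Sum>i\<le>m. (cmod (w i))\<^sup>2)" 
        by (simp only: bil_def y_def of_real_sum complex_norm_square)
      moreover obtain i where i: "w i \<noteq> 0" using eig(2) by auto
      then have "i \<le> m" using eig(3) by (meson not_le)
      then have "(\<Sum>i\<le>m. (cmod (w i))\<^sup>2) > 0" using i by (intro sum_pos2[of _ i]) auto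
      ultimately show ?thesis by (metis less_irrefl of_real_eq_0_iff)
    qed
    then have wy: "bil m w (?H y) \<noteq> 0" using sB[of w y] w1 by simp
    have "\<exists>s. ?H s = s \<and> bil m s s \<noteq> 0 \<and> (\<forall>i>m. s i = 0)"
    proof (cases "bil m w w \<noteq> 0 \<or> bil m (?H y) (?H y) \<noteq> 0")
      case True
      then show ?thesis using w1 Hy Hys eig(3) by blast
    next
      case False
      let ?s = "\<lambda>i. w i + 1 * ?H y i"
      have "bil m ?s ?s = 2 * bil m w (?H y)" unfolding bil_square using False by simp
      moreover have "?H ?s = ?s" using op_linear_add[OF op_linear_poly_op[OF lin(2)[of e]], of h w "?H y"] w1 Hy by simp
      moreover have "\<forall>i>m. ?s i = 0" using Hys eig(3) by simp
      ultimately show ?thesis using wy by (intro exI[of _ ?s]) simp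
    qed
    then obtain s where s: "?H s = s" "bil m s s \<noteq> 0" "\<And>i. i > m \<Longrightarrow> s i = 0" by blast
    define r where "r = 1 / csqrt (bil m s s)"
    have r: "r * r * bil m s s = 1" 
      using s(2) power2_csqrt[of "bil m s s"] by (simp add: r_def power2_eq_square)
    let ?w = "\<lambda>i. r * s i"
    have "bil m ?w ?w = r * r * bil m s s" by (simp add: bil_def sum_distrib_left mult_ac)
    moreover have "apply_matrix m (P (\<lambda>i. complex_of_real (e i))) ?w = ?w"
      using trid[of ?w] s(1,3) op_linear_scale[OF op_linear_poly_op[OF lin(2)[of e]], of h r s]
      by (simp add: apP Bx)
    ultimately show ?thesis using r by auto
  qed
  then obtain w0 where w0: "apply_matrix m (P (\<lambda>i. complex_of_real (e i))) w0 = w0" "bil m w0 w0 = 1" by blast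
  show False
  proof (rule no_projection_family[of P n w0, folded m_def])
    show "polyf (\<lambda>z. P z i j)" for i j
    proof (cases "j \<le> m")
      case True
      then show ?thesis unfolding P_def A_def by simp (intro polyf_poly_op poly polyf_const)
    qed (simp add: P_def polyf_const)
    show "P (\<lambda>i. complex_of_real (x i)) i j = P (\<lambda>i. complex_of_real (x i)) j i" for x i j
    proof (cases "i \<le> m \<and> j \<le> m")
      case True
      let ?H = "poly_op h (A (\<lambda>i. complex_of_real (x i)))"
      let ?u = "\<lambda>j l. if l = j then 1 else (0::complex)"
      have 1: "bil m s (?u i) = s i" "bil m (?u i) s = s i" if "i \<le> m" for s i using that 
        by (simp_all add: bil_def if_distrib[of "\<lambda>x. _ * x"] if_distrib[of "\<lambda>x. x * _"] cong: if_cong)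
      have "?H (?u j) i = bil m (?H (?u j)) (?u i)" using 1 True by simp
      also have "\<dots> = bil m (?u j) (?H (?u i))" by (rule bil_poly_op[OF lin(1)]) (rule sA)
      also have "\<dots> = ?H (?u i) j" using 1 True by simp
      finally show ?thesis using True by (simp add: P_def)
    qed (auto simp: P_def hsupp not_le)
    fix x assume x: "x \<in> sph m"
    show "apply_matrix m (P (\<lambda>i. complex_of_real (x i))) (apply_matrix m (P (\<lambda>i. complex_of_real (x i))) s) = 
        apply_matrix m (P (\<lambda>i. complex_of_real (x i))) s" for s
    proof -
      have "poly_op (u * v * q) (B x) (tr s) = (\<lambda>i. 0)"
        using kill'[OF x tr] by (simp add: poly_op_mult[OF lin(2)] op_linear_zero[OF op_linear_poly_op[OF lin(2)]])
      moreover have "h = h * h + u * v * q" using hh by simp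
      ultimately have "poly_op h (B x) (poly_op h (B x) (tr s)) = poly_op h (B x) (tr s)"
        using poly_op_add[OF lin(2), of "h * h" "u * v * q" x "tr s"] by (simp add: poly_op_mult[OF lin(2)])
      then show ?thesis by (simp add: apP Bx trP)
    qed
    show "apply_matrix m (P (\<lambda>i. complex_of_real (x i))) (apply_matrix m (P (\<lambda>i. complex_of_real (- x i))) s) = (\<lambda>i. 0)" for s
    proof -
      have "apply_matrix m (P (\<lambda>i. complex_of_real (- x i))) s = poly_op h' (B x) (tr s)"
        unfolding apP h'_def poly_op_neg[OF lin(2)] using Bneg[of x] by (simp add: B_def)
      moreover have "tr (poly_op h' (B x) (tr s)) = poly_op h' (B x) (tr s)"
        by (rule trid, rule poly_op_support[OF lin(2) suppB]) (auto simp: tr)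
      ultimately have "apply_matrix m (P (\<lambda>i. complex_of_real (x i))) (apply_matrix m (P (\<lambda>i. complex_of_real (- x i))) s) 
          = poly_op (g * q) (B x) (tr s)" 
        by (simp add: apP Bx poly_op_mult[OF lin(2)] flip: g)
      then show ?thesis using kill'[OF x tr] 
        by (simp add: poly_op_mult[OF lin(2)] op_linear_zero[OF op_linear_poly_op[OF lin(2)]])
    qed
    show "apply_matrix m (P (\<lambda>i. complex_of_real (x i))) (\<lambda>i. of_real (x i)) = (\<lambda>i. 0)"
    proof -
      let ?x = "\<lambda>i. complex_of_real (x i)"
      have "tr ?x = ?x" by (rule trid) (use x in \<open>simp add: sph_def\<close>)
      moreover have "B x ?x = (\<lambda>i. 0 * ?x i)" using tang[of ?x] by (simp add: B_def)
      ultimately show ?thesis using poly_op_eigenvector[OF lin(2)[of x], of ?x 0 h] h0 by (simp add: apP Bx)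
    qed
  qed (use w0 in \<open>simp_all add: e_def\<close>)
qed

section \<open>Isospectral families on a real form\<close>

definition spectrum :: "nat \<Rightarrow> ((nat \<Rightarrow> complex) \<Rightarrow> nat \<Rightarrow> complex) \<Rightarrow> complex set" where
  "spectrum n A = {c. \<exists>w. w \<noteq> (\<lambda>i. 0) \<and> (\<forall>i>n. w i = 0) \<and> A w = (\<lambda>i. c * w i)}"

text \<open>Gaussian elimination: a pivot \<open>p\<close> clears coordinate \<open>m\<close> from
  the other vectors, and its own coefficient is recovered afterwards. Working with an indexed family
  allows repeated vectors, as happens for powers of an operator.\<close>

lemma nontrivial_relation:
  fixes x :: "'i \<Rightarrow> nat \<Rightarrow> 'b::field"
  assumes "finite I" "card I > m"
  shows "\<exists>c. (\<exists>i\<in>I. c i \<noteq> 0) \<and> (\<forall>k<m. (\<Sum>i\<in>I. c i * x i k) = 0)"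
  using assms
proof (induction m arbitrary: I x)
  case 0
  then obtain i where "i \<in> I" by fastforce
  then show ?case by (intro exI[of _ "\<lambda>_. 1"]) auto
next
  case (Suc m)
  show ?case
  proof (cases "\<forall>i\<in>I. x i m = 0")
    case True
    obtain c where "\<exists>i\<in>I. c i \<noteq> 0" "\<forall>k<m. (\<Sum>i\<in>I. c i * x i k) = 0"
      using Suc.IH[of I x] Suc.prems by auto
    then show ?thesis using True by (intro exI[of _ c]) (auto simp: less_Suc_eq)
  next
    case False
    then obtain p where p: "p \<in> I" "x p m \<noteq> 0" by blast
    define J where "J = I - {p}"
    have J: "finite J" "card J > m" "p \<notin> J" "I = insert p J" using Suc.prems p by (auto simp: J_def)
    define y where "y i k = x i k - x i m / x p m * x p k" for i k
    obtain c where c: "\<exists>i\<in>J. c i \<noteq> 0" "\<And>k. k < m \<Longrightarrow> (\<Sum>i\<in>J. c i * y i k) = 0"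
      using Suc.IH[OF J(1,2), of y] by auto
    define d where "d i = (if i = p then - (\<Sum>j\<in>J. c j * (x j m / x p m)) else c i)" for i
    have d: "(\<Sum>i\<in>I. d i * x i k) = (\<Sum>i\<in>J. c i * y i k)" for k
    proof -
      have "(\<Sum>i\<in>J. d i * x i k) = (\<Sum>i\<in>J. c i * x i k)" using J(3) by (intro sum.cong) (auto simp: d_def)
      then have "(\<Sum>i\<in>I. d i * x i k) = (\<Sum>i\<in>J. c i * x i k) - (\<Sum>j\<in>J. c j * (x j m / x p m)) * x p k"
        using J by (simp add: d_def)
      also have "\<dots> = (\<Sum>i\<in>J. c i * y i k)"
        by (simp add: y_def sum_distrib_right sum_subtractf right_diff_distrib mult.assoc)
      finally show ?thesis .
    qed
    have "y i m = 0" for i using p(2) by (simp add: y_def)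
    then have "(\<Sum>i\<in>I. d i * x i k) = 0" if "k < Suc m" for k
      using c(2)[of k] that unfolding d by (cases "k = m") auto
    moreover have "\<exists>i\<in>I. d i \<noteq> 0" using c(1) J by (auto simp: d_def)
    ultimately show ?thesis by blast
  qed
qed

lemma poly_op_sum:
  assumes "op_linear A"
  shows "poly_op (\<Sum>j\<in>J. f j) A s = (\<lambda>i. \<Sum>j\<in>J. poly_op (f j) A s i)"
  by (induction J rule: infinite_finite_induct) (simp_all add: poly_op_add assms)

text \<open>The vector and its first \<open>n + 1\<close> iterates under \<open>A\<close> are
  \<open>n + 2\<close> vectors with only \<open>n + 1\<close> coordinates.\<close>

lemma annihilating_poly_vector:
  assumes A: "op_linear A" and supp: "\<And>s i. i > n \<Longrightarrow> A s i = 0" and w: "\<And>i. i > n \<Longrightarrow> w i = 0"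
  shows "\<exists>p. p \<noteq> 0 \<and> degree p \<le> Suc n \<and> poly_op p A w = (\<lambda>i. 0)"
proof -
  obtain c where c: "\<exists>i\<in>{..Suc n}. c i \<noteq> 0" 
      "\<forall>k<Suc n. (\<Sum>i\<in>{..Suc n}. c i * poly_op (Polynomial.monom 1 i) A w k) = 0"
    using nontrivial_relation[of "{..Suc n}" "Suc n" "\<lambda>i. poly_op (Polynomial.monom 1 i) A w"] by auto
  define p where "p = (\<Sum>i\<le>Suc n. Polynomial.smult (c i) (Polynomial.monom 1 i))"
  have "Polynomial.coeff p i = c i" if "i \<le> Suc n" for i
    using that by (simp add: p_def coeff_sum if_distrib[of "\<lambda>x. _ * x"] cong: if_cong del: sum.atMost_Suc)
  then have "p \<noteq> 0" using c(1) by fastforce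
  moreover have "degree p \<le> Suc n"
    unfolding p_def by (intro degree_sum_le) (auto simp: degree_monom_eq intro: order_trans[OF degree_smult_le])
  moreover have "poly_op p A w = (\<lambda>i. 0)"
  proof
    fix k
    have "poly_op p A w k = (\<Sum>i\<in>{..Suc n}. c i * poly_op (Polynomial.monom 1 i) A w k)"
      by (simp add: p_def poly_op_sum[OF A] poly_op_smult[OF A] del: sum.atMost_Suc)
    also have "\<dots> = 0"
    proof (cases "k < Suc n")
      case False
      then have "poly_op (Polynomial.monom 1 i) A w k = 0" for i
        by (intro poly_op_support[OF A, of n]) (auto simp: supp w)
      then show ?thesis by simp
    qed (use c in simp)
    finally show "poly_op p A w k = 0" .
  qed
  ultimately show ?thesis by blast
qed

text \<open>The annihilators of the unit vectors are multiplied. The degree bound depends on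
  \<open>n\<close> alone, which later permits a single exponent for all matrices of the
  family.\<close>

lemma annihilating_poly:
  assumes A: "op_linear A" and supp: "\<And>s i. i > n \<Longrightarrow> A s i = 0"
  shows "\<exists>p. p \<noteq> 0 \<and> degree p \<le> Suc n * Suc n \<and> (\<forall>s. (\<forall>i>n. s i = 0) \<longrightarrow> poly_op p A s = (\<lambda>i. 0))"
proof -
  let ?u = "\<lambda>j l. if l = j then 1 else (0::complex)"
  have "\<exists>p. p \<noteq> 0 \<and> degree p \<le> Suc n \<and> poly_op p A (?u j) = (\<lambda>i. 0)" if "j \<le> n" for j
    by (rule annihilating_poly_vector[OF A supp]) (use that in auto)
  then obtain f where f: "\<And>j. j \<le> n \<Longrightarrow> f j \<noteq> 0" "\<And>j. j \<le> n \<Longrightarrow> degree (f j) \<le> Suc n" 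
      "\<And>j. j \<le> n \<Longrightarrow> poly_op (f j) A (?u j) = (\<lambda>i. 0)"
    by metis
  define p where "p = (\<Prod>j\<le>n. f j)"
  have "p \<noteq> 0" using f(1) by (auto simp: p_def)
  moreover have "degree p \<le> Suc n * Suc n"
  proof -
    have "degree p \<le> (\<Sum>j\<le>n. degree (f j))" unfolding p_def by (rule degree_prod_sum_le[unfolded comp_def]) simp
    also have "\<dots> \<le> (\<Sum>j\<le>n. Suc n)" using f(2) by (intro sum_mono) auto
    finally show ?thesis by simp
  qed
  moreover have "poly_op p A s = (\<lambda>i. 0)" if s: "\<forall>i>n. s i = 0" for s
  proof -
    have pu: "poly_op p A (?u j) = (\<lambda>i. 0)" if "j \<le> n" for j
    proof -
      have "p = (\<Prod>k\<in>{..n}-{j}. f k) * f j" using that by (simp add: p_def prod.remove[of _ j] mult.commute)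
      then show ?thesis using f(3)[OF that] by (simp add: poly_op_mult[OF A] op_linear_zero[OF op_linear_poly_op[OF A]])
    qed
    have "s = (\<lambda>l. \<Sum>j\<le>n. s j * ?u j l)"
      using s by (auto simp: fun_eq_iff if_distrib[of "\<lambda>x. _ * x"] cong: if_cong)
    then have "poly_op p A s = (\<lambda>l. \<Sum>j\<le>n. s j * poly_op p A (?u j) l)"
      using op_linear_sum[OF op_linear_poly_op[OF A], where s = ?u] by metis
    then show ?thesis using pu by simp
  qed
  ultimately show ?thesis by blast
qed

lemma prod_linear_factors_dvd:
  fixes p :: "complex poly"
  assumes "finite S" "p \<noteq> 0" "\<And>c. poly p c = 0 \<Longrightarrow> c \<in> S" "degree p \<le> d"
  shows "p dvd (\<Prod>c\<in>S. [:-c, 1:] ^ d)"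
  using assms(2-)
proof (induction d arbitrary: p)
  case 0
  then have "is_unit p" by (simp add: is_unit_iff_degree)
  then show ?case by (rule unit_imp_dvd)
next
  case (Suc d)
  show ?case
  proof (cases "degree p = 0")
    case True
    then have "is_unit p" using Suc.prems(1) by (simp add: is_unit_iff_degree)
    then show ?thesis by (rule unit_imp_dvd)
  next
    case False
    then obtain c where c: "poly p c = 0" using fundamental_theorem_of_algebra[of p] by (auto simp: constant_degree)
    then obtain r where r: "p = [:-c, 1:] * r" unfolding poly_eq_0_iff_dvd by (rule dvdE)
    have r0: "r \<noteq> 0" using Suc.prems(1) r by auto
    have "r dvd (\<Prod>c\<in>S. [:-c, 1:] ^ d)"
    proof (rule Suc.IH[OF r0])
      show "c \<in> S" if "poly r c = 0" for c using Suc.prems(2)[of c] that r by simp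
      have "degree p = Suc (degree r)" using r0 unfolding r by (subst degree_mult_eq) auto
      then show "degree r \<le> d" using Suc.prems(3) by simp
    qed
    moreover have "[:-c, 1:] dvd (\<Prod>c\<in>S. [:-c, 1:])" using Suc.prems(2)[OF c] assms(1) by (rule dvd_prodI[rotated])
    ultimately have "p dvd (\<Prod>c\<in>S. [:-c, 1:]) * (\<Prod>c\<in>S. [:-c, 1:] ^ d)" unfolding r by (rule mult_dvd_mono[rotated])
    then show ?thesis by (simp only: prod.distrib power_Suc)
  qed
qed

text \<open>A root that is not an eigenvalue can be divided out of an annihilating polynomial,
  because the corresponding linear factor acts injectively. Afterwards every root is an eigenvalue,
  with multiplicity at most the degree bound.\<close>

lemma annihilating_poly_spectrum:
  assumes A: "op_linear A" and supp: "\<And>s i. i > n \<Longrightarrow> A s i = 0"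
  shows "finite (spectrum n A)" 
    and "(\<And>i. i > n \<Longrightarrow> s i = 0) \<Longrightarrow> 
       poly_op (\<Prod>c\<in>spectrum n A. [:-c, 1:] ^ (Suc n * Suc n)) A s = (\<lambda>i. 0)"
proof -
  define kills where "kills p \<longleftrightarrow> (\<forall>s. (\<forall>i>n. s i = 0) \<longrightarrow> poly_op p A s = (\<lambda>i. 0))" for p
  obtain p where p: "p \<noteq> 0" "degree p \<le> Suc n * Suc n" "kills p"
    using annihilating_poly[OF assms] unfolding kills_def by blast
  have root: "poly p c = 0" if k: "kills p" and c: "c \<in> spectrum n A" for p c
  proof -
    obtain w where w: "w \<noteq> (\<lambda>i. 0)" "\<forall>i>n. w i = 0" "A w = (\<lambda>i. c * w i)" 
      using c by (auto simp: spectrum_def)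
    then have "(\<lambda>i. poly p c * w i) = (\<lambda>i. 0)"
      using k poly_op_eigenvector[OF A w(3), of p] w(2) by (simp add: kills_def)
    then show ?thesis using w(1) by (metis mult_eq_0_iff)
  qed
  have "spectrum n A \<subseteq> {c. poly p c = 0}" using root p(3) by blast
  then show fin: "finite (spectrum n A)" using poly_roots_finite[OF p(1)] finite_subset by blast
  have "\<exists>p'. p' \<noteq> 0 \<and> degree p' \<le> Suc n * Suc n \<and> kills p' \<and> (\<forall>c. poly p' c = 0 \<longrightarrow> c \<in> spectrum n A)"
    using p
  proof (induction "degree p" arbitrary: p rule: less_induct)
    case less
    show ?case
    proof (cases "\<forall>c. poly p c = 0 \<longrightarrow> c \<in> spectrum n A")
      case False
      then obtain c where c: "poly p c = 0" "c \<notin> spectrum n A" by blast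
      then obtain r where r: "p = [:-c, 1:] * r" unfolding poly_eq_0_iff_dvd by (elim dvdE)
      have r0: "r \<noteq> 0" using less.prems(1) r by auto
      have deg: "degree p = Suc (degree r)" using r0 unfolding r by (subst degree_mult_eq) auto
      have "poly_op r A s = (\<lambda>i. 0)" if s: "\<forall>i>n. s i = 0" for s
      proof (rule ccontr)
        assume nz: "poly_op r A s \<noteq> (\<lambda>i. 0)"
        have "poly_op [:-c, 1:] A (poly_op r A s) = (\<lambda>i. 0)" (is "?l = _")
          using less.prems(3) s by (simp only: kills_def r poly_op_mult[OF A])
        then have "(\<lambda>i. A (poly_op r A s) i - c * poly_op r A s i) = (\<lambda>i. 0)"
          by (simp add: poly_op_pCons[OF A] op_linear_zero[OF A])
        then have "A (poly_op r A s) i = c * poly_op r A s i" for i by (metis eq_iff_diff_eq_0)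
        moreover have "\<forall>i>n. poly_op r A s i = 0"
          using poly_op_support[OF A supp, of n s] s by blast
        ultimately have "c \<in> spectrum n A" using nz by (auto simp: spectrum_def)
        then show False using c(2) by simp
      qed
      then have "kills r" by (simp add: kills_def)
      then show ?thesis using less.hyps[of r] deg r0 less.prems(2) by simp
    qed (use less in blast)
  qed
  then obtain p' where p': "p' \<noteq> 0" "degree p' \<le> Suc n * Suc n" "kills p'" "\<And>c. poly p' c = 0 \<Longrightarrow> c \<in> spectrum n A"
    by blast
  have "p' dvd (\<Prod>c\<in>spectrum n A. [:-c, 1:] ^ (Suc n * Suc n))"
    by (rule prod_linear_factors_dvd[OF fin p'(1,4,2)])
  then obtain g where g: "(\<Prod>c\<in>spectrum n A. [:-c, 1:] ^ (Suc n * Suc n)) = g * p'" by (metis dvdE mult.commute)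
  show "poly_op (\<Prod>c\<in>spectrum n A. [:-c, 1:] ^ (Suc n * Suc n)) A s = (\<lambda>i. 0)" if "\<And>i. i > n \<Longrightarrow> s i = 0"
    using p'(3) that unfolding g kills_def
    by (simp add: poly_op_mult[OF A] op_linear_zero[OF op_linear_poly_op[OF A]])
qed

section \<open>Polynomial identities along complex lines\<close>

lemma polyf_on_line:
  assumes "polyf f"
  shows "\<exists>p. \<forall>t. f (\<lambda>i. a i + t * b i) = poly p t"
  using assms
proof induction
  case (polyf_const c)
  show ?case by (intro exI[of _ "[:c:]"]) simp
next
  case (polyf_coord i)
  show ?case by (intro exI[of _ "[:a i, b i:]"]) simp
next
  case (polyf_add f g)
  then obtain p q where "\<forall>t. f (\<lambda>i. a i + t * b i) = poly p t" "\<forall>t. g (\<lambda>i. a i + t * b i) = poly q t" by blast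
  then show ?case by (intro exI[of _ "p + q"]) simp
next
  case (polyf_mult f g)
  then obtain p q where "\<forall>t. f (\<lambda>i. a i + t * b i) = poly p t" "\<forall>t. g (\<lambda>i. a i + t * b i) = poly q t" by blast
  then show ?case by (intro exI[of _ "p * q"]) simp
qed

text \<open>On the line, \<open>f\<close> is a polynomial in one variable with infinitely many
  roots. This carries identities from a short real segment to complex parameters.\<close>

lemma polyf_zero_on_line:
  assumes "polyf f" "\<delta> > 0" and z: "\<And>t::real. 0 < t \<Longrightarrow> t < \<delta> \<Longrightarrow> f (\<lambda>i. a i + of_real t * b i) = 0"
  shows "f (\<lambda>i. a i + t * b i) = 0"
proof -
  obtain p where p: "\<And>t. f (\<lambda>i. a i + t * b i) = poly p t" using polyf_on_line[OF assms(1)] by blast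
  have "of_real ` {0<..<\<delta>} \<subseteq> {t. poly p t = 0}" using z p by auto
  moreover have "infinite (complex_of_real ` {0<..<\<delta>})"
    using assms(2) by (simp add: finite_image_iff inj_on_def)
  ultimately have "p = 0" using poly_roots_finite finite_subset by blast
  then show ?thesis using p by simp
qed


lemma polyf_power:
  assumes "polyf f"
  shows "polyf (\<lambda>z. f z ^ k)"
  by (induction k) (simp_all add: polyf_const polyf_mult assms)

text \<open>The matrices are cubic in \<open>z\<close>, so an eigenvalue \<open>c\<close> found
  where \<open>N z = 1\<close> becomes \<open>c * r ^ 3\<close> where \<open>r * r = N z\<close>.
  That is not polynomial in \<open>z\<close>, but its square \<open>c^2 * N z ^ 3\<close> is.
  Quadratic factors with both signs of the root therefore replace the linear ones.\<close>

lemma polyf_poly_op_quadratic: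
  assumes M: "\<And>i j. polyf (\<lambda>z. M z i j)" and N: "polyf N" and fin: "finite S"
  shows "polyf (\<lambda>z. poly_op (\<Prod>c\<in>S. [:- (c\<^sup>2 * N z ^ 3), 0, 1:] ^ d) (apply_matrix n (M z)) s i)"
proof -
  note lin = op_linear_apply_matrix
  have quad: "polyf (\<lambda>z. poly_op [:- (c\<^sup>2 * N z ^ 3), 0, 1:] (apply_matrix n (M z)) (t z) i)"
    if t: "\<And>i. polyf (\<lambda>z. t z i)" for c t i
  proof -
    have "poly_op [:- (c\<^sup>2 * N z ^ 3), 0, 1:] (apply_matrix n (M z)) (t z) i
        = (- c\<^sup>2) * N z ^ 3 * t z i + apply_matrix n (M z) (apply_matrix n (M z) (t z)) i" for z
      by (simp add: poly_op_pCons[OF lin] op_linear_zero[OF lin])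
    then show ?thesis
      by (simp only:) (intro polyf_add polyf_mult polyf_const polyf_power N t polyf_apply_matrix M)
  qed
  have pow: "polyf (\<lambda>z. poly_op ([:- (c\<^sup>2 * N z ^ 3), 0, 1:] ^ k) (apply_matrix n (M z)) (t z) i)"
    if t: "\<And>i. polyf (\<lambda>z. t z i)" for c k t i
  proof (induction k arbitrary: i)
    case 0
    show ?case using t by (simp add: poly_op_1[OF lin])
  next
    case (Suc k)
    show ?case unfolding power_Suc poly_op_mult[OF lin] by (rule quad) (rule Suc)
  qed
  show ?thesis using fin
  proof (induction S arbitrary: i)
    case empty
    show ?case by (simp add: poly_op_1[OF lin] polyf_const)
  next
    case (insert c S)
    show ?case unfolding prod.insert[OF insert.hyps] poly_op_mult[OF lin] by (rule pow) (rule insert.IH)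
  qed
qed

text \<open>
  \<open>Z y\<close> runs through a real form of the complexification on which the quadratic form
  \<open>N\<close> is indefinite. Since all expressions are polynomial, the annihilating polynomial found
  there also works on the real form on which \<open>N\<close> is definite.
\<close>

lemma isospectral_imp_nilpotent:
  fixes n :: nat and M :: "(nat \<Rightarrow> complex) \<Rightarrow> nat \<Rightarrow> nat \<Rightarrow> complex" and u :: "nat \<Rightarrow> complex"
  defines "m \<equiv> Suc n"
  defines "A \<equiv> \<lambda>z. apply_matrix m (M z)"
  defines "N \<equiv> \<lambda>z :: nat \<Rightarrow> complex. \<Sum>i\<le>m. z i * z i"
  defines "Z \<equiv> \<lambda>y :: nat \<Rightarrow> real. \<lambda>i. u i * of_real (y i)"
  assumes poly: "\<And>i j. polyf (\<lambda>z. M z i j)"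
    and sym: "\<And>z i j. M z i j = M z j i"
    and cubic: "\<And>t z i j. M (\<lambda>i. t * z i) i j = t ^ 3 * M z i j"
    and tang: "\<And>z. A z z = (\<lambda>i. 0)"
    and u: "\<And>i. u i * u i = 1 \<or> u i * u i = -1" "u m = 1"
    and spec: "\<And>y. (\<And>i. i > m \<Longrightarrow> y i = 0) \<Longrightarrow> N (Z y) = 1 \<Longrightarrow> spectrum m (A (Z y)) = \<Sigma>"
    and y: "\<And>i. i > m \<Longrightarrow> y i = 0"
  shows "spectrum m (A (Z y)) \<subseteq> {0}"
proof -
  define e where "e = (\<lambda>i. if i = m then 1 else (0::real))"
  have Az: "A z = apply_matrix m (M z)" for z by (simp add: A_def)
  have lin: "op_linear (A z)" for z by (simp add: A_def op_linear_apply_matrix)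
  have suppA: "A z s i = 0" if "i > m" for z s i using that by (simp add: A_def apply_matrix_def)
  have Ze: "Z e = (\<lambda>i. if i = m then 1 else 0)" using u(2) by (auto simp: Z_def e_def)
  have NZ: "N (Z y) = of_real (Re (N (Z y)))" for y
  proof -
    have "Z y i * Z y i \<in> \<real>" for i
    proof -
      have "Z y i * Z y i = (u i * u i) * (of_real (y i) * of_real (y i))" by (simp add: Z_def)
      moreover have "u i * u i \<in> \<real>" using u(1)[of i] by auto
      ultimately show ?thesis by (metis Reals_mult Reals_of_real)
    qed
    then have "N (Z y) \<in> \<real>" unfolding N_def by (intro sum_in_Reals) auto
    then show ?thesis by (simp add: complex_is_Real_iff complex_eq_iff)
  qed
  have Ne: "N (Z e) = 1" unfolding Ze N_def
    by (simp add: if_distrib[of "\<lambda>x. x * _"] if_distrib[of "\<lambda>x. _ * x"] cong: if_cong)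
  have se: "spectrum m (A (Z e)) = \<Sigma>" by (rule spec[OF _ Ne]) (simp add: e_def)
  have fin: "finite \<Sigma>" using annihilating_poly_spectrum(1)[OF lin suppA] se by metis
  have "0 \<in> \<Sigma>"
  proof -
    have "A (Z e) (Z e) = (\<lambda>i. 0 * Z e i)" using tang by simp
    moreover have "Z e \<noteq> (\<lambda>i. 0)" using Ze by (metis zero_neq_one)
    moreover have "\<forall>i>m. Z e i = 0" by (simp add: Ze)
    ultimately show ?thesis unfolding se[symmetric] spectrum_def by blast
  qed
  define d where "d = Suc m * Suc m"
  define q where "q N = (\<Prod>c\<in>\<Sigma>. [:- (c\<^sup>2 * N ^ 3), 0, 1:] ^ d)" for N :: complex
  have homog: "A (\<lambda>i. t * z i) s = (\<lambda>i. t ^ 3 * A z s i)" for t z s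
    by (simp add: A_def apply_matrix_def cubic sum_distrib_left mult.assoc fun_eq_iff)
  have kill_pos: "poly_op (q (N (Z y))) (A (Z y)) s = (\<lambda>i. 0)" 
    if y: "\<And>i. i > m \<Longrightarrow> y i = 0" "Re (N (Z y)) > 0" and s: "\<And>i. i > m \<Longrightarrow> s i = 0" for y s
  proof -
    \<comment> \<open>Division by \<open>r\<close> moves the point to the level
      \<open>N = 1\<close>, where the spectrum is known; the eigenvalues change by the factor
      \<open>r ^ 3\<close>.\<close>
    define r where "r = sqrt (Re (N (Z y)))"
    have r: "r > 0" "of_real r * of_real r = N (Z y)" 
      using y(2) NZ[of y] by (simp_all add: r_def flip: of_real_mult)
    define y' where "y' i = y i / r" for i
    have yy': "Z y = (\<lambda>i. of_real r * Z y' i)" using r by (simp add: Z_def y'_def fun_eq_iff)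
    have "N (Z y) = of_real r * of_real r * N (Z y')" 
      unfolding yy' N_def by (simp add: sum_distrib_left mult_ac)
    then have "N (Z y') = 1" using r by (metis mult_cancel_left1 mult_eq_0_iff of_real_eq_0_iff less_irrefl)
    then have sy': "spectrum m (A (Z y')) = \<Sigma>" by (intro spec) (simp_all add: y'_def y)
    have AA: "A (Z y) s = (\<lambda>i. of_real r ^ 3 * A (Z y') s i)" for s unfolding yy' homog ..
    have sub: "\<exists>c'\<in>\<Sigma>. c = of_real r ^ 3 * c'" if c: "c \<in> spectrum m (A (Z y))" for c
    proof -
      obtain w where w: "w \<noteq> (\<lambda>i. 0)" "\<forall>i>m. w i = 0" "A (Z y) w = (\<lambda>i. c * w i)"
        using c by (auto simp: spectrum_def)
      have "A (Z y') w i = (c / of_real r ^ 3) * w i" for i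
        using fun_cong[OF w(3), of i] r(1) unfolding AA by (simp add: field_simps)
      then have "c / of_real r ^ 3 \<in> \<Sigma>" using w unfolding sy'[symmetric] spectrum_def by blast
      then show ?thesis using r(1) by (intro bexI[of _ "c / of_real r ^ 3"]) auto
    qed
    have "(\<Prod>c\<in>spectrum m (A (Z y)). [:-c, 1:] ^ d) dvd q (N (Z y))"
    proof -
      define h where "h c = c / of_real r ^ 3" for c :: complex
      have h: "h c \<in> \<Sigma>" "c = of_real r ^ 3 * h c" if "c \<in> spectrum m (A (Z y))" for c
        using sub[OF that] r(1) by (auto simp: h_def)
      have inj: "inj_on h (spectrum m (A (Z y)))" using r(1) by (auto simp: inj_on_def h_def)
      have "(\<Prod>c\<in>spectrum m (A (Z y)). [:-c, 1:] ^ d) dvd (\<Prod>c\<in>spectrum m (A (Z y)). [:- ((h c)\<^sup>2 * N (Z y) ^ 3), 0, 1:] ^ d)"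
      proof (rule prod_dvd_prod, rule dvd_power_same)
        fix c assume c: "c \<in> spectrum m (A (Z y))"
        have "(h c)\<^sup>2 * N (Z y) ^ 3 = (of_real r ^ 3 * h c)\<^sup>2"
          unfolding r(2)[symmetric] by (simp add: power_mult_distrib power2_eq_square power3_eq_cube)
        then have "[:- ((h c)\<^sup>2 * N (Z y) ^ 3), 0, 1:] = [:-c, 1:] * [:c, 1:]"
          using h(2)[OF c] by (simp add: power2_eq_square)
        then show "[:-c, 1:] dvd [:- ((h c)\<^sup>2 * N (Z y) ^ 3), 0, 1:]" by (simp only: dvd_triv_left)
      qed
      also have "\<dots> = (\<Prod>c\<in>h ` spectrum m (A (Z y)). [:- (c\<^sup>2 * N (Z y) ^ 3), 0, 1:] ^ d)"
        by (simp add: prod.reindex[OF inj])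
      also have "\<dots> dvd q (N (Z y))" unfolding q_def
        using fin h(1) by (intro prod_dvd_prod_subset) auto
      finally show ?thesis .
    qed
    then obtain g where g: "q (N (Z y)) = g * (\<Prod>c\<in>spectrum m (A (Z y)). [:-c, 1:] ^ d)" by (metis dvdE mult.commute)
    show ?thesis
      using annihilating_poly_spectrum(2)[OF lin suppA, of m s] s
      unfolding g poly_op_mult[OF lin] d_def by (simp add: op_linear_zero[OF op_linear_poly_op[OF lin]])
  qed
  have kill: "poly_op (q (N z)) (A z) s = (\<lambda>i. 0)" 
    if z: "\<And>i. i > m \<Longrightarrow> z i = 0" and s: "\<And>i. i > m \<Longrightarrow> s i = 0" for z s
  proof
    fix i
    define F where "F z = poly_op (q (N z)) (A z) s i" for z
    have NP: "polyf N" unfolding N_def by (intro polyf_sum polyf_mult polyf_coord)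
    have F: "polyf F" unfolding F_def[abs_def] q_def A_def by (rule polyf_poly_op_quadratic[OF poly NP fin])
    have Zlin: "(\<lambda>i. Z a i + of_real t * Z b i) = Z (\<lambda>i. a i + t * b i)" for a b t
      by (simp add: Z_def fun_eq_iff algebra_simps)
    \<comment> \<open>Near \<open>e\<close> the form stays positive, so \<open>kill_pos\<close>
      applies to short real segments starting there, and the polynomial \<open>F\<close> then
      vanishes on the whole complex line. The value \<open>t = 1\<close> with direction
      \<open>b - e\<close> reaches every point of the real form, whatever the sign of
      \<open>N\<close>.\<close>
    have F1: "F (\<lambda>i. Z e i + t * Z b i) = 0" if b: "\<And>i. i > m \<Longrightarrow> b i = 0" for b t
    proof -
      have cont: "continuous (at 0) (\<lambda>t. Re (N (Z (\<lambda>i. e i + t * b i))))"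
      proof -
        have "continuous_on UNIV (\<lambda>t. Re (N (Z (\<lambda>i. e i + t * b i))))"
          unfolding N_def Z_def by (intro continuous_intros)
        then show ?thesis by (simp add: continuous_on_eq_continuous_at)
      qed
      have "Re (N (Z (\<lambda>i. e i + 0 * b i))) > 0" using Ne by simp
      then have "eventually (\<lambda>t. Re (N (Z (\<lambda>i. e i + t * b i))) > 0) (at 0)"
        using cont unfolding continuous_at by (rule order_tendstoD(1)[rotated])
      then obtain \<delta> where \<delta>: "\<delta> > 0" "\<And>t. t \<noteq> 0 \<Longrightarrow> \<bar>t\<bar> < \<delta> \<Longrightarrow> Re (N (Z (\<lambda>i. e i + t * b i))) > 0"
        by (auto simp: eventually_at dist_real_def)
      show ?thesis
      proof (rule polyf_zero_on_line[OF F \<delta>(1)])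
        fix t assume "0 < t" "t < \<delta>"
        then have "Re (N (Z (\<lambda>i. e i + t * b i))) > 0" using \<delta>(2)[of t] by simp
        then show "F (\<lambda>i. Z e i + of_real t * Z b i) = 0"
          unfolding Zlin F_def using kill_pos[of "\<lambda>i. e i + t * b i" s] b s by (simp add: e_def)
      qed
    qed
    have F2: "F (Z b) = 0" if b: "\<And>i. i > m \<Longrightarrow> b i = 0" for b
    proof -
      have "(\<lambda>i. Z e i + 1 * Z (\<lambda>i. b i - e i) i) = Z b" by (simp add: Z_def fun_eq_iff algebra_simps)
      then show ?thesis using F1[of "\<lambda>i. b i - e i" 1] b by (simp add: e_def)
    qed
    have u0: "u i \<noteq> 0" for i using u(1)[of i] by auto
    \<comment> \<open>Every \<open>z\<close> has a real and an imaginary part with respect to the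
      real form; a second complex line, evaluated at the imaginary unit, joins them.\<close>
    define a where "a i = Re (z i / u i)" for i
    define b where "b i = Im (z i / u i)" for i
    have zab: "z = (\<lambda>i. Z a i + \<i> * Z b i)"
    proof
      fix i
      have "z i = u i * (z i / u i)" using u0 by simp
      also have "z i / u i = of_real (a i) + \<i> * of_real (b i)" unfolding a_def b_def by (rule complex_eq)
      finally show "z i = Z a i + \<i> * Z b i" by (simp add: Z_def algebra_simps)
    qed
    have "F (\<lambda>i. Z a i + \<i> * Z b i) = 0"
    proof (rule polyf_zero_on_line[OF F zero_less_one])
      fix t :: real
      show "F (\<lambda>i. Z a i + of_real t * Z b i) = 0"
        unfolding Zlin by (rule F2) (simp add: a_def b_def z)
    qed
    then show "poly_op (q (N z)) (A z) s i = 0" using zab by (simp add: F_def)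
  qed
  have \<Sigma>0: "\<Sigma> = {0}"
  proof -
    have "c = 0" if c: "c \<in> \<Sigma>" for c
    proof -
      obtain w where w: "w \<noteq> (\<lambda>i. 0)" "\<forall>i>m. w i = 0" "A (Z e) w = (\<lambda>i. c * w i)"
        using c unfolding se[symmetric] spectrum_def by blast
      \<comment> \<open>The quadratic form is 1 on the real unit sphere, so there the family
        \<open>q\<close> specialises to the single polynomial \<open>q 1\<close>, which is even and
        vanishes at 0 because \<open>0 \<in> \<Sigma>\<close>.\<close>
      show "c = 0"
      proof (rule no_isospectral_symmetric_family[where M = M and q = "q 1" and n = n and w = w, folded m_def, folded Az])
        show "polyf (\<lambda>z. M z i j)" for i j by (rule poly)
        show "M z i j = M z j i" for z i j by (rule sym)
        show "M (\<lambda>i. - z i) i j = - M z i j" for z i j using cubic[of "-1" z i j] by simp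
        show "A z z = (\<lambda>i. 0)" for z by (rule tang)
        show "q 1 \<noteq> 0" using fin by (simp add: q_def)
        show "pcompose (q 1) [:0, -1:] = q 1"
        proof -
          have "pcompose (p ^ k) [:0, -1:] = p ^ k" if "pcompose p [:0, -1:] = p" for k and p :: "complex poly"
            by (induction k) (simp_all add: pcompose_mult pcompose_1 that)
          then show ?thesis unfolding q_def pcompose_prod
            by (intro prod.cong refl) (simp add: pcompose_pCons)
        qed
        have "poly (q 1) 0 = (\<Prod>c\<in>\<Sigma>. (- (c\<^sup>2)) ^ d)" by (simp add: q_def poly_prod)
        also have "\<dots> = 0" using fin \<open>0 \<in> \<Sigma>\<close> by (intro prod_zero) (auto simp: d_def)
        finally show "poly (q 1) 0 = 0" .
        show "poly_op (q 1) (A (\<lambda>i. complex_of_real (x i))) s = (\<lambda>i. 0)"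
          if x: "x \<in> sph m" and s: "\<And>i. i > m \<Longrightarrow> s i = 0" for x s
        proof -
          have "N (\<lambda>i. complex_of_real (x i)) = of_real (\<Sum>i\<le>m. (x i)\<^sup>2)"
            by (simp only: N_def of_real_sum power2_eq_square of_real_mult)
          moreover have "(\<Sum>i\<le>m. (x i)\<^sup>2) = 1" using x by (simp add: sph_def)
          ultimately have "N (\<lambda>i. complex_of_real (x i)) = 1" by (simp only: of_real_1)
          then show ?thesis using kill[of "\<lambda>i. complex_of_real (x i)" s] x s by (simp add: sph_def)
        qed
        show "A (\<lambda>i. if i = m then 1 else 0) w = (\<lambda>i. c * w i)" using w(3) by (simp add: Ze)
      qed (use w in auto)
    qed
    then show ?thesis using \<open>0 \<in> \<Sigma>\<close> by auto
  qed
  \<comment> \<open>Once \<open>\<Sigma>\<close> is \<open>{0}\<close>, the polynomial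
    \<open>q (N (Z y))\<close> is a power of the variable for every value of \<open>N\<close>, so
    null vectors and those of negative square are covered too.\<close>
  show ?thesis
  proof
    fix c assume "c \<in> spectrum m (A (Z y))"
    then obtain w where w: "w \<noteq> (\<lambda>i. 0)" "\<forall>i>m. w i = 0" "A (Z y) w = (\<lambda>i. c * w i)"
      by (auto simp: spectrum_def)
    have "poly_op (q (N (Z y))) (A (Z y)) w = (\<lambda>i. 0)"
      by (rule kill) (use y w in \<open>auto simp: Z_def\<close>)
    then have "(\<lambda>i. poly (q (N (Z y))) c * w i) = (\<lambda>i. 0)"
      using poly_op_eigenvector[OF lin w(3)] by simp
    then have "poly (q (N (Z y))) c = 0" using w(1) by (metis mult_eq_0_iff)
    then show "c \<in> {0}" by (simp add: q_def \<Sigma>0)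
  qed
qed

section \<open>Szabo tensors\<close>

lemma abs_eq_1_imp_square: "\<bar>a\<bar> = 1 \<Longrightarrow> a * a = (1::real)"
  by (cases "a \<ge> 0") auto

definition orthonormal_set :: "('a::real_vector \<Rightarrow> 'a \<Rightarrow> real) \<Rightarrow> 'a set \<Rightarrow> bool" where
  "orthonormal_set g E \<longleftrightarrow> (\<forall>b\<in>E. \<bar>g b b\<bar> = 1) \<and> (\<forall>b\<in>E. \<forall>c\<in>E. b \<noteq> c \<longrightarrow> g b c = 0)"

text \<open>An orthonormal set containing \<open>u\<close> of largest size must span. Otherwise
  nondegeneracy gives two vectors of the orthogonal complement with non-zero product, and one of
  them or their sum is not null and can be normalised.\<close>

lemma exists_orthonormal_basis:
  fixes g :: "'a::real_vector \<Rightarrow> 'a \<Rightarrow> real"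
  assumes fin: "\<exists>B. finite B \<and> span B = (UNIV :: 'a set)"
    and g: "nondegenerate_inner_product g" and u: "\<bar>g u u\<bar> = 1"
  shows "\<exists>E. finite E \<and> u \<in> E \<and> orthonormal_set g E \<and> independent E \<and> span E = UNIV"
proof -
  obtain B0 :: "'a set" where B0: "finite B0" "span B0 = UNIV" using fin by blast
  have l1: "linear (\<lambda>x. g x y)" and l2: "linear (g x)" for x y
    using g by (auto simp: nondegenerate_inner_product_def bilinear_def)
  have sy: "g x y = g y x" for x y using g by (simp add: nondegenerate_inner_product_def)
  have expand: "g (\<Sum>b\<in>E. f b *\<^sub>R b) c = f c * g c c" if "orthonormal_set g E" "finite E" "c \<in> E" for E f c
  proof -
    have "g (\<Sum>b\<in>E. f b *\<^sub>R b) c = (\<Sum>b\<in>E. f b * g b c)"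
      by (simp add: linear_sum[OF l1] linear_scale[OF l1])
    also have "\<dots> = (\<Sum>b\<in>E. if b = c then f c * g c c else 0)"
      using that by (intro sum.cong) (auto simp: orthonormal_set_def)
    finally show ?thesis using that by simp
  qed
  have indep: "independent E" if E: "orthonormal_set g E" "finite E" for E
  proof (rule independent_if_scalars_zero[OF E(2)])
    fix f c assume s: "(\<Sum>b\<in>E. f b *\<^sub>R b) = 0" and c: "c \<in> E"
    have "g 0 c = 0" using linear_0[OF l1] .
    then have "f c * g c c = 0" using expand[OF E c, of f] s by simp
    then show "f c = 0" using E(1) c by (auto simp: orthonormal_set_def)
  qed
  define P where "P k \<longleftrightarrow> (\<exists>E. finite E \<and> u \<in> E \<and> orthonormal_set g E \<and> card E = k)" for k
  have P1: "P 1" unfolding P_def using u by (intro exI[of _ "{u}"]) (auto simp: orthonormal_set_def)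
  have bd: "k \<le> card B0" if k: "P k" for k
  proof -
    obtain E where "finite E" "orthonormal_set g E" "card E = k" using k unfolding P_def by blast
    then show ?thesis using independent_span_bound[OF B0(1) indep, of E] B0(2) by auto
  qed
  define k where "k = Greatest P"
  have k: "P k" "\<And>l. P l \<Longrightarrow> l \<le> k"
    using GreatestI_nat[of P 1 "card B0"] Greatest_le_nat[of P _ "card B0"] P1 bd unfolding k_def by blast+
  obtain E where E: "finite E" "u \<in> E" "orthonormal_set g E" "card E = k" using k(1) unfolding P_def by blast
  have "span E = UNIV"
  proof (rule ccontr)
    assume "span E \<noteq> UNIV"
    then obtain x where x: "x \<notin> span E" by blast
    define pr where "pr x = x - (\<Sum>b\<in>E. (g x b * g b b) *\<^sub>R b)" for x
    have gg: "g b b * g b b = 1" if "b \<in> E" for b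
      using E(3) that abs_eq_1_imp_square by (simp add: orthonormal_set_def)
    have po: "g (pr x) c = 0" if "c \<in> E" for x c
      using expand[OF E(3,1) that, of "\<lambda>b. g x b * g b b"] gg[OF that]
      by (simp add: pr_def linear_diff[OF l1] mult.assoc)
    have "pr x \<noteq> 0"
    proof
      assume "pr x = 0"
      then have "x = (\<Sum>b\<in>E. (g x b * g b b) *\<^sub>R b)" by (simp add: pr_def)
      moreover have "(\<Sum>b\<in>E. (g x b * g b b) *\<^sub>R b) \<in> span E"
        by (intro span_sum span_scale span_base)
      ultimately show False using x by simp
    qed
    then obtain y where y: "g (pr x) y \<noteq> 0" using g unfolding nondegenerate_inner_product_def by blast
    have op: "g (pr x) (\<Sum>b\<in>E. f b *\<^sub>R b) = 0" for f x
      by (simp add: linear_sum[OF l2] linear_scale[OF l2] po)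
    have "g (pr x) (pr y) = g (pr x) y" unfolding pr_def[of y] linear_diff[OF l2] using op by simp
    then have xy: "g (pr x) (pr y) \<noteq> 0" using y by simp
    have po': "g (pr x + pr y) c = 0" if "c \<in> E" for c using po[OF that] by (simp add: linear_add[OF l1])
    have "\<exists>w. g w w \<noteq> 0 \<and> (\<forall>c\<in>E. g w c = 0)"
    proof (cases "g (pr x) (pr x) \<noteq> 0 \<or> g (pr y) (pr y) \<noteq> 0")
      case True
      then show ?thesis using po by blast
    next
      case False
      then have "g (pr x + pr y) (pr x + pr y) = 2 * g (pr x) (pr y)"
        using sy[of "pr x" "pr y"] by (simp add: linear_add[OF l1] linear_add[OF l2])
      then show ?thesis using xy po' by (intro exI[of _ "pr x + pr y"]) simp
    qed
    then obtain w where w: "g w w \<noteq> 0" "\<And>c. c \<in> E \<Longrightarrow> g w c = 0" by blast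
    define w' where "w' = (1 / sqrt \<bar>g w w\<bar>) *\<^sub>R w"
    have "\<bar>g w' w'\<bar> = 1" using w(1) 
      by (simp add: w'_def linear_scale[OF l1] linear_scale[OF l2] abs_mult abs_divide flip: real_sqrt_mult)
    moreover have w'0: "g w' c = 0" "g c w' = 0" if "c \<in> E" for c 
      using w(2)[OF that] sy[of c w'] by (simp_all add: w'_def linear_scale[OF l1])
    ultimately have "orthonormal_set g (insert w' E)" using E(3) unfolding orthonormal_set_def by auto
    moreover have "w' \<notin> E" using w'0 \<open>\<bar>g w' w'\<bar> = 1\<close> by force
    ultimately have "P (Suc k)" unfolding P_def using E by (intro exI[of _ "insert w' E"]) auto
    then show False using k(2) by fastforce
  qed
  then show ?thesis using E indep by blast
qed

text \<open>The given vector takes the last index because the pole of the sphere is the last unit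
  vector. Dimension at least 2 leaves another basis vector, so the last index has the form
  \<open>Suc n\<close>.\<close>

lemma exists_indexed_orthonormal_basis:
  fixes g :: "'a::real_vector \<Rightarrow> 'a \<Rightarrow> real"
  assumes fin: "\<exists>B. finite B \<and> span B = (UNIV :: 'a set)"
    and g: "nondegenerate_inner_product g" and u: "g u u = 1" and d: "dim (UNIV :: 'a set) \<ge> 2"
  shows "\<exists>b n. b (Suc n) = u \<and> (\<forall>i\<le>Suc n. \<bar>g (b i) (b i)\<bar> = 1) \<and>
    (\<forall>i\<le>Suc n. \<forall>j\<le>Suc n. i \<noteq> j \<longrightarrow> g (b i) (b j) = 0) \<and>
    (\<forall>x. x = (\<Sum>i\<le>Suc n. (g (b i) (b i) * g x (b i)) *\<^sub>R b i))"
proof -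
  obtain E where E: "finite E" "u \<in> E" "orthonormal_set g E" "independent E" "span E = UNIV"
    using exists_orthonormal_basis[OF fin g, of u] u by auto
  have "card E = dim (UNIV :: 'a set)" using dim_eq_card[of E UNIV] E(4,5) by simp
  then have "card (E - {u}) > 0" using d E by (simp add: card_Diff_singleton)
  then obtain n where n: "card (E - {u}) = Suc n" by (metis gr0_conv_Suc)
  obtain f where f: "bij_betw f {..<Suc n} (E - {u})"
    using ex_bij_betw_nat_finite[of "E - {u}"] E(1) n by (auto simp: atLeast0LessThan)
  define b where "b i = (if i = Suc n then u else f i)" for i
  have bb: "bij_betw b {..Suc n} E"
  proof -
    have "bij_betw b {..<Suc n} (E - {u})" 
      using f by (rule bij_betw_cong[THEN iffD1, rotated]) (simp add: b_def)
    moreover have "bij_betw b {Suc n} {u}" by (simp add: b_def bij_betw_def)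
    ultimately have "bij_betw b ({..<Suc n} \<union> {Suc n}) ((E - {u}) \<union> {u})"
      by (rule bij_betw_combine) auto
    moreover have "{..<Suc n} \<union> {Suc n} = {..Suc n}" by auto
    moreover have "(E - {u}) \<union> {u} = E" using E(2) by auto
    ultimately show ?thesis by simp
  qed
  have bO: "b i \<in> E" if "i \<le> Suc n" for i using bb that by (auto simp: bij_betw_def)
  have binj: "b i \<noteq> b j" if "i \<le> Suc n" "j \<le> Suc n" "i \<noteq> j" for i j
    using bb that by (auto simp: bij_betw_def inj_on_def)
  have l1: "linear (\<lambda>x. g x y)" for y using g by (auto simp: nondegenerate_inner_product_def bilinear_def)
  have "x = (\<Sum>i\<le>Suc n. (g (b i) (b i) * g x (b i)) *\<^sub>R b i)" for x
  proof -
    have "x \<in> span E" using E(5) by simp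
    then obtain c where c: "x = (\<Sum>v\<in>E. c v *\<^sub>R v)" using span_finite[OF E(1)] by auto
    have "g v v * g x v = c v" if v: "v \<in> E" for v
    proof -
      have "g x v = (\<Sum>w\<in>E. c w * g w v)" unfolding c by (simp add: linear_sum[OF l1] linear_scale[OF l1])
      also have "\<dots> = (\<Sum>w\<in>E. if w = v then c v * g v v else 0)"
        using E(3) v by (intro sum.cong) (auto simp: orthonormal_set_def)
      also have "\<dots> = c v * g v v" using E(1) v by simp
      finally have "g v v * g x v = c v * (g v v * g v v)" by simp
      moreover have "g v v * g v v = 1" using E(3) v abs_eq_1_imp_square by (simp add: orthonormal_set_def)
      ultimately show ?thesis by simp
    qed
    then have "x = (\<Sum>v\<in>E. (g v v * g x v) *\<^sub>R v)" using c by (metis (no_types, lifting) sum.cong)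
    also have "\<dots> = (\<Sum>i\<le>Suc n. (g (b i) (b i) * g x (b i)) *\<^sub>R b i)"
      by (rule sum.reindex_bij_betw[OF bb, symmetric])
    finally show ?thesis .
  qed
  moreover have "\<bar>g (b i) (b i)\<bar> = 1" if "i \<le> Suc n" for i using E(3) bO[OF that] by (auto simp: orthonormal_set_def)
  moreover have "g (b i) (b j) = 0" if "i \<le> Suc n" "j \<le> Suc n" "i \<noteq> j" for i j 
    using E(3) bO binj that unfolding orthonormal_set_def by blast
  moreover have "b (Suc n) = u" by (simp add: b_def)
  ultimately show ?thesis by blast
qed

section \<open>From Szabo operators to complex symmetric matrices\<close>

lemma complex_spectrum_neg:
  "complex_spectrum (\<lambda>y. - A y) = uminus ` complex_spectrum A"
proof -
  have neg: "complex_scale (- c) w = - complex_scale c w" for c and w :: "'a \<times> 'a"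
    by (simp add: complex_scale_def uminus_prod_def)
  have "map_prod (\<lambda>y. - A y) (\<lambda>y. - A y) w = - map_prod A A w" for w
    by (cases w) simp
  then have "map_prod (\<lambda>y. - A y) (\<lambda>y. - A y) w = complex_scale c w \<longleftrightarrow> map_prod A A w = complex_scale (- c) w" for c w
    unfolding neg by (metis minus_minus)
  then have 1: "c \<in> complex_spectrum (\<lambda>y. - A y) \<longleftrightarrow> - c \<in> complex_spectrum A" for c
    by (simp add: complex_spectrum_def)
  show ?thesis
  proof (intro equalityI subsetI)
    fix c assume "c \<in> complex_spectrum (\<lambda>y. - A y)"
    then have "- c \<in> complex_spectrum A" using 1 by simp
    then have "- (- c) \<in> uminus ` complex_spectrum A" by (rule imageI)
    then show "c \<in> uminus ` complex_spectrum A" by simp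
  next
    fix c assume "c \<in> uminus ` complex_spectrum A"
    then show "c \<in> complex_spectrum (\<lambda>y. - A y)" using 1 by auto
  qed
qed

lemma szabo_operator:
  fixes g :: "'a::real_vector \<Rightarrow> 'a \<Rightarrow> real"
  assumes "\<exists>B. finite B \<and> span B = (UNIV :: 'a set)" "nondegenerate_inner_product g" "multilinear5 R"
  shows "linear (szabo_operator g R v)" "g (szabo_operator g R v y) z = R y v v z v"
  using theI'[OF szabo_operator_ex1[OF assms, of v]] unfolding szabo_operator_def by auto

lemma szabo_operator_unique:
  fixes g :: "'a::real_vector \<Rightarrow> 'a \<Rightarrow> real"
  assumes "\<exists>B. finite B \<and> span B = (UNIV :: 'a set)" "nondegenerate_inner_product g" "multilinear5 R"
    and "linear A" "\<And>y z. g (A y) z = R y v v z v"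
  shows "szabo_operator g R v = A"
  unfolding szabo_operator_def
  by (rule the1_equality[OF szabo_operator_ex1[OF assms(1-3)]]) (use assms in auto)

lemma zero_in_complex_spectrum:
  assumes "x \<noteq> 0" "A x = 0" "A 0 = 0"
  shows "0 \<in> complex_spectrum A"
  unfolding complex_spectrum_def mem_Collect_eq
  by (rule exI[of _ "(x, 0)"]) (use assms in \<open>simp add: complex_scale_def zero_prod_def\<close>)


lemma sum_antisymmetric:
  fixes f :: "nat \<Rightarrow> nat \<Rightarrow> complex"
  assumes "\<And>i j. f i j = - f j i"
  shows "(\<Sum>i\<le>n. \<Sum>j\<le>n. f i j) = 0"
proof -
  have "(\<Sum>i\<le>n. \<Sum>j\<le>n. f i j) = (\<Sum>j\<le>n. \<Sum>i\<le>n. f i j)" by (rule sum.swap)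
  also have "\<dots> = - (\<Sum>i\<le>n. \<Sum>j\<le>n. f i j)" by (subst assms) (simp add: sum_negf)
  finally show ?thesis by (simp add: eq_neg_iff_add_eq_0 flip: mult_2)
qed

text \<open>The spacelike unit vector \<open>e\<close> becomes the last basis vector and receives no
  imaginary factor. The pole thus lies both on the sphere where the spectrum is known to be constant
  and on the real unit sphere.\<close>

lemma spacelike_szabo_nilpotent:
  fixes g :: "'a::real_vector \<Rightarrow> 'a \<Rightarrow> real"
    and R :: "'a \<Rightarrow> 'a \<Rightarrow> 'a \<Rightarrow> 'a \<Rightarrow> 'a \<Rightarrow> real"
  assumes fin: "\<exists>B. finite B \<and> span B = (UNIV :: 'a set)"
    and g: "nondegenerate_inner_product g" and dim: "dim (UNIV :: 'a set) \<ge> 2"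
    and e: "g e e = 1"
    and R: "covariant_derivative_curvature_tensor R" and sz: "spacelike_szabo g R"
  shows "complex_spectrum (szabo_operator g R v) \<subseteq> {0}"
proof -
  obtain b n where H: "b (Suc n) = e \<and> (\<forall>i\<le>Suc n. \<bar>g (b i) (b i)\<bar> = 1) \<and>
    (\<forall>i\<le>Suc n. \<forall>j\<le>Suc n. i \<noteq> j \<longrightarrow> g (b i) (b j) = 0) \<and>
    (\<forall>x. x = (\<Sum>i\<le>Suc n. (g (b i) (b i) * g x (b i)) *\<^sub>R b i))"
    using exists_indexed_orthonormal_basis[OF fin g e dim] by (elim exE)
  note H2 = conjunct2[OF H] 
  note H3 = conjunct2[OF H2]
  have be: "b (Suc n) = e" by (rule conjunct1[OF H])
  have b1: "\<bar>g (b i) (b i)\<bar> = 1" if "i \<le> Suc n" for i using conjunct1[OF H2] that by blast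
  have b0: "g (b i) (b j) = 0" if "i \<le> Suc n" "j \<le> Suc n" "i \<noteq> j" for i j
    using conjunct1[OF H3] that by blast
  have bx: "x = (\<Sum>i\<le>Suc n. (g (b i) (b i) * g x (b i)) *\<^sub>R b i)" for x
    by (rule spec[OF conjunct2[OF H3]])
  define m where "m = Suc n"
  define et where "et i = g (b i) (b i)" for i
  have et: "et i = 1 \<or> et i = -1" if "i \<le> m" for i using b1[of i] that by (auto simp: et_def m_def)
  have et2: "et i * et i = 1" if "i \<le> m" for i using et[OF that] by auto
  \<comment> \<open>Basis vectors are multiplied by \<open>ep\<close> and coordinates by its
    reciprocal \<open>u\<close>. In the rescaled basis the complexified inner product is the sum of
    squares.\<close>
  define ep where "ep i = (if et i = 1 then 1 else \<i>)" for i
  define u where "u i = (if et i = 1 then 1 else - \<i>)" for i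
  have epu: "ep i * u i = 1" for i by (simp add: ep_def u_def)
  have ep2: "ep i * ep i = of_real (et i)" "u i * u i = of_real (et i)" if "i \<le> m" for i
    using et[OF that] by (auto simp: ep_def u_def)
  have l1: "linear (\<lambda>x. g x y)" and l2: "linear (g x)" for x y
    using g by (auto simp: nondegenerate_inner_product_def bilinear_def)
  have ml: "multilinear5 R" using R by (simp add: covariant_derivative_curvature_tensor_def)
  have Rpair: "R x y z w v = R z w x y v" and Ranti: "R x y z w v = - R y x z w v" for x y z w v
    using R unfolding covariant_derivative_curvature_tensor_def by blast+
  have Ranti2: "R x y z w v = - R x y w z v" for x y z w v
    using Rpair[of x y z w v] Ranti[of z w x y v] Rpair[of w z x y v] by simp
  have Rsym: "R x y z w v = R w z y x v" for x y z w v
    using Rpair[of x y z w v] Ranti[of z w x y v] Ranti2[of w z x y v] by simp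
  define co where "co x i = (if i \<le> m then et i * g x (b i) else 0)" for x i
  have exp: "x = (\<Sum>i\<le>m. co x i *\<^sub>R b i)" for x
  proof -
    have "x = (\<Sum>i\<le>Suc n. (g (b i) (b i) * g x (b i)) *\<^sub>R b i)" by (rule bx)
    also have "\<dots> = (\<Sum>i\<le>m. co x i *\<^sub>R b i)"
      by (rule sum.cong) (simp_all add: co_def et_def m_def)
    finally show ?thesis .
  qed
  have gsum: "g (\<Sum>i\<le>m. a i *\<^sub>R b i) (b k) = a k * et k" if "k \<le> m" for a k
  proof -
    have "g (\<Sum>i\<le>m. a i *\<^sub>R b i) (b k) = (\<Sum>i\<le>m. a i * g (b i) (b k))"
      by (simp add: linear_sum[OF l1] linear_scale[OF l1])
    also have "\<dots> = (\<Sum>i\<le>m. if i = k then a k * et k else 0)"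
      using that b0 by (intro sum.cong) (auto simp: et_def m_def)
    finally show ?thesis using that by simp
  qed
  have co_sum: "co (\<Sum>i\<le>m. a i *\<^sub>R b i) k = a k" if "k \<le> m" for a k
    using gsum[OF that, of a] et2[OF that] that by (simp add: co_def mult_ac)
  have co_add: "co (x + y) k = co x k + co y k" and co_scale: "co (r *\<^sub>R x) k = r * co x k" 
    and co_diff: "co (x - y) k = co x k - co y k" for x y r k
    by (simp_all add: co_def linear_add[OF l1] linear_scale[OF l1] linear_diff[OF l1] algebra_simps)
  have co_inj: "x = y" if "\<And>k. co x k = co y k" for x y
  proof -
    have "x = (\<Sum>i\<le>m. co x i *\<^sub>R b i)" by (rule exp)
    also have "\<dots> = (\<Sum>i\<le>m. co y i *\<^sub>R b i)" unfolding that ..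
    also have "\<dots> = y" by (rule exp[symmetric])
    finally show ?thesis .
  qed
  \<comment> \<open>These are the components of \<open>R\<close> in the rescaled basis;
    \<open>M z\<close> inserts \<open>z\<close> into the second, third and fifth slots, as in the
    Szabo operator.\<close>
  define T where "T j a c k d = ep j * ep a * ep c * ep k * ep d * complex_of_real (R (b j) (b a) (b c) (b k) (b d))" for j a c k d
  define M where "M z j k = (if j \<le> m \<and> k \<le> m then \<Sum>c\<le>m. \<Sum>a\<le>m. \<Sum>d\<le>m. T j a c k d * (z a * z c * z d) else 0)"
    for z :: "nat \<Rightarrow> complex" and j k
  define A where "A z = apply_matrix m (M z)" for z
  define Z where "Z y = (\<lambda>i. u i * complex_of_real (y i))" for y :: "nat \<Rightarrow> real"
  define S where "S v = szabo_operator g R v" for v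
  have S: "linear (S v)" "g (S v y) z = R y v v z v" for v y z
    unfolding S_def by (rule szabo_operator[OF fin g ml])+
  have MZ: "M (Z (co v)) j k = ep j * ep k * complex_of_real (R (b j) v v (b k) v)" if "j \<le> m" "k \<le> m" for v j k
  proof -
    have L: "linear (\<lambda>y. R x y z w v)" "linear (\<lambda>z. R x y z w v)" "linear (\<lambda>v. R x y z w v)" for x y z w v
      using ml by (auto simp: multilinear5_def)
    have e1: "R x v y z w = (\<Sum>a\<le>m. co v a * R x (b a) y z w)" for x y z w
    proof -
      have "R x v y z w = R x (\<Sum>a\<le>m. co v a *\<^sub>R b a) y z w" by (simp only: exp[symmetric])
      then show ?thesis by (simp add: linear_sum[OF L(1)] linear_scale[OF L(1)])
    qed
    have e2: "R x y v z w = (\<Sum>a\<le>m. co v a * R x y (b a) z w)" for x y z w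
    proof -
      have "R x y v z w = R x y (\<Sum>a\<le>m. co v a *\<^sub>R b a) z w" by (simp only: exp[symmetric])
      then show ?thesis by (simp add: linear_sum[OF L(2)] linear_scale[OF L(2)])
    qed
    have e3: "R x y z w v = (\<Sum>a\<le>m. co v a * R x y z w (b a))" for x y z w
    proof -
      have "R x y z w v = R x y z w (\<Sum>a\<le>m. co v a *\<^sub>R b a)" by (simp only: exp[symmetric])
      then show ?thesis by (simp add: linear_sum[OF L(3)] linear_scale[OF L(3)])
    qed
    have "R (b j) v v (b k) v = (\<Sum>c\<le>m. co v c * R (b j) v (b c) (b k) v)" by (rule e2)
    also have "\<dots> = (\<Sum>c\<le>m. co v c * (\<Sum>a\<le>m. co v a * R (b j) (b a) (b c) (b k) v))" by (simp only: e1)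
    also have "\<dots> = (\<Sum>c\<le>m. co v c * (\<Sum>a\<le>m. co v a * (\<Sum>d\<le>m. co v d * R (b j) (b a) (b c) (b k) (b d))))" by (simp only: e3)
    finally have r: "R (b j) v v (b k) v = (\<Sum>c\<le>m. \<Sum>a\<le>m. \<Sum>d\<le>m. R (b j) (b a) (b c) (b k) (b d) * (co v a * co v c * co v d))"
      by (simp add: sum_distrib_left mult_ac)
    have t: "T j a c k d * (Z (co v) a * Z (co v) c * Z (co v) d) = 
       ep j * ep k * of_real (R (b j) (b a) (b c) (b k) (b d) * (co v a * co v c * co v d))" for a c d
    proof -
      have "T j a c k d * (Z (co v) a * Z (co v) c * Z (co v) d) = 
        ep j * ep k * of_real (R (b j) (b a) (b c) (b k) (b d)) * ((ep a * u a) * (ep c * u c) * (ep d * u d)) * of_real (co v a * co v c * co v d)"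
        by (simp add: T_def Z_def mult_ac)
      then show ?thesis by (simp add: epu)
    qed
    show ?thesis using that unfolding M_def r t by (simp add: sum_distrib_left)
  qed
  have spec: "complex_spectrum (S v) = spectrum m (A (Z (co v)))" for v
  proof -
    \<comment> \<open>Rescaled complex coordinates of a pair: a complex-linear bijection onto the
      functions supported up to \<open>m\<close>. It intertwines the complexified Szabo operator
      with the matrix, so eigenvectors correspond.\<close>
    define ka where "ka w i = u i * (complex_of_real (co (fst w) i) + \<i> * complex_of_real (co (snd w) i))" for w :: "'a \<times> 'a" and i
    have ka0: "ka w i = 0" if "i > m" for w i using that by (simp add: ka_def co_def)
    have u0: "u i \<noteq> 0" for i by (simp add: u_def)
    have ka_inj: "w = w'" if "ka w = ka w'" for w w'
    proof -
      have "complex_of_real (co (fst w) i) + \<i> * complex_of_real (co (snd w) i) 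
          = complex_of_real (co (fst w') i) + \<i> * complex_of_real (co (snd w') i)" for i
        using fun_cong[OF that, of i] u0[of i] by (simp add: ka_def)
      then have "co (fst w) i = co (fst w') i" "co (snd w) i = co (snd w') i" for i
        by (auto simp: complex_eq_iff)
      then show ?thesis using co_inj by (metis prod_eqI)
    qed
    have ka_z: "ka 0 = (\<lambda>i. 0)" by (simp add: ka_def co_def linear_0[OF l1] fun_eq_iff)
    have ka_scale: "ka (complex_scale c w) = (\<lambda>i. c * ka w i)" for c w
      by (rule ext) (simp add: ka_def complex_scale_def co_add co_scale co_diff complex_eq_iff algebra_simps)
    have coS: "co (S v x) k = et k * (\<Sum>j\<le>m. co x j * R (b j) v v (b k) v)" if "k \<le> m" for x k
    proof -
      have L: "linear (\<lambda>x. R x v v (b k) v)" using ml by (auto simp: multilinear5_def)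
      have "g (S v x) (b k) = R (\<Sum>j\<le>m. co x j *\<^sub>R b j) v v (b k) v" by (simp only: exp[symmetric] S(2))
      also have "\<dots> = (\<Sum>j\<le>m. co x j * R (b j) v v (b k) v)" 
        by (simp add: linear_sum[OF L] linear_scale[OF L])
      finally show ?thesis using that by (simp add: co_def)
    qed
    have kaS: "ka (map_prod (S v) (S v) w) = A (Z (co v)) (ka w)" for w
    proof
      fix k
      show "ka (map_prod (S v) (S v) w) k = A (Z (co v)) (ka w) k"
      proof (cases "k \<le> m")
        case True
        have "A (Z (co v)) (ka w) k = (\<Sum>j\<le>m. ep k * ep j * complex_of_real (R (b k) v v (b j) v) * ka w j)"
          using True by (simp add: A_def apply_matrix_def MZ)
        also have "\<dots> = ep k * (\<Sum>j\<le>m. complex_of_real (R (b j) v v (b k) v) * 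
            (complex_of_real (co (fst w) j) + \<i> * complex_of_real (co (snd w) j)))"
          unfolding sum_distrib_left
        proof (rule sum.cong[OF refl])
          fix j
          have "ep k * ep j * complex_of_real (R (b k) v v (b j) v) * ka w j
             = ep k * (ep j * u j) * complex_of_real (R (b k) v v (b j) v) * (complex_of_real (co (fst w) j) + \<i> * complex_of_real (co (snd w) j))"
            by (simp add: ka_def mult_ac)
          then show "ep k * ep j * complex_of_real (R (b k) v v (b j) v) * ka w j
             = ep k * (complex_of_real (R (b j) v v (b k) v) * (complex_of_real (co (fst w) j) + \<i> * complex_of_real (co (snd w) j)))"
            using Rsym[of "b k" v v "b j" v] by (simp add: epu mult.assoc)
        qed
        also have "ep k = u k * of_real (et k)"
        proof -
          have "u k * of_real (et k) = u k * (ep k * ep k)" using ep2 True by simp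
          also have "\<dots> = (ep k * u k) * ep k" by (simp only: mult_ac)
          finally show ?thesis by (simp add: epu)
        qed
        also have "u k * of_real (et k) * (\<Sum>j\<le>m. complex_of_real (R (b j) v v (b k) v) * 
            (complex_of_real (co (fst w) j) + \<i> * complex_of_real (co (snd w) j))) = ka (map_prod (S v) (S v) w) k"
          using coS[OF True] by (simp add: ka_def sum_distrib_left sum.distrib distrib_left distrib_right mult_ac)
        finally show ?thesis ..
      qed (simp add: ka0 A_def apply_matrix_def)
    qed
    have ka_surj: "\<exists>w. ka w = om" if om: "\<forall>i>m. om i = 0" for om
    proof -
      define w where "w = ((\<Sum>i\<le>m. Re (ep i * om i) *\<^sub>R b i), (\<Sum>i\<le>m. Im (ep i * om i) *\<^sub>R b i))"
      have "ka w i = om i" for i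
      proof (cases "i \<le> m")
        case True
        have "ka w i = u i * (complex_of_real (Re (ep i * om i)) + \<i> * complex_of_real (Im (ep i * om i)))"
          using co_sum[OF True] by (simp add: ka_def w_def)
        also have "\<dots> = u i * (ep i * om i)" by (simp only: complex_eq[symmetric])
        also have "\<dots> = (ep i * u i) * om i" by (simp only: mult_ac)
        finally show ?thesis by (simp add: epu)
      qed (use om ka0 in simp)
      then show ?thesis by blast
    qed
    have "c \<in> complex_spectrum (S v) \<longleftrightarrow> c \<in> spectrum m (A (Z (co v)))" for c
    proof
      assume "c \<in> complex_spectrum (S v)"
      then obtain w where w: "w \<noteq> 0" "map_prod (S v) (S v) w = complex_scale c w" 
        by (auto simp: complex_spectrum_def)
      have "A (Z (co v)) (ka w) = (\<lambda>i. c * ka w i)" using kaS[of w] ka_scale[of c w] w(2) by simp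
      moreover have "ka w \<noteq> (\<lambda>i. 0)" using ka_inj[of w 0] ka_z w(1) by auto
      ultimately show "c \<in> spectrum m (A (Z (co v)))" using ka0 unfolding spectrum_def by blast
    next
      assume "c \<in> spectrum m (A (Z (co v)))"
      then obtain om where om: "om \<noteq> (\<lambda>i. 0)" "\<forall>i>m. om i = 0" "A (Z (co v)) om = (\<lambda>i. c * om i)"
        by (auto simp: spectrum_def)
      obtain w where w: "ka w = om" using ka_surj[OF om(2)] by blast
      have "ka (map_prod (S v) (S v) w) = ka (complex_scale c w)" using kaS ka_scale om(3) w by simp
      then have "map_prod (S v) (S v) w = complex_scale c w" by (rule ka_inj)
      moreover have "w \<noteq> 0" using w om(1) ka_z by auto
      ultimately show "c \<in> complex_spectrum (S v)" unfolding complex_spectrum_def by blast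
    qed
    then show ?thesis by blast
  qed
  obtain \<Sigma> where \<Sigma>: "\<And>v. g v v = 1 \<Longrightarrow> complex_spectrum (S v) = \<Sigma>"
    using sz unfolding spacelike_szabo_def constant_on_def spacelike_sphere_def S_def by auto
  have "spectrum m (A (Z (co v))) \<subseteq> {0}"
    unfolding A_def Z_def
  proof (rule isospectral_imp_nilpotent[where n = n and \<Sigma> = \<Sigma>, folded m_def])
    show "polyf (\<lambda>z. M z i j)" for i j
    proof (cases "i \<le> m \<and> j \<le> m")
      case True
      then show ?thesis unfolding M_def by simp (intro polyf_sum polyf_mult polyf_const polyf_coord)
    next
      case False
      then have "(\<lambda>z. M z i j) = (\<lambda>z. 0)" by (auto simp: M_def)
      then show ?thesis by (simp add: polyf_const)
    qed
    show "M z i j = M z j i" for z i j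
    proof (cases "i \<le> m \<and> j \<le> m")
      case True
      \<comment> \<open>Reversing the first four arguments of \<open>R\<close> exchanges
        \<open>i\<close> with \<open>j\<close> and also \<open>a\<close> with \<open>c\<close>; the
        second exchange is undone by swapping the sums.\<close>
      have t: "T i a c j d * (z a * z c * z d) = T j c a i d * (z c * z a * z d)" for a c d
        unfolding T_def using Rsym[of "b i" "b a" "b c" "b j" "b d"] by (simp add: mult_ac)
      have "M z i j = (\<Sum>c\<le>m. \<Sum>a\<le>m. \<Sum>d\<le>m. T j c a i d * (z c * z a * z d))"
        using True by (simp add: M_def t)
      also have "\<dots> = (\<Sum>a\<le>m. \<Sum>c\<le>m. \<Sum>d\<le>m. T j c a i d * (z c * z a * z d))" by (rule sum.swap)
      also have "\<dots> = M z j i" using True by (simp add: M_def)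
      finally show ?thesis .
    qed (auto simp: M_def)
    show "M (\<lambda>i. t * z i) i j = t ^ 3 * M z i j" for t z i j
      by (simp add: M_def sum_distrib_left power3_eq_cube mult_ac)
    show "apply_matrix m (M z) z = (\<lambda>i. 0)" for z
    proof
      fix i
      show "apply_matrix m (M z) z i = 0"
      proof (cases "i \<le> m")
        case True
        \<comment> \<open>Applying \<open>M z\<close> to \<open>z\<close> puts \<open>z\<close> into
          both slots of the second antisymmetric pair of \<open>R\<close>, so the terms for
          \<open>k\<close> and \<open>c\<close> cancel in pairs.\<close>
        define f where "f k c = (\<Sum>a\<le>m. \<Sum>d\<le>m. T i a c k d * (z a * z c * z d) * z k)" for k c
        have "f k c = - f c k" for k c
        proof -
          have "T i a c k d * (z a * z c * z d) * z k = - (T i a k c d * (z a * z k * z d) * z c)" for a d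
            unfolding T_def using Ranti2[of "b i" "b a" "b c" "b k" "b d"] by (simp add: mult_ac)
          then show ?thesis by (simp add: f_def sum_negf)
        qed
        then have "(\<Sum>k\<le>m. \<Sum>c\<le>m. f k c) = 0" by (rule sum_antisymmetric)
        moreover have "apply_matrix m (M z) z i = (\<Sum>k\<le>m. \<Sum>c\<le>m. f k c)"
          using True by (simp add: apply_matrix_def M_def f_def sum_distrib_right)
        ultimately show ?thesis by simp
      qed (simp add: apply_matrix_def)
    qed
    show "u i * u i = 1 \<or> u i * u i = -1" for i by (simp add: u_def)
    show "u m = 1" using e be by (simp add: u_def et_def m_def)
    show "spectrum m (apply_matrix m (M (\<lambda>i. u i * complex_of_real (y i)))) = \<Sigma>"
      if y: "\<And>i. i > m \<Longrightarrow> y i = 0" 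
        and N: "(\<Sum>i\<le>m. u i * complex_of_real (y i) * (u i * complex_of_real (y i))) = 1" for y
    proof -
      define x where "x = (\<Sum>i\<le>m. y i *\<^sub>R b i)"
      have cx: "co x = y"
      proof
        fix i show "co x i = y i" using co_sum[of i y] y[of i] by (cases "i \<le> m") (auto simp: x_def co_def)
      qed
      have "g x x = (\<Sum>i\<le>m. y i * g x (b i))"
        by (subst (2) x_def) (simp add: linear_sum[OF l2] linear_scale[OF l2])
      also have "\<dots> = (\<Sum>i\<le>m. et i * y i * y i)"
        using gsum[of _ y] by (intro sum.cong) (auto simp: x_def mult_ac)
      finally have gx: "g x x = (\<Sum>i\<le>m. et i * y i * y i)" .
      have "complex_of_real (g x x) = (\<Sum>i\<le>m. (u i * u i) * complex_of_real (y i) * complex_of_real (y i))"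
        unfolding gx of_real_sum by (intro sum.cong refl) (simp add: ep2)
      also have "\<dots> = 1" using N by (simp add: mult_ac)
      finally have "g x x = 1" by (simp only: of_real_eq_1_iff)
      then have "spectrum m (A (Z (co x))) = \<Sigma>" using \<Sigma> spec by blast
      then show ?thesis by (simp add: cx A_def Z_def)
    qed
    show "co v i = 0" if "i > m" for i using that by (simp add: co_def)
  qed
  then show ?thesis using spec[of v] by (simp add: S_def)
qed


text \<open>Replacing \<open>g\<close> by its negative exchanges the pseudo-spheres and negates the
  Szabo operator, which reduces the timelike case to the spacelike one.\<close>

lemma szabo_tensor_nilpotent:
  fixes g :: "'a::real_vector \<Rightarrow> 'a \<Rightarrow> real"
    and R :: "'a \<Rightarrow> 'a \<Rightarrow> 'a \<Rightarrow> 'a \<Rightarrow> 'a \<Rightarrow> real"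
  assumes fin: "\<exists>B. finite B \<and> span B = (UNIV :: 'a set)"
    and g: "nondegenerate_inner_product g" and dim: "dim (UNIV :: 'a set) \<ge> 2"
    and e: "g e e = 1" and e': "g e' e' = -1" and sz: "szabo_tensor g R"
  shows "complex_spectrum (szabo_operator g R v) \<subseteq> {0}"
proof -
  have R: "covariant_derivative_curvature_tensor R" using sz by (simp add: szabo_tensor_def)
  then have ml: "multilinear5 R" by (simp add: covariant_derivative_curvature_tensor_def)
  show ?thesis
  proof (cases "spacelike_szabo g R")
    case True
    then show ?thesis by (rule spacelike_szabo_nilpotent[OF fin g dim e R])
  next
    case False
    define h where "h x y = - g x y" for x y
    have "bilinear h"
      using g unfolding nondegenerate_inner_product_def bilinear_def h_def by (auto intro: linear_compose_neg)
    then have h: "nondegenerate_inner_product h"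
      using g by (simp add: nondegenerate_inner_product_def h_def)
    have op: "szabo_operator h R v = (\<lambda>y. - szabo_operator g R v y)" for v
    proof (rule szabo_operator_unique[OF fin h ml])
      show "linear (\<lambda>y. - szabo_operator g R v y)"
        by (rule linear_compose_neg) (rule szabo_operator(1)[OF fin g ml])
      have "linear (\<lambda>x. g x z)" for z using g by (auto simp: nondegenerate_inner_product_def bilinear_def)
      then show "h (- szabo_operator g R v y) z = R y v v z v" for y z
        using szabo_operator(2)[OF fin g ml, of v y z] by (simp add: h_def linear_neg[of "\<lambda>x. g x z"])
    qed
    have "timelike_szabo g R" using sz False by (simp add: szabo_tensor_def)
    then obtain T where T: "\<And>v. g v v = -1 \<Longrightarrow> complex_spectrum (szabo_operator g R v) = T"
      unfolding timelike_szabo_def constant_on_def timelike_sphere_def by auto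
    have "spacelike_szabo h R"
      unfolding spacelike_szabo_def constant_on_def
    proof (intro exI ballI)
      fix v assume "v \<in> spacelike_sphere h"
      then have "g v v = -1" by (simp add: spacelike_sphere_def h_def)
      then show "complex_spectrum (szabo_operator h R v) = uminus ` T"
        using T by (simp add: op complex_spectrum_neg)
    qed
    moreover have "h e' e' = 1" using e' by (simp add: h_def)
    ultimately have "complex_spectrum (szabo_operator h R v) \<subseteq> {0}"
      using spacelike_szabo_nilpotent[OF fin h dim _ R] by blast
    then have "uminus ` complex_spectrum (szabo_operator g R v) \<subseteq> {0}" by (simp add: op complex_spectrum_neg)
    then show ?thesis by auto
  qed
qed

text \<open>Without a vector of positive square, \<open>{0}\<close> is the only spacelike subspace
  and hence a maximal one, contradicting \<open>q > 0\<close>; negative squares are treated in the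
  same way.\<close>

lemma exists_unit_vectors:
  fixes g :: "'a::real_vector \<Rightarrow> 'a \<Rightarrow> real"
  assumes g: "nondegenerate_inner_product g" and sig: "has_signature g p q" and "p > 0" "q > 0"
  shows "\<exists>e. g e e = 1" "\<exists>e. g e e = -1"
proof -
  have l1: "linear (\<lambda>x. g x y)" and l2: "linear (g x)" for x y
    using g by (auto simp: nondegenerate_inner_product_def bilinear_def)
  have sc: "g (c *\<^sub>R x) (c *\<^sub>R x) = c * c * g x x" for c x
    by (simp add: linear_scale[OF l1] linear_scale[OF l2])
  have zero: "U = {0}" if "subspace U" "\<And>x. x \<in> U \<Longrightarrow> x \<noteq> 0 \<Longrightarrow> False" for U :: "'a set"
    using that subspace_0 by blast
  have "\<exists>x. g x x > 0"
  proof (rule ccontr)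
    assume n: "\<not> ?thesis"
    then have "U = {0}" if "spacelike_subspace g U" for U 
      using zero[of U] that unfolding spacelike_subspace_def by blast
    moreover have "spacelike_subspace g {0}" by (simp add: spacelike_subspace_def)
    ultimately have "dim ({0} :: 'a set) = q" using sig unfolding has_signature_def by blast
    then show False using \<open>q > 0\<close> dim_eq_card[of "{}" "{0 :: 'a}"] by (simp add: independent_empty)
  qed
  then obtain x where x: "g x x > 0" by blast
  have "g ((1 / sqrt (g x x)) *\<^sub>R x) ((1 / sqrt (g x x)) *\<^sub>R x) = 1"
    unfolding sc using x by simp
  then show "\<exists>e. g e e = 1" by blast
  have "\<exists>x. g x x < 0"
  proof (rule ccontr)
    assume n: "\<not> ?thesis"
    then have "U = {0}" if "timelike_subspace g U" for U 
      using zero[of U] that unfolding timelike_subspace_def by blast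
    moreover have "timelike_subspace g {0}" by (simp add: timelike_subspace_def)
    ultimately have "dim ({0} :: 'a set) = p" using sig unfolding has_signature_def by blast
    then show False using \<open>p > 0\<close> dim_eq_card[of "{}" "{0 :: 'a}"] by (simp add: independent_empty)
  qed
  then obtain y where y: "g y y < 0" by blast
  have "g ((1 / sqrt (- g y y)) *\<^sub>R y) ((1 / sqrt (- g y y)) *\<^sub>R y) = -1"
    unfolding sc using y by simp
  then show "\<exists>e. g e e = -1" by blast
qed

theorem theorem1p3:
  fixes g :: "'a::real_vector \<Rightarrow> 'a \<Rightarrow> real"
    and R :: "'a \<Rightarrow> 'a \<Rightarrow> 'a \<Rightarrow> 'a \<Rightarrow> 'a \<Rightarrow> real"
    and p q :: nat
  assumes "\<exists>B. finite B \<and> span B = (UNIV :: 'a set)"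
    and "nondegenerate_inner_product g"
    and "has_signature g p q"
    and "p \<ge> 2" and "q \<ge> 2"
    and "szabo_tensor g R"
  shows "(spec_plus g R = uminus ` spec_plus g R \<and>
          spec_plus g R = (*) \<i> ` spec_minus g R \<and>
          spec_minus g R = uminus ` spec_minus g R \<and>
          spec_minus g R = (*) \<i> ` spec_plus g R) \<and>
         (spec_plus g R \<subseteq> \<real> \<union> (*) \<i> ` \<real> \<and>
          spec_minus g R \<subseteq> \<real> \<union> (*) \<i> ` \<real>) \<and>
         (p < q \<longrightarrow> spec_plus g R \<subseteq> (*) \<i> ` \<real> \<and> spec_minus g R \<subseteq> \<real>) \<and>
         (q < p \<longrightarrow> spec_plus g R \<subseteq> \<real> \<and> spec_minus g R \<subseteq> (*) \<i> ` \<real>)"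
proof -
  have R: "covariant_derivative_curvature_tensor R" using assms(6) by (simp add: szabo_tensor_def)
  then have ml: "multilinear5 R" by (simp add: covariant_derivative_curvature_tensor_def)
  have anti: "R x y z w v = - R y x z w v" for x y z w v
    using R unfolding covariant_derivative_curvature_tensor_def by blast
  have l1: "linear (\<lambda>x. g x y)" for y
    using assms(2) by (auto simp: nondegenerate_inner_product_def bilinear_def)
  obtain e where e: "g e e = 1" using exists_unit_vectors(1)[OF assms(2,3)] assms(4,5) by auto
  obtain e' where e': "g e' e' = -1" using exists_unit_vectors(2)[OF assms(2,3)] assms(4,5) by auto
  have "dim (UNIV :: 'a set) = p + q" using assms(3) unfolding has_signature_def by blast
  then have dim: "dim (UNIV :: 'a set) \<ge> 2" using assms(4) by simp
  \<comment> \<open>Antisymmetry of \<open>R\<close> in its first pair makes the non-zero vector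
    \<open>v\<close> an eigenvector for 0, so the spectrum is not only contained in
    \<open>{0}\<close> but equal to it.\<close>
  have spec: "complex_spectrum (szabo_operator g R v) = {0}" if v: "g v v \<noteq> 0" for v
  proof -
    have "g (szabo_operator g R v v) z = 0" for z
      using szabo_operator(2)[OF assms(1,2) ml, of v v z] anti[of v v v z v] by simp
    then have "szabo_operator g R v v = 0" using assms(2) unfolding nondegenerate_inner_product_def by blast
    moreover have "v \<noteq> 0" using v linear_0[OF l1] by auto
    moreover have "szabo_operator g R v 0 = 0" by (rule linear_0[OF szabo_operator(1)[OF assms(1,2) ml]])
    ultimately have "0 \<in> complex_spectrum (szabo_operator g R v)" by (intro zero_in_complex_spectrum)
    then show ?thesis using szabo_tensor_nilpotent[OF assms(1,2) dim e e' assms(6), of v] by blast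
  qed
  \<comment> \<open>The vector \<open>e\<close> makes the pseudo-sphere nonempty, which gives the
    uniqueness needed for the definite description; \<open>e'\<close> does the same for
    \<open>spec_minus\<close>.\<close>
  have "spec_plus g R = {0}"
    unfolding spec_plus_def
  proof (rule the_equality)
    show "\<forall>v\<in>spacelike_sphere g. complex_spectrum (szabo_operator g R v) = {0}"
      using spec by (simp add: spacelike_sphere_def)
    show "T = {0}" if "\<forall>v\<in>spacelike_sphere g. complex_spectrum (szabo_operator g R v) = T" for T
      using that spec[of e] e by (simp add: spacelike_sphere_def)
  qed
  moreover have "spec_minus g R = {0}"
    unfolding spec_minus_def
  proof (rule the_equality)
    show "\<forall>v\<in>timelike_sphere g. complex_spectrum (szabo_operator g R v) = {0}"
      using spec by (simp add: timelike_sphere_def)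
    show "T = {0}" if "\<forall>v\<in>timelike_sphere g. complex_spectrum (szabo_operator g R v) = T" for T
      using that spec[of e'] e' by (simp add: timelike_sphere_def)
  qed
  moreover have "(0 :: complex) \<in> (*) \<i> ` \<real>" by (rule image_eqI[of _ _ 0]) simp_all
  ultimately show ?thesis by simp
qed

end
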